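(* Let $V=(M_\psi\otimes K^* )\mathscr V(M_\psi\otimes K)$ with $\nu_0>1$, $0\le\mathscr V\in\mathcal B(\ell^2(\mathbb Z_h,\mathcal G))$ and $K\in\mathfrak S_2(\mathcal G)$. Then the spectral shift functions $\xi(\cdot;H^\pm,H_Q)$ are bounded on compact subsets of $\mathbb R\setminus\mathscr E_Q$: for every compact $\Gamma\subset\mathbb R\setminus\mathscr E_Q$, $$\sup_{\lambda\in\Gamma}|\xi(\lambda;H^\pm,H_Q)|<+\infty .$$
   Context: Let $h>0$, $\mathbb Z_h=\{hn:n\in\mathbb Z\}$, and let $\mathcal G$ be a separable complex Hilbert space. $\ell^2(\mathbb Z_h)=\ell^2(\mathbb Z_h,\mathbb C)$ has scalar product $\langle\varphi,\phi\rangle=\sum_{n\in\mathbb Z}\overline{\varphi(hn)}\phi(hn)$, and $\ell^2(\mathbb Z_h,\mathcal G)$ is identified with $\ell^2(\mathbb Z_h)\otimes\mathcal G$. On $\ell^2(\mathbb Z_h)$, $(-\Delta_h\phi)(hn)=h^{-2}\big(2\phi(hn)-\phi(h(n+1))-\phi(h(n-1))\big)$, whose spectrum is $[0,4/h^2]$. $Q$ is a self-adjoint operator on $\mathcal G$ such that either $Q=0$, or $Q\ne0$ and $\mathcal G=\bigoplus_{s=1}^d\mathrm{Ker}(Q-\mu_s)$ with $d<+\infty$ and $\mu_1,\dots,\mu_d$ the distinct (real) eigenvalues of $Q$. $H_Q=-\Delta_h\otimes I_{\mathcal G}+I_{\ell^2(\mathbb Z_h)}\otimes Q$. The threshold set is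 $\mathscr E_Q=\{0,4/h^2\}$ if $Q=0$ and $\mathscr E_Q=\{\mu_s,\mu_s+4/h^2\}_{s=1}^d$ if $Q\neq0$. $\mathfrak S_p$ denotes the Schatten class of order $p$. $\langle n\rangle=(1+n^2)^{1/2}$, $\psi(hn)=\langle n\rangle^{-\nu_0/2}$, and $M_\psi$ is multiplication by $\psi$ on $\ell^2(\mathbb Z_h)$. $H^\pm=H_Q\pm V$. Spectral shift function: put $\mathscr M=\mathscr V^{1/2}(M_\psi\otimes K)\in\mathfrak S_2$ (so $V=\mathscr M^*\mathscr M$ is trace class) and $T(z)=\mathscr M(H_Q-z)^{-1}\mathscr M^*$. For each $\lambda\in\mathbb R\setminus\mathscr E_Q$ the limit $T(\lambda+i0)=\lim_{\varepsilon\searrow0}T(\lambda+i\varepsilon)$ exists in $\mathfrak S_2$; let $A(\lambda+i0)$ and $B(\lambda+i0)$ be its real and imaginary (self-adjoint) parts, $0\le B(\lambda+i0)\in\mathfrak S_1$. For a compact self-adjoint operator $S$ and $r>0$ let $\mathscr N_\pm(r,S)=\mathrm{Rank}\,\mathbf 1_{(r,\infty)}(\pm S)$. The SSF (whose class in $L^1(\mathbb R)$ is determined by $\mathrm{Tr}(f(H^\pm)-f(H_Q))=\int_{\mathbb R}\xi(\lambda;H^\pm,H_Q)f'(\lambda)\,d\lambda$, $f\in C_0^\infty(\mathbb R)$) is identified with the representative defined for every $\lambda\in\mathbb R\setminus\mathscr E_Q$ by $$\xi(\lambda;H^\pm,H_Q)=\pm\frac1\pi\int_{\mathbb R}\mathscr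 N_\mp\big(1,A(\lambda+i0)+tB(\lambda+i0)\big)\frac{dt}{1+t^2}.$$ *)

theory Defs
  imports "HOL-Analysis.Analysis"
begin

section \<open>Complex Hilbert spaces\<close>

class scaleC =
  fixes scaleC :: "complex \<Rightarrow> 'a \<Rightarrow> 'a" (infixr "*\<^sub>C" 75)

text \<open>A complex Hilbert space is a real one carrying a compatible complex structure. The scalar
  product is antilinear in the \<^emph>\<open>first\<close> argument, and its real part is the real inner product, so
  norm and topology are those of \<^class>\<open>real_inner\<close>.\<close>

class complex_hilbert = real_inner + complete_space + scaleC +
  fixes cinner :: "'a \<Rightarrow> 'a \<Rightarrow> complex"
  assumes scaleC_add_right: "c *\<^sub>C (x + y) = c *\<^sub>C x + c *\<^sub>C y"
    and scaleC_add_left: "(c + d) *\<^sub>C x = c *\<^sub>C x + d *\<^sub>C x"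
    and scaleC_scaleC: "c *\<^sub>C d *\<^sub>C x = (c * d) *\<^sub>C x"
    and scaleR_scaleC: "r *\<^sub>R x = complex_of_real r *\<^sub>C x"
    and cinner_commute: "cinner y x = cnj (cinner x y)"
    and cinner_add_right: "cinner x (y + z) = cinner x y + cinner x z"
    and cinner_scaleC_right: "cinner x (c *\<^sub>C y) = c * cinner x y"
    and inner_eq_Re_cinner: "inner x y = Re (cinner x y)"

lemma scaleC_one: "1 *\<^sub>C x = (x :: 'a::complex_hilbert)"
  using scaleR_scaleC[of 1 x] by simp

global_interpretation cvec: vector_space "scaleC :: complex \<Rightarrow> 'a \<Rightarrow> 'a::complex_hilbert"
  defines cspan_raw_def: cspan = cvec.span
    and cdependent_raw_def: cdependent = cvec.dependent
    and crepresentation_raw_def: crepresentation = cvec.representation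
    and csubspace_raw_def: csubspace = cvec.subspace
    and cextend_basis_raw_def: cextend_basis = cvec.extend_basis
    and cdim_raw_def: cdim = cvec.dim
  by unfold_locales (simp_all add: scaleC_add_right scaleC_add_left scaleC_scaleC scaleC_one)

lemma cinner_self: "cinner x x = complex_of_real ((norm (x :: 'a::complex_hilbert))\<^sup>2)"
proof -
  have "Im (cinner x x) = 0"
    using cinner_commute[of x x] by (metis cnj.simps(2) equal_neg_zero)
  moreover have "Re (cinner x x) = (norm x)\<^sup>2"
    by (metis inner_eq_Re_cinner power2_norm_eq_inner)
  ultimately show ?thesis by (simp add: complex_eq_iff)
qed

lemma cinner_scaleC_left: "cinner (c *\<^sub>C x) y = cnj c * cinner x (y :: 'a::complex_hilbert)"
  by (metis cinner_commute cinner_scaleC_right complex_cnj_mult)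

lemma cinner_add_left: "cinner (x + y) z = cinner x z + cinner y (z :: 'a::complex_hilbert)"
  by (metis cinner_commute cinner_add_right complex_cnj_add)

lemma norm_scaleC: "norm (c *\<^sub>C x) = cmod c * norm (x :: 'a::complex_hilbert)"
proof -
  have "complex_of_real ((norm (c *\<^sub>C x))\<^sup>2) = complex_of_real ((cmod c * norm x)\<^sup>2)"
    unfolding cinner_self[symmetric] cinner_scaleC_left cinner_scaleC_right
    by (simp add: cinner_self power_mult_distrib complex_norm_square[of c, simplified] mult_ac)
  then have "(norm (c *\<^sub>C x))\<^sup>2 = (cmod c * norm x)\<^sup>2" by (simp only: of_real_eq_iff)
  then show ?thesis by (simp add: power2_eq_iff_nonneg)
qed

lemma cmod_cinner_le: "cmod (cinner x y) \<le> norm x * norm (y :: 'a::complex_hilbert)"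
proof (cases "cinner x y = 0")
  case False
  define c where "c = cnj (cinner x y) / cmod (cinner x y)"
  have c: "cmod c = 1" using False by (simp add: c_def norm_divide)
  have "c * cinner x y = cmod (cinner x y)"
    using False by (simp add: c_def mult.commute[of "cnj _"] complex_norm_square[symmetric] power2_eq_square)
  then have "cmod (cinner x y) = inner x (c *\<^sub>C y)"
    by (simp add: inner_eq_Re_cinner cinner_scaleC_right)
  also have "\<dots> \<le> norm x * norm (c *\<^sub>C y)" by (rule norm_cauchy_schwarz)
  finally show ?thesis by (simp add: norm_scaleC c)
qed simp

instantiation complex :: complex_hilbert
begin
definition scaleC_complex :: "complex \<Rightarrow> complex \<Rightarrow> complex" where "scaleC_complex c x = c * x"
definition cinner_complex :: "complex \<Rightarrow> complex \<Rightarrow> complex" where "cinner_complex x y = cnj x * y"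
instance
  by standard (auto simp: scaleC_complex_def cinner_complex_def algebra_simps scaleR_conv_of_real
      inner_complex_def)
end

section \<open>Square-summable functions on the lattice\<close>

text \<open>A function \<open>\<phi>\<close> on the lattice \<open>h\<int>\<close> is represented by the sequence \<open>n \<mapsto> \<phi>(hn)\<close>; the step \<open>h\<close>
  enters only through the Laplacian.\<close>

typedef (overloaded) 'g ell2 =
  "{\<phi> :: int \<Rightarrow> 'g::complex_hilbert. (\<lambda>n. (norm (\<phi> n))\<^sup>2) summable_on UNIV}"
  morphisms ell2_apply Abs_ell2
  by (rule exI[of _ "\<lambda>_. 0"]) simp

setup_lifting type_definition_ell2

lemma ell2_eqI: "(\<And>n. ell2_apply \<phi> n = ell2_apply \<phi>' n) \<Longrightarrow> \<phi> = \<phi>'"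
  by transfer auto

lemma ell2_summable: "(\<lambda>n. (norm (ell2_apply \<phi> n))\<^sup>2) summable_on UNIV"
  by transfer

lemma sq_summable_add:
  fixes f g :: "'i \<Rightarrow> 'a::real_normed_vector"
  assumes "(\<lambda>n. (norm (f n))\<^sup>2) summable_on A" "(\<lambda>n. (norm (g n))\<^sup>2) summable_on A"
  shows "(\<lambda>n. (norm (f n + g n))\<^sup>2) summable_on A"
proof (rule summable_on_comparison_test)
  show "(\<lambda>n. 2 * (norm (f n))\<^sup>2 + 2 * (norm (g n))\<^sup>2) summable_on A"
    by (intro summable_on_add summable_on_cmult_right assms)
  fix n
  have "(norm (f n + g n))\<^sup>2 \<le> (norm (f n) + norm (g n))\<^sup>2"
    by (intro power_mono norm_triangle_ineq) auto
  also have "\<dots> \<le> 2 * (norm (f n))\<^sup>2 + 2 * (norm (g n))\<^sup>2"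
    using sum_squares_bound[of "norm (f n)" "norm (g n)"] by (simp add: power2_sum)
  finally show "(norm (f n + g n))\<^sup>2 \<le> 2 * (norm (f n))\<^sup>2 + 2 * (norm (g n))\<^sup>2" .
qed auto

lemma sq_summable_bound:
  fixes f :: "'i \<Rightarrow> 'a::real_normed_vector" and g :: "'i \<Rightarrow> 'b::real_normed_vector"
  assumes "(\<lambda>n. (norm (f n))\<^sup>2) summable_on A" "\<And>n. norm (g n) \<le> c * norm (f n)"
  shows "(\<lambda>n. (norm (g n))\<^sup>2) summable_on A"
proof (rule summable_on_comparison_test)
  show "(\<lambda>n. c\<^sup>2 * (norm (f n))\<^sup>2) summable_on A"
    by (intro summable_on_cmult_right assms)
  show "(norm (g n))\<^sup>2 \<le> c\<^sup>2 * (norm (f n))\<^sup>2" for n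
    using power_mono[OF assms(2)[of n], of 2] by (simp add: power_mult_distrib)
qed auto

lemma cinner_summable:
  fixes f g :: "'i \<Rightarrow> 'a::complex_hilbert"
  assumes "(\<lambda>n. (norm (f n))\<^sup>2) summable_on A" "(\<lambda>n. (norm (g n))\<^sup>2) summable_on A"
  shows "(\<lambda>n. cinner (f n) (g n)) summable_on A"
proof -
  have "(\<lambda>n. norm (cinner (f n) (g n))) summable_on A"
  proof (rule summable_on_comparison_test)
    show "(\<lambda>n. (norm (f n))\<^sup>2 + (norm (g n))\<^sup>2) summable_on A"
      by (intro summable_on_add assms)
    fix n
    have "norm (cinner (f n) (g n)) \<le> norm (f n) * norm (g n)" by (rule cmod_cinner_le)
    also have "\<dots> \<le> (norm (f n))\<^sup>2 + (norm (g n))\<^sup>2"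
      using sum_squares_bound[of "norm (f n)" "norm (g n)"]
        mult_nonneg_nonneg[OF norm_ge_zero[of "f n"] norm_ge_zero[of "g n"]]
      unfolding mult.assoc by linarith
    finally show "norm (cinner (f n) (g n)) \<le> (norm (f n))\<^sup>2 + (norm (g n))\<^sup>2" .
  qed auto
  then show ?thesis by (rule abs_summable_summable)
qed

instantiation ell2 :: (complex_hilbert) real_inner
begin

lift_definition zero_ell2 :: "'a ell2" is "\<lambda>_. 0" by simp
lift_definition plus_ell2 :: "'a ell2 \<Rightarrow> 'a ell2 \<Rightarrow> 'a ell2" is "\<lambda>f g n. f n + g n"
  by (rule sq_summable_add)
lift_definition uminus_ell2 :: "'a ell2 \<Rightarrow> 'a ell2" is "\<lambda>f n. - f n" by simp
lift_definition minus_ell2 :: "'a ell2 \<Rightarrow> 'a ell2 \<Rightarrow> 'a ell2" is "\<lambda>f g n. f n - g n"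
  using sq_summable_add[of _ UNIV "\<lambda>n. - _ n"] by simp
lift_definition scaleR_ell2 :: "real \<Rightarrow> 'a ell2 \<Rightarrow> 'a ell2" is "\<lambda>r f n. r *\<^sub>R f n"
  by (rule sq_summable_bound) auto

definition inner_ell2 :: "'a ell2 \<Rightarrow> 'a ell2 \<Rightarrow> real" where
  "inner_ell2 f g = Re (\<Sum>\<^sub>\<infinity>n. cinner (ell2_apply f n) (ell2_apply g n))"
definition norm_ell2 :: "'a ell2 \<Rightarrow> real" where "norm_ell2 f = sqrt (inner f f)"
definition sgn_ell2 :: "'a ell2 \<Rightarrow> 'a ell2" where "sgn_ell2 f = scaleR (inverse (norm f)) f"
definition dist_ell2 :: "'a ell2 \<Rightarrow> 'a ell2 \<Rightarrow> real" where "dist_ell2 f g = norm (f - g)"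
definition uniformity_ell2 :: "('a ell2 \<times> 'a ell2) filter" where
  "uniformity_ell2 = (INF e\<in>{0<..}. principal {(x, y). dist x y < e})"
definition open_ell2 :: "'a ell2 set \<Rightarrow> bool" where
  "open_ell2 U \<longleftrightarrow> (\<forall>x\<in>U. eventually (\<lambda>(x', y). x' = x \<longrightarrow> y \<in> U) uniformity)"

lemma inner_ell2_alt: "inner f g = (\<Sum>\<^sub>\<infinity>n. inner (ell2_apply f n) (ell2_apply g n))"
  unfolding inner_ell2_def inner_eq_Re_cinner
  by (intro infsum_Re[symmetric] cinner_summable ell2_summable)

lemma inner_ell2_summable: "(\<lambda>n. inner (ell2_apply f n) (ell2_apply g n)) summable_on UNIV"
  unfolding inner_eq_Re_cinner by (intro summable_on_Re cinner_summable ell2_summable)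

instance
proof
  fix x y z :: "'a ell2" and r s :: real
  show "x + y + z = x + (y + z)" "x + y = y + x" "0 + x = x" "- x + x = 0" "x - y = x + - y"
    "r *\<^sub>R (x + y) = r *\<^sub>R x + r *\<^sub>R y" "(r + s) *\<^sub>R x = r *\<^sub>R x + s *\<^sub>R x"
    "r *\<^sub>R s *\<^sub>R x = (r * s) *\<^sub>R x" "1 *\<^sub>R x = x"
    by (transfer; simp add: algebra_simps)+
  show "inner x y = inner y x" by (simp add: inner_ell2_alt inner_commute)
  show "inner (x + y) z = inner x z + inner y z"
    using inner_ell2_summable[of x z] inner_ell2_summable[of y z]
    by (simp add: inner_ell2_alt plus_ell2.rep_eq inner_add_left infsum_add)
  show "inner (r *\<^sub>R x) y = r * inner x y"
    by (simp add: inner_ell2_alt scaleR_ell2.rep_eq infsum_cmult_right')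
  show "0 \<le> inner x x" by (simp add: inner_ell2_alt infsum_nonneg)
  show "inner x x = 0 \<longleftrightarrow> x = 0"
  proof
    assume *: "inner x x = 0"
    show "x = 0"
    proof (rule ell2_eqI)
      fix n
      have "inner (ell2_apply x n) (ell2_apply x n) = 0"
        by (rule nonneg_infsum_le_0D[where A = UNIV])
          (use * inner_ell2_summable[of x x] in \<open>auto simp: inner_ell2_alt\<close>)
      then show "ell2_apply x n = ell2_apply 0 n" by (simp add: zero_ell2.rep_eq)
    qed
  qed (simp add: inner_ell2_alt zero_ell2.rep_eq)
qed (rule norm_ell2_def sgn_ell2_def dist_ell2_def uniformity_ell2_def open_ell2_def)+

end

lemma norm_ell2_sq: "(norm \<phi>)\<^sup>2 = (\<Sum>\<^sub>\<infinity>n. (norm (ell2_apply \<phi> n))\<^sup>2)"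
  by (simp add: power2_norm_eq_inner inner_ell2_alt)

lemma norm_ell2_finite_le: "finite F \<Longrightarrow> (\<Sum>n\<in>F. (norm (ell2_apply \<phi> n))\<^sup>2) \<le> (norm \<phi>)\<^sup>2"
  unfolding norm_ell2_sq by (rule finite_sum_le_infsum) (auto intro: ell2_summable)

lemma norm_ell2_apply_le: "norm (ell2_apply \<phi> n) \<le> norm \<phi>"
  using norm_ell2_finite_le[of "{n}" \<phi>] by (simp add: power2_le_iff_abs_le)

lemma norm_ell2_leI:
  assumes "0 \<le> c" "\<And>F. finite F \<Longrightarrow> (\<Sum>n\<in>F. (norm (ell2_apply \<phi> n))\<^sup>2) \<le> c\<^sup>2"
  shows "norm \<phi> \<le> c"
proof -
  have "(norm \<phi>)\<^sup>2 \<le> c\<^sup>2"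
    unfolding norm_ell2_sq by (rule infsum_le_finite_sums) (auto intro: ell2_summable assms)
  then show ?thesis using assms(1) by (simp add: power2_le_iff_abs_le)
qed

instance ell2 :: (complex_hilbert) complete_space
proof
  fix X :: "nat \<Rightarrow> 'a ell2" assume X: "Cauchy X"
  have "Cauchy (\<lambda>i. ell2_apply (X i) n)" for n
    unfolding Cauchy_def
  proof (intro allI impI)
    fix e :: real assume "0 < e"
    then obtain M where M: "\<And>i j. i \<ge> M \<Longrightarrow> j \<ge> M \<Longrightarrow> dist (X i) (X j) < e"
      using X unfolding Cauchy_def by blast
    have "dist (ell2_apply (X i) n) (ell2_apply (X j) n) < e" if "i \<ge> M" "j \<ge> M" for i j
      using norm_ell2_apply_le[of "X i - X j" n] M[OF that] by (simp add: dist_norm minus_ell2.rep_eq)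
    then show "\<exists>M. \<forall>i\<ge>M. \<forall>j\<ge>M. dist (ell2_apply (X i) n) (ell2_apply (X j) n) < e" by blast
  qed
  then have "\<exists>l. (\<lambda>i. ell2_apply (X i) n) \<longlonglongrightarrow> l" for n
    by (simp add: Cauchy_convergent_iff convergent_def)
  then obtain l where l: "\<And>n. (\<lambda>i. ell2_apply (X i) n) \<longlonglongrightarrow> l n" by metis
  have bd: "(\<Sum>n\<in>F. (norm (ell2_apply (X i) n - l n))\<^sup>2) \<le> e\<^sup>2"
    if "finite F" "i \<ge> M" and M: "\<And>i j. i \<ge> M \<Longrightarrow> j \<ge> M \<Longrightarrow> dist (X i) (X j) < e" for F i M e
  proof (rule Lim_bounded)
    show "(\<lambda>j. \<Sum>n\<in>F. (norm (ell2_apply (X i) n - ell2_apply (X j) n))\<^sup>2)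
        \<longlonglongrightarrow> (\<Sum>n\<in>F. (norm (ell2_apply (X i) n - l n))\<^sup>2)"
      by (intro tendsto_intros l)
    show "\<forall>j\<ge>M. (\<Sum>n\<in>F. (norm (ell2_apply (X i) n - ell2_apply (X j) n))\<^sup>2) \<le> e\<^sup>2"
    proof (intro allI impI)
      fix j assume "j \<ge> M"
      have "(\<Sum>n\<in>F. (norm (ell2_apply (X i) n - ell2_apply (X j) n))\<^sup>2) \<le> (norm (X i - X j))\<^sup>2"
        using norm_ell2_finite_le[OF \<open>finite F\<close>, of "X i - X j"] by (simp add: minus_ell2.rep_eq)
      also have "\<dots> \<le> e\<^sup>2"
        using M[OF \<open>i \<ge> M\<close> \<open>j \<ge> M\<close>] by (intro power_mono) (auto simp: dist_norm)
      finally show "(\<Sum>n\<in>F. (norm (ell2_apply (X i) n - ell2_apply (X j) n))\<^sup>2) \<le> e\<^sup>2" .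
    qed
  qed
  obtain M1 where M1: "\<And>i j. i \<ge> M1 \<Longrightarrow> j \<ge> M1 \<Longrightarrow> dist (X i) (X j) < 1"
    using X unfolding Cauchy_def by (meson zero_less_one)
  have "(\<lambda>n. (norm (ell2_apply (X M1) n - l n))\<^sup>2) summable_on UNIV"
    by (rule nonneg_bdd_above_summable_on)
      (use bd[OF _ order_refl M1] in \<open>auto intro!: bdd_aboveI[of _ "1\<^sup>2"]\<close>)
  then have "(\<lambda>n. (norm (ell2_apply (X M1) n + - (ell2_apply (X M1) n - l n)))\<^sup>2) summable_on UNIV"
    by (intro sq_summable_add ell2_summable) (simp only: norm_minus_cancel)
  then have L: "ell2_apply (Abs_ell2 l) = l" by (simp add: Abs_ell2_inverse)
  have "X \<longlonglongrightarrow> Abs_ell2 l"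
  proof (rule metric_LIMSEQ_I)
    fix e :: real assume "0 < e"
    then have "0 < e / 2" by simp
    then obtain M where M: "\<And>i j. i \<ge> M \<Longrightarrow> j \<ge> M \<Longrightarrow> dist (X i) (X j) < e / 2"
      using X unfolding Cauchy_def by blast
    have "norm (X i - Abs_ell2 l) \<le> e / 2" if "i \<ge> M" for i
      by (rule norm_ell2_leI) (use bd[OF _ that M] \<open>0 < e\<close> in \<open>auto simp: minus_ell2.rep_eq L\<close>)
    then have "dist (X i) (Abs_ell2 l) < e" if "i \<ge> M" for i
      using that \<open>0 < e\<close> by (fastforce simp: dist_norm)
    then show "\<exists>M. \<forall>i\<ge>M. dist (X i) (Abs_ell2 l) < e" by blast
  qed
  then show "convergent X" by (auto simp: convergent_def)
qed

instantiation ell2 :: (complex_hilbert) complex_hilbert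
begin

lift_definition scaleC_ell2 :: "complex \<Rightarrow> 'a ell2 \<Rightarrow> 'a ell2" is "\<lambda>c f n. c *\<^sub>C f n"
  by (rule sq_summable_bound) (auto simp: norm_scaleC)

definition cinner_ell2 :: "'a ell2 \<Rightarrow> 'a ell2 \<Rightarrow> complex" where
  "cinner_ell2 f g = (\<Sum>\<^sub>\<infinity>n. cinner (ell2_apply f n) (ell2_apply g n))"

instance
proof
  fix x y z :: "'a ell2" and c d :: complex and r :: real
  show "c *\<^sub>C (x + y) = c *\<^sub>C x + c *\<^sub>C y" "(c + d) *\<^sub>C x = c *\<^sub>C x + d *\<^sub>C x"
    "c *\<^sub>C d *\<^sub>C x = (c * d) *\<^sub>C x" "r *\<^sub>R x = complex_of_real r *\<^sub>C x"
    by (transfer; simp add: scaleC_add_right scaleC_add_left scaleC_scaleC scaleR_scaleC)+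
  show "cinner y x = cnj (cinner x y)"
    unfolding cinner_ell2_def infsum_cnj[symmetric] by (simp add: cinner_commute[symmetric])
  show "cinner x (y + z) = cinner x y + cinner x z"
    unfolding cinner_ell2_def plus_ell2.rep_eq cinner_add_right
    by (intro infsum_add cinner_summable ell2_summable)
  show "cinner x (c *\<^sub>C y) = c * cinner x y"
    unfolding cinner_ell2_def scaleC_ell2.rep_eq cinner_scaleC_right by (rule infsum_cmult_right')
  show "inner x y = Re (cinner x y)" by (simp add: inner_ell2_def cinner_ell2_def)
qed

end

section \<open>Operators\<close>

text \<open>Bounded operators are elements of the type \<^typ>\<open>'a \<Rightarrow>\<^sub>L 'b\<close>, whose members are merely
  real-linear; complex linearity is required by \<open>clinear_op\<close>.\<close>

definition clinear_op :: "('a::complex_hilbert \<Rightarrow>\<^sub>L 'b::complex_hilbert) \<Rightarrow> bool" where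
  "clinear_op A \<longleftrightarrow> (\<forall>c x. A (c *\<^sub>C x) = c *\<^sub>C A x)"

definition scalar_op :: "complex \<Rightarrow> 'a::complex_hilbert \<Rightarrow>\<^sub>L 'a" where
  "scalar_op c = Blinfun (\<lambda>x. c *\<^sub>C x)"

lemma scalar_op_apply [simp]: "scalar_op c x = c *\<^sub>C x"
proof -
  have "bounded_linear (\<lambda>x :: 'a. c *\<^sub>C x)"
    by (rule bounded_linear_intro[of _ "cmod c"])
      (simp_all add: scaleC_add_right scaleR_scaleC scaleC_scaleC norm_scaleC mult.commute)
  then show ?thesis by (simp add: scalar_op_def bounded_linear_Blinfun_apply)
qed

text \<open>In the following descriptions the described operator, if it exists, is unique.\<close>

definition adj :: "('a::complex_hilbert \<Rightarrow>\<^sub>L 'b::complex_hilbert) \<Rightarrow> 'b \<Rightarrow>\<^sub>L 'a" where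
  "adj A = (SOME B :: 'b \<Rightarrow>\<^sub>L 'a. \<forall>x y. cinner (B x) y = cinner x (A y))"

definition selfadjoint :: "('a::complex_hilbert \<Rightarrow>\<^sub>L 'a) \<Rightarrow> bool" where
  "selfadjoint A \<longleftrightarrow> (\<forall>x y. cinner (A x) y = cinner x (A y))"

definition positive_op :: "('a::complex_hilbert \<Rightarrow>\<^sub>L 'a) \<Rightarrow> bool" where
  "positive_op A \<longleftrightarrow> selfadjoint A \<and> (\<forall>x. 0 \<le> Re (cinner x (A x)))"

definition sqrt_op :: "('a::complex_hilbert \<Rightarrow>\<^sub>L 'a) \<Rightarrow> 'a \<Rightarrow>\<^sub>L 'a" where
  "sqrt_op A = (SOME B. positive_op B \<and> B o\<^sub>L B = A)"

definition inverse_op :: "('a::complex_hilbert \<Rightarrow>\<^sub>L 'a) \<Rightarrow> 'a \<Rightarrow>\<^sub>L 'a" where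
  "inverse_op A = (SOME B. A o\<^sub>L B = id_blinfun \<and> B o\<^sub>L A = id_blinfun)"

definition orth_proj :: "'a::complex_hilbert set \<Rightarrow> 'a \<Rightarrow>\<^sub>L 'a" where
  "orth_proj W = (SOME P :: 'a \<Rightarrow>\<^sub>L 'a. \<forall>x. P x \<in> W \<and> (\<forall>w\<in>W. cinner w (x - P x) = 0))"

definition re_op :: "('a::complex_hilbert \<Rightarrow>\<^sub>L 'a) \<Rightarrow> 'a \<Rightarrow>\<^sub>L 'a" where
  "re_op T = scalar_op (1 / 2) o\<^sub>L (T + adj T)"

definition im_op :: "('a::complex_hilbert \<Rightarrow>\<^sub>L 'a) \<Rightarrow> 'a \<Rightarrow>\<^sub>L 'a" where
  "im_op T = scalar_op (1 / (2 * \<i>)) o\<^sub>L (T - adj T)"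

subsection \<open>The Hilbert--Schmidt class\<close>

definition is_onb :: "'a::complex_hilbert set \<Rightarrow> bool" where
  "is_onb E \<longleftrightarrow> (\<forall>e\<in>E. \<forall>e'\<in>E. cinner e e' = (if e = e' then 1 else 0)) \<and> closure (cspan E) = UNIV"

text \<open>\<open>hs_sq A\<close> is the squared norm of the Schatten class of order 2, i.e. the trace of \<open>A\<^sup>*A\<close>
  (possibly infinite), computed in one orthonormal basis; the value does not depend on the basis
  when \<open>A\<close> is complex linear.\<close>

definition hs_sq :: "('a::complex_hilbert \<Rightarrow>\<^sub>L 'b::complex_hilbert) \<Rightarrow> ennreal" where
  "hs_sq A = (\<Sum>\<^sub>\<infinity>e\<in>(SOME E. is_onb E). ennreal ((norm (A e))\<^sup>2))"

definition hilbert_schmidt :: "('a::complex_hilbert \<Rightarrow>\<^sub>L 'b::complex_hilbert) \<Rightarrow> bool" where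
  "hilbert_schmidt A \<longleftrightarrow> clinear_op A \<and> hs_sq A < \<infinity>"

subsection \<open>Spectral counting functions of compact self-adjoint operators\<close>

definition eigenspace :: "('a::complex_hilbert \<Rightarrow>\<^sub>L 'a) \<Rightarrow> real \<Rightarrow> 'a set" where
  "eigenspace S \<mu> = {x. S x = \<mu> *\<^sub>R x}"

text \<open>For a compact self-adjoint operator \<open>S\<close> the spectral projection \<open>1\<^sub>J(S)\<close> projects onto the
  closed span of the eigenvectors with eigenvalue in \<open>J\<close>.\<close>

definition spectral_proj :: "real set \<Rightarrow> ('a::complex_hilbert \<Rightarrow>\<^sub>L 'a) \<Rightarrow> 'a \<Rightarrow>\<^sub>L 'a" where
  "spectral_proj J S = orth_proj (closure (cspan (\<Union>\<mu>\<in>J. eigenspace S \<mu>)))"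

definition rank_op :: "('a::complex_hilbert \<Rightarrow>\<^sub>L 'b::complex_hilbert) \<Rightarrow> enat" where
  "rank_op A = (if \<exists>E. finite E \<and> range A \<subseteq> cspan E then enat (cdim (range A)) else \<infinity>)"

definition count_plus :: "real \<Rightarrow> ('a::complex_hilbert \<Rightarrow>\<^sub>L 'a) \<Rightarrow> enat" where
  "count_plus r S = rank_op (spectral_proj {r<..} S)"

definition count_minus :: "real \<Rightarrow> ('a::complex_hilbert \<Rightarrow>\<^sub>L 'a) \<Rightarrow> enat" where
  "count_minus r S = rank_op (spectral_proj {r<..} (- S))"

section \<open>Tensor products of operators\<close>

text \<open>The \<open>\<G>\<close>-valued square-summable functions are identified with the Hilbert space tensor product
  of \<^typ>\<open>complex ell2\<close> and \<open>\<G>\<close> by \<open>(f \<otimes> g)(hn) = f(hn) g\<close>.\<close>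

lift_definition tensor_vec :: "complex ell2 \<Rightarrow> 'g::complex_hilbert \<Rightarrow> 'g ell2" is
  "\<lambda>f g n. f n *\<^sub>C g"
proof -
  fix f :: "int \<Rightarrow> complex" and g :: 'g
  assume "(\<lambda>n. (norm (f n))\<^sup>2) summable_on UNIV"
  then show "(\<lambda>n. (norm (f n *\<^sub>C g))\<^sup>2) summable_on UNIV"
    by (rule sq_summable_bound[where c = "norm g"]) (simp add: norm_scaleC)
qed

definition tensor_op ::
  "(complex ell2 \<Rightarrow>\<^sub>L complex ell2) \<Rightarrow> ('g::complex_hilbert \<Rightarrow>\<^sub>L 'g) \<Rightarrow> 'g ell2 \<Rightarrow>\<^sub>L 'g ell2" where
  "tensor_op A K = (SOME T :: 'g ell2 \<Rightarrow>\<^sub>L 'g ell2. \<forall>f g. T (tensor_vec f g) = tensor_vec (A f) (K g))"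

lift_definition delta :: "int \<Rightarrow> complex ell2" is "\<lambda>k n. if n = k then 1 else 0"
proof -
  fix k :: int
  have "(\<lambda>n. (norm (if n = k then 1 else 0 :: complex))\<^sup>2) summable_on {k}" by simp
  then show "(\<lambda>n. (norm (if n = k then 1 else 0 :: complex))\<^sup>2) summable_on UNIV"
    by (rule summable_on_cong_neutral[THEN iffD1, rotated -1]) auto
qed

lemma sum_ell2_apply: "ell2_apply (\<Sum>i\<in>F. \<phi> i) n = (\<Sum>i\<in>F. ell2_apply (\<phi> i) n)"
  by (induction F rule: infinite_finite_induct) (auto simp: zero_ell2.rep_eq plus_ell2.rep_eq)

lemma has_sum_delta_tensor:
  "((\<lambda>n. tensor_vec (delta n) (ell2_apply \<phi> n)) has_sum \<phi>) UNIV"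
proof -
  let ?s = "\<lambda>F. \<Sum>n\<in>F. tensor_vec (delta n) (ell2_apply \<phi> n)"
  let ?r = "\<lambda>F. (norm \<phi>)\<^sup>2 - (\<Sum>n\<in>F. (norm (ell2_apply \<phi> n))\<^sup>2)"
  have s: "ell2_apply (?s F) n = (if n \<in> F then ell2_apply \<phi> n else 0)" if "finite F" for F n
  proof -
    have "ell2_apply (?s F) n = (\<Sum>m\<in>F. if m = n then ell2_apply \<phi> n else 0)"
      unfolding sum_ell2_apply tensor_vec.rep_eq delta.rep_eq
      by (intro sum.cong refl) (auto simp: scaleC_one)
    then show ?thesis using that by (simp add: sum.delta)
  qed
  have le: "norm (?s F - \<phi>) \<le> sqrt (?r F)" if F: "finite F" for F
  proof (rule norm_ell2_leI)
    show "0 \<le> sqrt (?r F)" using norm_ell2_finite_le[OF F, of \<phi>] by simp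
    fix G :: "int set" assume G: "finite G"
    have "(\<Sum>n\<in>G. (norm (ell2_apply (?s F - \<phi>) n))\<^sup>2) = (\<Sum>n\<in>G - F. (norm (ell2_apply \<phi> n))\<^sup>2)"
      using G by (intro sum.mono_neutral_cong_right) (auto simp: minus_ell2.rep_eq s[OF F])
    also have "\<dots> = (\<Sum>n\<in>G \<union> F. (norm (ell2_apply \<phi> n))\<^sup>2) - (\<Sum>n\<in>F. (norm (ell2_apply \<phi> n))\<^sup>2)"
      using F G by (subst sum_diff[symmetric]) (auto intro!: sum.cong)
    also have "\<dots> \<le> ?r F"
      using norm_ell2_finite_le[of "G \<union> F" \<phi>] F G by simp
    also have "\<dots> = (sqrt (?r F))\<^sup>2" using norm_ell2_finite_le[OF F, of \<phi>] by simp
    finally show "(\<Sum>n\<in>G. (norm (ell2_apply (?s F - \<phi>) n))\<^sup>2) \<le> (sqrt (?r F))\<^sup>2" .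
  qed
  have "((\<lambda>F. \<Sum>n\<in>F. (norm (ell2_apply \<phi> n))\<^sup>2) \<longlongrightarrow> (norm \<phi>)\<^sup>2) (finite_subsets_at_top UNIV)"
    unfolding norm_ell2_sq by (rule infsum_tendsto) (rule ell2_summable)
  then have "((\<lambda>F. sqrt (?r F)) \<longlongrightarrow> sqrt ((norm \<phi>)\<^sup>2 - (norm \<phi>)\<^sup>2)) (finite_subsets_at_top UNIV)"
    by (intro tendsto_intros)
  then have "((\<lambda>F. sqrt (?r F)) \<longlongrightarrow> 0) (finite_subsets_at_top UNIV)" by simp
  then have "((\<lambda>F. ?s F - \<phi>) \<longlongrightarrow> 0) (finite_subsets_at_top UNIV)"
    by (rule Lim_null_comparison[rotated])
      (auto intro!: eventually_finite_subsets_at_top_weakI le)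
  then show ?thesis unfolding has_sum_def by (rule Lim_null[THEN iffD2])
qed

lemma tensor_op_eqI:
  fixes A :: "complex ell2 \<Rightarrow>\<^sub>L complex ell2" and K :: "'g::complex_hilbert \<Rightarrow>\<^sub>L 'g"
    and T :: "'g ell2 \<Rightarrow>\<^sub>L 'g ell2"
  assumes T: "\<And>f g. T (tensor_vec f g) = tensor_vec (A f) (K g)"
  shows "tensor_op A K = T"
proof -
  have "S = T" if S: "\<forall>f g. S (tensor_vec f g) = tensor_vec (A f) (K g)"
    for S :: "'g ell2 \<Rightarrow>\<^sub>L 'g ell2"
  proof (rule blinfun_eqI)
    fix \<phi>
    have "((\<lambda>n. (S - T) (tensor_vec (delta n) (ell2_apply \<phi> n))) has_sum (S - T) \<phi>) UNIV"
      by (rule has_sum_bounded_linear[OF _ has_sum_delta_tensor]) (rule blinfun.bounded_linear_right)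
    moreover have "(S - T) (tensor_vec (delta n) (ell2_apply \<phi> n)) = 0" for n
      using S T by (simp add: blinfun.diff_left)
    ultimately have "((\<lambda>_. 0) has_sum (S - T) \<phi>) (UNIV :: int set)" by simp
    then have "(S - T) \<phi> = 0" by (rule has_sum_unique) (rule has_sum_0, simp)
    then show "S \<phi> = T \<phi>" by (simp add: blinfun.diff_left)
  qed
  then show ?thesis
    unfolding tensor_op_def by (intro some_equality) (use T in auto)
qed

section \<open>The discrete Schroedinger operator\<close>

lift_definition translate :: "int \<Rightarrow> 'g::complex_hilbert ell2 \<Rightarrow> 'g ell2" is "\<lambda>k \<phi> n. \<phi> (n + k)"
proof -
  fix k and \<phi> :: "int \<Rightarrow> 'g"
  assume "(\<lambda>n. (norm (\<phi> n))\<^sup>2) summable_on UNIV"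
  then show "(\<lambda>n. (norm (\<phi> (n + k)))\<^sup>2) summable_on UNIV"
    by (subst summable_on_reindex_bij_betw[where g = "\<lambda>n. n + k" and A = UNIV and B = UNIV])
      (auto intro!: bij_betwI[where g = "\<lambda>n. n - k"])
qed

lemma norm_translate: "norm (translate k \<phi>) = norm \<phi>"
proof -
  have "(norm (translate k \<phi>))\<^sup>2 = (norm \<phi>)\<^sup>2"
    unfolding norm_ell2_sq translate.rep_eq
    by (subst infsum_reindex_bij_betw[where g = "\<lambda>n. n + k" and A = UNIV and B = UNIV])
      (auto intro!: bij_betwI[where g = "\<lambda>n. n - k"])
  then show ?thesis by simp
qed

lift_definition translate_op :: "int \<Rightarrow> 'g::complex_hilbert ell2 \<Rightarrow>\<^sub>L 'g ell2" is translate
  by (rule bounded_linear_intro[where K = 1])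
    (simp_all add: norm_translate, (transfer; simp)+)

definition neg_laplacian :: "real \<Rightarrow> 'g::complex_hilbert ell2 \<Rightarrow>\<^sub>L 'g ell2" where
  "neg_laplacian h = (1 / h\<^sup>2) *\<^sub>R (2 *\<^sub>R id_blinfun - translate_op 1 - translate_op (- 1))"

lemma neg_laplacian_apply:
  "ell2_apply (neg_laplacian h \<phi>) n
    = (1 / h\<^sup>2) *\<^sub>R (2 *\<^sub>R ell2_apply \<phi> n - ell2_apply \<phi> (n + 1) - ell2_apply \<phi> (n - 1))"
  by (simp add: neg_laplacian_def blinfun.scaleR_left blinfun.diff_left translate_op.rep_eq
      scaleR_ell2.rep_eq minus_ell2.rep_eq translate.rep_eq)

text \<open>Multiplication by a (bounded) function.\<close>

definition mult_op :: "(int \<Rightarrow> complex) \<Rightarrow> complex ell2 \<Rightarrow>\<^sub>L complex ell2" where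
  "mult_op f = Blinfun (\<lambda>\<phi>. Abs_ell2 (\<lambda>n. f n * ell2_apply \<phi> n))"

definition H_op :: "real \<Rightarrow> ('g::complex_hilbert \<Rightarrow>\<^sub>L 'g) \<Rightarrow> 'g ell2 \<Rightarrow>\<^sub>L 'g ell2" where
  "H_op h Q = tensor_op (neg_laplacian h) id_blinfun + tensor_op id_blinfun Q"

definition psi :: "real \<Rightarrow> int \<Rightarrow> complex" where
  "psi \<nu>0 n = complex_of_real (sqrt (1 + (real_of_int n)\<^sup>2) powr (- \<nu>0 / 2))"

lemma bounded_psi: "0 \<le> \<nu>0 \<Longrightarrow> bounded (range (psi \<nu>0))"
  unfolding bounded_iff
proof (intro exI[of _ 1] ballI)
  fix z assume "0 \<le> \<nu>0" "z \<in> range (psi \<nu>0)"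
  then obtain n where z: "z = psi \<nu>0 n" by blast
  have "sqrt (1 + (real_of_int n)\<^sup>2) powr (- \<nu>0 / 2) \<le> sqrt (1 + (real_of_int n)\<^sup>2) powr 0"
    using \<open>0 \<le> \<nu>0\<close> by (intro powr_mono) auto
  moreover have "0 < sqrt (1 + (real_of_int n)\<^sup>2)"
    by (simp add: add_pos_nonneg)
  ultimately show "norm z \<le> 1" by (simp add: z psi_def)
qed

lemma ell2_pointwise_op:
  fixes K :: "'g::complex_hilbert \<Rightarrow>\<^sub>L 'g"
  assumes "bounded (range f)"
  shows "ell2_apply (Blinfun (\<lambda>\<phi>. Abs_ell2 (\<lambda>n. f n *\<^sub>C K (ell2_apply \<phi> n))) \<phi>) n
    = f n *\<^sub>C K (ell2_apply \<phi> n)"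
proof -
  obtain b where b: "\<And>n. cmod (f n) \<le> b" using assms by (auto simp: bounded_iff)
  then have b0: "0 \<le> b" using norm_ge_zero order_trans by blast
  define c where "c = b * norm K"
  have c0: "0 \<le> c" using b0 by (simp add: c_def)
  have le: "norm (f n *\<^sub>C K x) \<le> c * norm x" for n x
  proof -
    have "norm (f n *\<^sub>C K x) \<le> b * (norm K * norm x)"
      unfolding norm_scaleC by (intro mult_mono b norm_blinfun b0) auto
    then show ?thesis by (simp add: c_def mult.assoc)
  qed
  let ?T = "\<lambda>\<phi>. Abs_ell2 (\<lambda>n. f n *\<^sub>C K (ell2_apply \<phi> n))"
  have T: "ell2_apply (?T \<phi>) n = f n *\<^sub>C K (ell2_apply \<phi> n)" for \<phi> n
    by (subst Abs_ell2_inverse) (use sq_summable_bound[OF ell2_summable le] in auto)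
  have "bounded_linear ?T"
  proof (rule bounded_linear_intro[where K = c])
    show "?T (x + y) = ?T x + ?T y" for x y
      by (rule ell2_eqI, unfold T) (simp only: T plus_ell2.rep_eq blinfun.add_right scaleC_add_right)
    show "?T (r *\<^sub>R x) = r *\<^sub>R ?T x" for r x
    proof (rule ell2_eqI)
      fix n
      have "f n *\<^sub>C (r *\<^sub>R y) = r *\<^sub>R (f n *\<^sub>C y)" for y :: 'g
        by (simp add: scaleR_scaleC scaleC_scaleC mult.commute)
      then show "ell2_apply (?T (r *\<^sub>R x)) n = ell2_apply (r *\<^sub>R ?T x) n"
        unfolding T unfolding scaleR_ell2.rep_eq T blinfun.scaleR_right by blast
    qed
    show "norm (?T x) \<le> norm x * c" for x
    proof (rule norm_ell2_leI)
      fix F :: "int set" assume "finite F"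
      have "(\<Sum>n\<in>F. (norm (ell2_apply (?T x) n))\<^sup>2) \<le> (\<Sum>n\<in>F. (c * norm (ell2_apply x n))\<^sup>2)"
        unfolding T by (intro sum_mono power_mono le) auto
      also have "\<dots> \<le> c\<^sup>2 * (norm x)\<^sup>2"
        using norm_ell2_finite_le[OF \<open>finite F\<close>, of x]
        by (simp add: power_mult_distrib sum_distrib_left[symmetric] mult_left_mono)
      finally show "(\<Sum>n\<in>F. (norm (ell2_apply (?T x) n))\<^sup>2) \<le> (norm x * c)\<^sup>2"
        by (simp add: power_mult_distrib mult.commute)
    qed (simp add: c0)
  qed
  then show ?thesis by (simp add: bounded_linear_Blinfun_apply T)
qed

lemma mult_op_apply:
  assumes "bounded (range f)"
  shows "ell2_apply (mult_op f \<phi>) n = f n * ell2_apply \<phi> n"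
  using ell2_pointwise_op[OF assms, of id_blinfun \<phi> n] by (simp add: mult_op_def scaleC_complex_def)

lemma tensor_mult_op_apply:
  assumes "bounded (range f)" and "clinear_op K"
  shows "ell2_apply (tensor_op (mult_op f) K \<phi>) n = f n *\<^sub>C K (ell2_apply \<phi> n)"
proof -
  have "tensor_op (mult_op f) K = Blinfun (\<lambda>\<phi>. Abs_ell2 (\<lambda>n. f n *\<^sub>C K (ell2_apply \<phi> n)))"
  proof (rule tensor_op_eqI, rule ell2_eqI,
      unfold ell2_pointwise_op[OF assms(1)] tensor_vec.rep_eq mult_op_apply[OF assms(1)])
    show "f n *\<^sub>C K (ell2_apply u n *\<^sub>C g) = (f n * ell2_apply u n) *\<^sub>C K g" for u g n
      using assms(2) by (simp add: clinear_op_def scaleC_scaleC)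
  qed
  then show ?thesis by (simp add: ell2_pointwise_op[OF assms(1)])
qed

lemma H_op_apply:
  assumes "clinear_op Q"
  shows "ell2_apply (H_op h Q \<phi>) n
    = (1 / h\<^sup>2) *\<^sub>R (2 *\<^sub>R ell2_apply \<phi> n - ell2_apply \<phi> (n + 1) - ell2_apply \<phi> (n - 1))
      + Q (ell2_apply \<phi> n)"
proof -
  have b: "bounded (range (\<lambda>_ :: int. 1 :: complex))" by simp
  have "mult_op (\<lambda>_. 1) = id_blinfun"
    by (rule blinfun_eqI, rule ell2_eqI) (simp add: mult_op_apply[OF b])
  then have 1: "ell2_apply (tensor_op id_blinfun Q \<phi>) n = Q (ell2_apply \<phi> n)"
    using tensor_mult_op_apply[OF b assms, of \<phi> n] by (simp add: scaleC_one)
  have "r *\<^sub>R (c *\<^sub>C g) = (complex_of_real r * c) *\<^sub>C g" for r c and g :: 'a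
    by (simp only: scaleR_scaleC scaleC_scaleC)
  then have "tensor_op (neg_laplacian h) id_blinfun = (neg_laplacian h :: 'a ell2 \<Rightarrow>\<^sub>L _)"
    by (intro tensor_op_eqI ell2_eqI)
      (simp only: neg_laplacian_apply tensor_vec.rep_eq blinfun_apply_id_blinfun
        cvec.scale_left_diff_distrib[symmetric] scaleR_conv_of_real)
  then show ?thesis by (simp add: H_op_def blinfun.add_left plus_ell2.rep_eq 1 neg_laplacian_apply)
qed

text \<open>\<open>\<G>\<close> is the direct sum of the nonzero eigenspaces for the distinct eigenvalues \<open>\<mu>\<^sub>1, \<dots>, \<mu>\<^sub>d\<close>; an
  operator with such a decomposition is everywhere defined and, when self-adjoint, bounded. The
  numbers \<open>\<mu>\<^sub>s\<close> are irrelevant for the threshold set if \<open>Q = 0\<close>.\<close>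

definition eigen_decomposition ::
  "('g::complex_hilbert \<Rightarrow>\<^sub>L 'g) \<Rightarrow> nat \<Rightarrow> (nat \<Rightarrow> real) \<Rightarrow> bool" where
  "eigen_decomposition Q d \<mu> \<longleftrightarrow>
     inj_on \<mu> {1..d} \<and> (\<forall>s\<in>{1..d}. eigenspace Q (\<mu> s) \<noteq> {0}) \<and>
     (\<forall>x. \<exists>!y. y \<in> (\<Pi>\<^sub>E s\<in>{1..d}. eigenspace Q (\<mu> s)) \<and> x = (\<Sum>s=1..d. y s))"

definition threshold_set ::
  "real \<Rightarrow> ('g::complex_hilbert \<Rightarrow>\<^sub>L 'g) \<Rightarrow> nat \<Rightarrow> (nat \<Rightarrow> real) \<Rightarrow> real set" where
  "threshold_set h Q d \<mu> =
     (if Q = 0 then {0, 4 / h\<^sup>2} else (\<Union>s\<in>{1..d}. {\<mu> s, \<mu> s + 4 / h\<^sup>2}))"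

section \<open>The spectral shift function\<close>

definition sandwiched_resolvent ::
  "('a::complex_hilbert \<Rightarrow>\<^sub>L 'b::complex_hilbert) \<Rightarrow> ('a \<Rightarrow>\<^sub>L 'a) \<Rightarrow> complex \<Rightarrow> 'b \<Rightarrow>\<^sub>L 'b" where
  "sandwiched_resolvent M H0 z = M o\<^sub>L inverse_op (H0 - scalar_op z) o\<^sub>L adj M"

definition boundary_value ::
  "('a::complex_hilbert \<Rightarrow>\<^sub>L 'b::complex_hilbert) \<Rightarrow> ('a \<Rightarrow>\<^sub>L 'a) \<Rightarrow> real \<Rightarrow> 'b \<Rightarrow>\<^sub>L 'b" where
  "boundary_value M H0 x = (SOME L. hilbert_schmidt L \<and>
     ((\<lambda>\<epsilon>. hs_sq (sandwiched_resolvent M H0 (Complex x \<epsilon>) - L)) \<longlongrightarrow> 0) (at_right 0))"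

text \<open>The representative of the spectral shift function of the pair \<open>(H, H0)\<close> for a perturbation
  \<open>H - H0 = \<plusminus>M\<^sup>*M\<close> of definite sign; there is no conflict if both cases apply, since then \<open>M = 0\<close>.
  The values are extended reals, so that a divergent integral would show up as an infinite value.\<close>

definition ssf ::
  "('a::complex_hilbert \<Rightarrow>\<^sub>L 'b::complex_hilbert) \<Rightarrow> ('a \<Rightarrow>\<^sub>L 'a) \<Rightarrow> ('a \<Rightarrow>\<^sub>L 'a) \<Rightarrow> real \<Rightarrow> ereal" where
  "ssf M H H0 x =
    (let A = re_op (boundary_value M H0 x);
         B = im_op (boundary_value M H0 x)
     in if H = H0 + (adj M o\<^sub>L M) then
          ereal (1 / pi) * enn2ereal
            (\<integral>\<^sup>+t. ennreal_of_enat (count_minus 1 (A + t *\<^sub>R B)) * ennreal (1 / (1 + t\<^sup>2)) \<partial>lborel)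
        else if H = H0 - (adj M o\<^sub>L M) then
          - (ereal (1 / pi) * enn2ereal
            (\<integral>\<^sup>+t. ennreal_of_enat (count_plus 1 (A + t *\<^sub>R B)) * ennreal (1 / (1 + t\<^sup>2)) \<partial>lborel))
        else undefined)"

end

theory Submission
  imports Defs
begin

text \<open>Write \<open>H\<^sub>Q = \<Sum>\<^sub>s (-\<Delta>\<^sub>h + \<mu>\<^sub>s) \<otimes> P\<^sub>s\<close>. The Green function of \<open>-\<Delta>\<^sub>h - w\<close> is
  \<open>c q\<^bsup>|n - m|\<^esup>\<close> with explicit \<open>c\<close> and \<open>|q| \<le> 1\<close>, and it has bounded boundary values away from the thresholds.
  Since \<open>\<psi>\<close> is square summable and \<open>K\<close> is Hilbert--Schmidt, dominated convergence yields the limit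
  \<open>T(\<lambda> + i0)\<close> in the Hilbert--Schmidt norm, with locally uniform bounds for the Hilbert--Schmidt norm
  of its real part \<open>A\<close> and for the trace of its imaginary part \<open>B \<ge> 0\<close>. Finally
  \<open>\<N>(1, A + tB) \<le> \<N>(1/2, A) + \<N>(1/2, |t| B)\<close>, where the first term is at most \<open>4 \<parallel>A\<parallel>\<^sup>2\<close> and the
  integral of the second one against \<open>dt / (1 + t\<^sup>2)\<close> is bounded by a multiple of the trace of \<open>B\<close>.\<close>

text \<open>Since \<open>S = sqrt_op W\<close> is merely bounded, it stays outside every limit:
  \<open>T = S N S\<close>, and only \<psi> and \<open>K\<close>, inside \<open>N\<close>, supply
  summability. Inside a spectral band \<open>|q| = 1\<close>, so at real energies the Green function
  no longer decays and there is no bounded resolvent to pass to; what survives is a bounded kernel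
  with the weight \<psi> on both sides. A Hilbert-Schmidt bound alone would not do for
  \<open>B\<close>: it yields a count of order \<open>t^2\<close>, which is not integrable against
  \<open>dt / (1 + t^2)\<close>. The stronger trace bound rests on the positivity of
  \<open>B\<close>, inherited from positive imaginary energies, and on the diagonal of the kernel,
  where both weights sit at the same site and the sum of \<psi> squared appears. The energy enters
  the estimates only through a bound for the Green kernel that is continuous off the thresholds, so
  compactness of \<Gamma> gives uniformity. Adjoints, roots, inverses, projections and boundary
  values are defined by choice, so existence has to be proved for each before it can be used, and
  uniqueness wherever a concrete value is computed.\<close>

instance complex_hilbert \<subseteq> banach ..

section \<open>Hilbert spaces\<close>

lemma bounded_bilinear_cinner:
  "bounded_bilinear (cinner :: 'a::complex_hilbert \<Rightarrow> 'a \<Rightarrow> complex)"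
proof
  fix a a' b b' :: 'a and r :: real
  show "cinner (a + a') b = cinner a b + cinner a' b" by (rule cinner_add_left)
  show "cinner a (b + b') = cinner a b + cinner a b'" by (rule cinner_add_right)
  show "cinner (r *\<^sub>R a) b = r *\<^sub>R cinner a b"
    by (simp add: scaleR_scaleC[of r a] cinner_scaleC_left scaleR_conv_of_real)
  show "cinner a (r *\<^sub>R b) = r *\<^sub>R cinner a b"
    by (simp add: scaleR_scaleC[of r b] cinner_scaleC_right scaleR_conv_of_real)
  show "\<exists>K. \<forall>a b. norm (cinner a b) \<le> norm (a::'a) * norm (b::'a) * K"
    by (rule exI[of _ 1]) (simp add: cmod_cinner_le)
qed

interpretation cinner: bounded_bilinear "cinner :: 'a::complex_hilbert \<Rightarrow> 'a \<Rightarrow> complex"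
  by (rule bounded_bilinear_cinner)

lemma bounded_bilinear_scaleC:
  "bounded_bilinear (scaleC :: complex \<Rightarrow> 'a::complex_hilbert \<Rightarrow> 'a)"
proof
  fix a a' :: complex and b b' :: 'a and r :: real
  show "(a + a') *\<^sub>C b = a *\<^sub>C b + a' *\<^sub>C b" by (rule scaleC_add_left)
  show "a *\<^sub>C (b + b') = a *\<^sub>C b + a *\<^sub>C b'" by (rule scaleC_add_right)
  show "(r *\<^sub>R a) *\<^sub>C b = r *\<^sub>R (a *\<^sub>C b)"
    by (simp add: scaleR_scaleC[of r "a *\<^sub>C b"] scaleC_scaleC scaleR_conv_of_real)
  show "a *\<^sub>C (r *\<^sub>R b) = r *\<^sub>R (a *\<^sub>C b)"
    by (simp add: scaleR_scaleC[of r] scaleC_scaleC mult.commute)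
  show "\<exists>K. \<forall>a b. norm (a *\<^sub>C b) \<le> norm a * norm (b::'a) * K"
    by (rule exI[of _ 1]) (simp add: norm_scaleC)
qed

interpretation scaleC: bounded_bilinear "scaleC :: complex \<Rightarrow> 'a::complex_hilbert \<Rightarrow> 'a"
  by (rule bounded_bilinear_scaleC)

text \<open>Real and imaginary parts of the scalar product are both values of the real inner
  product, so facts about real Hilbert spaces carry over to complex-linear data.\<close>

lemma Im_cinner: "Im (cinner x y) = inner x ((- \<i>) *\<^sub>C (y :: 'a::complex_hilbert))"
  by (simp add: inner_eq_Re_cinner cinner_scaleC_right cinner.minus_right)

lemma cinner_ext: "(\<And>y. cinner x y = cinner x' y) \<Longrightarrow> x = (x' :: 'a::complex_hilbert)"
  by (metis cinner.diff_left cinner_self eq_iff_diff_eq_0 norm_eq_zero of_real_eq_0_iff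
      zero_eq_power2)

lemma cinner_eq_0_commute: "cinner x y = 0 \<longleftrightarrow> cinner y (x :: 'a::complex_hilbert) = 0"
  by (metis cinner_commute complex_cnj_zero_iff)

section \<open>Nearest points, Riesz representation and orthogonal projections\<close>

lemma inner_eq_0_of_norm_le:
  fixes p w :: "'a::real_inner"
  assumes "\<And>t. norm p \<le> norm (p + t *\<^sub>R w)"
  shows "inner p w = 0"
proof (cases "w = 0")
  case False
  \<comment> \<open>The minimiser of the squared norm of \<open>p + t w\<close>, a quadratic
    polynomial in \<open>t\<close>; minimality at \<open>0\<close> forces it to be
    \<open>0\<close>.\<close>
  define t where "t = - (inner p w / inner w w)"
  have "inner p p \<le> inner (p + t *\<^sub>R w) (p + t *\<^sub>R w)"
    using assms[of t] by (simp add: norm_le)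
  then have "0 \<le> t * (2 * inner p w + t * inner w w)"
    by (simp add: inner_add_left inner_add_right inner_commute algebra_simps)
  moreover have "t * inner w w = - inner p w" using False by (simp add: t_def)
  ultimately have "0 \<le> t * inner p w" by simp
  then have "(inner p w)\<^sup>2 / inner w w \<le> 0" by (simp add: t_def power2_eq_square)
  moreover have "0 < inner w w" using False by simp
  ultimately have "(inner p w)\<^sup>2 \<le> 0" by (simp only: divide_le_0_iff) linarith
  then show ?thesis by simp
qed simp

text \<open>The parallelogram law makes a minimising sequence Cauchy, because midpoints stay in the
  convex set and so have norm at least the infimum.\<close>

lemma ex_min_norm:
  fixes C :: "'a::{real_inner, complete_space} set"
  assumes C: "closed C" "convex C" "C \<noteq> {}"
  shows "\<exists>p\<in>C. \<forall>y\<in>C. norm p \<le> norm y"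
proof -
  define m where "m = Inf (norm ` C)"
  have bdd: "bdd_below (norm ` C)" by (rule bdd_belowI[of _ 0]) auto
  have m_le: "m \<le> norm y" if "y \<in> C" for y
    unfolding m_def using that bdd by (intro cInf_lower) auto
  have m0: "0 \<le> m" unfolding m_def using C(3) by (intro cInf_greatest) auto
  have "\<exists>y\<in>C. norm y < m + 1 / Suc n" for n
  proof -
    have "Inf (norm ` C) < m + 1 / Suc n" unfolding m_def by simp
    then show ?thesis using cInf_lessD[of "norm ` C"] C(3) by blast
  qed
  then obtain u where u: "\<And>n. u n \<in> C" "\<And>n. norm (u n) < m + 1 / Suc n" by metis
  have key: "(norm (u i - u j))\<^sup>2 \<le> (8 * m + 4) / Suc N" if "N \<le> i" "N \<le> j" for N i j
  proof -
    define r where "r = 1 / real (Suc N)"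
    have r: "0 < r" "r \<le> 1" by (auto simp: r_def divide_simps)
    have "(1/2) *\<^sub>R u i + (1/2) *\<^sub>R u j \<in> C"
      using C(2) u(1) by (intro convexD) auto
    from m_le[OF this] have "m \<le> norm ((1/2) *\<^sub>R (u i + u j))" by (simp add: scaleR_add_right)
    then have "2 * m \<le> norm (u i + u j)" by simp
    then have 1: "(2 * m)\<^sup>2 \<le> (norm (u i + u j))\<^sup>2" using m0 by (intro power_mono) auto
    have "1 / real (Suc i) \<le> r" "1 / real (Suc j) \<le> r"
      using that by (auto simp: r_def frac_le)
    then have "norm (u i) \<le> m + r" "norm (u j) \<le> m + r" using u(2)[of i] u(2)[of j] by linarith+
    then have 2: "(norm (u i))\<^sup>2 \<le> (m + r)\<^sup>2" "(norm (u j))\<^sup>2 \<le> (m + r)\<^sup>2"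
      by (intro power_mono; simp)+
    have "(norm (u i - u j))\<^sup>2 = 2 * (norm (u i))\<^sup>2 + 2 * (norm (u j))\<^sup>2 - (norm (u i + u j))\<^sup>2"
      by (simp add: power2_norm_eq_inner inner_add_left inner_add_right inner_diff_left
          inner_diff_right inner_commute)
    also have "\<dots> \<le> 4 * (m + r)\<^sup>2 - (2 * m)\<^sup>2" using 1 2 by linarith
    also have "\<dots> = 8 * m * r + 4 * (r * r)" by (simp add: power2_eq_square algebra_simps)
    also have "\<dots> \<le> 8 * m * r + 4 * r" using r by (simp add: mult_left_le)
    also have "\<dots> = (8 * m + 4) / Suc N" by (simp add: r_def add_divide_distrib del: of_nat_Suc)
    finally show ?thesis .
  qed
  have "Cauchy u"
  proof (rule CauchyI)
    fix e :: real assume e: "0 < e"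
    obtain N where N: "(8 * m + 4) / e\<^sup>2 < real N" using reals_Archimedean2 by blast
    have "(8 * m + 4) / Suc N < e\<^sup>2"
    proof -
      have "8 * m + 4 < real N * e\<^sup>2" using N e by (simp add: pos_divide_less_eq)
      also have "\<dots> \<le> real (Suc N) * e\<^sup>2" by (intro mult_right_mono) auto
      finally show ?thesis by (simp add: pos_divide_less_eq mult.commute del: of_nat_Suc)
    qed
    then have "(norm (u i - u j))\<^sup>2 < e\<^sup>2" if "N \<le> i" "N \<le> j" for i j
      using key[OF that] by linarith
    then show "\<exists>N. \<forall>i\<ge>N. \<forall>j\<ge>N. norm (u i - u j) < e"
      using e by (meson power_less_imp_less_base less_imp_le)
  qed
  then obtain p where p: "u \<longlonglongrightarrow> p" by (metis Cauchy_convergent_iff convergent_def)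
  have "p \<in> C" using C(1) p u(1) by (metis closed_sequential_limits)
  moreover have "norm p \<le> m"
  proof (rule LIMSEQ_le)
    show "(\<lambda>n. norm (u n)) \<longlonglongrightarrow> norm p" using p by (rule tendsto_norm)
    show "(\<lambda>n. m + 1 / Suc n) \<longlonglongrightarrow> m"
      using tendsto_add[OF tendsto_const LIMSEQ_inverse_real_of_nat, of m] by (simp add: divide_inverse)
    show "\<exists>N. \<forall>n\<ge>N. norm (u n) \<le> m + 1 / Suc n" using u(2) less_imp_le by blast
  qed
  ultimately show ?thesis using m_le by force
qed

text \<open>The vector \<open>p\<close> of least norm in the hyperplane \<open>f = 1\<close> is
  orthogonal to the kernel of \<open>f\<close>; a multiple of \<open>p\<close> then represents
  \<open>f\<close>.\<close>

lemma riesz_representation: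
  fixes f :: "'a::{real_inner, complete_space} \<Rightarrow> real"
  assumes f: "bounded_linear f"
  shows "\<exists>v. \<forall>x. f x = inner v x"
proof (cases "\<forall>x. f x = 0")
  case True
  then show ?thesis by (intro exI[of _ 0]) simp
next
  case False
  interpret f: bounded_linear f by (rule f)
  from False obtain x where x: "f x \<noteq> 0" by blast
  define C where "C = {x. f x = 1}"
  have "closed C" unfolding C_def
    by (intro closed_Collect_eq continuous_intros f.continuous_on)
  moreover have "convex C"
    by (rule convexI) (auto simp: C_def f.add f.scaleR)
  moreover have "inverse (f x) *\<^sub>R x \<in> C" using x by (simp add: C_def f.scaleR)
  ultimately obtain p where p: "f p = 1" "\<And>y. f y = 1 \<Longrightarrow> norm p \<le> norm y"
    using ex_min_norm[of C] by (auto simp: C_def)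
  have "inner p w = 0" if "f w = 0" for w
    by (rule inner_eq_0_of_norm_le) (rule p(2), simp add: f.add f.scaleR p(1) that)
  then have "inner p (y - f y *\<^sub>R p) = 0" for y by (simp add: f.diff f.scaleR p(1))
  then have v: "inner p y = f y * inner p p" for y
    unfolding inner_diff_right inner_scaleR_right right_minus_eq .
  have pp: "inner p p \<noteq> 0" using p(1) f.zero by auto
  have "f y = inner (inverse (inner p p) *\<^sub>R p) y" for y
    using v[of y] pp by simp
  then show ?thesis by blast
qed

text \<open>A vector of least norm in the translate \<open>x - C\<close> cannot be shortened by
  moving inside \<open>C\<close>, hence is orthogonal to \<open>C\<close>.\<close>

lemma ex_orthogonal_decomposition:
  fixes C :: "'a::{real_inner, complete_space} set"
  assumes C: "closed C" "subspace C"
  shows "\<exists>y\<in>C. \<forall>w\<in>C. inner (x - y) w = 0"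
proof -
  have "closed ((\<lambda>y. x - y) ` C)" using closed_translation[of "uminus ` C" x] C(1)
    by (simp add: image_image closed_negations)
  moreover have "convex ((\<lambda>y. x - y) ` C)"
    using convex_translation[of "uminus ` C" x] subspace_imp_convex[OF C(2)]
    by (simp add: image_image convex_negations)
  moreover have "(\<lambda>y. x - y) ` C \<noteq> {}" using subspace_0[OF C(2)] by auto
  ultimately obtain y where y: "y \<in> C" "\<And>w. w \<in> C \<Longrightarrow> norm (x - y) \<le> norm (x - w)"
    using ex_min_norm by (metis (no_types, lifting) image_iff)
  have "inner (x - y) w = 0" if "w \<in> C" for w
  proof (rule inner_eq_0_of_norm_le)
    fix t
    have "y - t *\<^sub>R w \<in> C" using C(2) y(1) that by (simp add: subspace_diff subspace_scale)
    from y(2)[OF this] show "norm (x - y) \<le> norm (x - y + t *\<^sub>R w)" by (simp add: algebra_simps)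
  qed
  then show ?thesis using y(1) by blast
qed

lemma csubspace_imp_subspace: "csubspace C \<Longrightarrow> subspace (C :: 'a::complex_hilbert set)"
  by (rule subspaceI) (auto simp: cvec.subspace_def scaleR_scaleC)

text \<open>A complex subspace contains \<open>- \<i> w\<close> together with \<open>w\<close>; real
  orthogonality to both kills the real and the imaginary part.\<close>

lemma cinner_eq_0_of_inner:
  assumes "csubspace C" "\<And>w. w \<in> C \<Longrightarrow> inner x w = 0" "w \<in> C"
  shows "cinner x (w :: 'a::complex_hilbert) = 0"
  using assms(2)[OF assms(3)] assms(2)[OF cvec.subspace_scale[OF assms(1,3)], of "- \<i>"]
  by (simp add: complex_eq_iff Im_cinner inner_eq_Re_cinner[symmetric])

lemma cinner_eq_0_cspan: "(\<And>e. e \<in> E \<Longrightarrow> cinner x e = 0) \<Longrightarrow> w \<in> cspan E \<Longrightarrow> cinner x w = 0"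
  by (erule cvec.span_induct_alt) (auto simp: cinner_add_right cinner_scaleC_right cinner.zero_right)

lemma csubspace_closure:
  assumes "csubspace (C :: 'a::complex_hilbert set)"
  shows "csubspace (closure C)"
  unfolding cvec.subspace_def
proof (intro conjI ballI allI)
  show "0 \<in> closure C" using assms closure_subset cvec.subspace_0 by blast
  fix x assume x: "x \<in> closure C"
  then obtain u where u: "\<And>n. u n \<in> C" "u \<longlonglongrightarrow> x" by (meson closure_sequential)
  show "c *\<^sub>C x \<in> closure C" for c
    unfolding closure_sequential
    by (rule exI[of _ "\<lambda>n. c *\<^sub>C u n"]) (use u assms in \<open>auto intro!: scaleC.tendsto cvec.subspace_scale\<close>)
  fix y assume "y \<in> closure C"
  then obtain v where v: "\<And>n. v n \<in> C" "v \<longlonglongrightarrow> y" by (meson closure_sequential)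
  show "x + y \<in> closure C"
    unfolding closure_sequential
    by (rule exI[of _ "\<lambda>n. u n + v n"]) (use u v assms in \<open>auto intro!: tendsto_add cvec.subspace_add\<close>)
qed

text \<open>\<open>orth_proj\<close> is a choice among bounded operators, so the nearest-point map
  has to be shown linear and bounded before the choice can be unfolded. Linearity comes from
  uniqueness of the orthogonal decomposition, boundedness from Pythagoras.\<close>

lemma orth_proj_works:
  assumes C: "closed C" "csubspace (C :: 'a::complex_hilbert set)"
  shows "orth_proj C x \<in> C" and "w \<in> C \<Longrightarrow> cinner w (x - orth_proj C x) = 0"
proof -
  have "\<exists>y. y \<in> C \<and> (\<forall>w\<in>C. cinner w (x - y) = 0)" for x
  proof -
    obtain y where y: "y \<in> C" "\<And>w. w \<in> C \<Longrightarrow> inner (x - y) w = 0"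
      using ex_orthogonal_decomposition[OF C(1) csubspace_imp_subspace[OF C(2)]] by blast
    then show ?thesis
      using cinner_eq_0_of_inner[OF C(2) y(2)] cinner_eq_0_commute by blast
  qed
  then obtain p where p: "\<And>x. p x \<in> C" "\<And>x w. w \<in> C \<Longrightarrow> cinner w (x - p x) = 0" by metis
  have uniq: "p x = y" if "y \<in> C" "\<And>w. w \<in> C \<Longrightarrow> cinner w (x - y) = 0" for x y
  proof -
    have d: "p x - y \<in> C" using p(1) that(1) C(2) by (simp add: cvec.subspace_diff)
    have "cinner (p x - y) (p x - y) = 0"
      using p(2)[OF d, of x] that(2)[OF d] by (simp add: cinner.diff_right)
    then show ?thesis by (simp add: cinner_self)
  qed
  have "bounded_linear p"
  proof (rule bounded_linear_intro[where K = 1])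
    show "p (x + y) = p x + p y" for x y
    proof (rule uniq)
      show "p x + p y \<in> C" using p(1) C(2) by (simp add: cvec.subspace_add)
      show "cinner w (x + y - (p x + p y)) = 0" if "w \<in> C" for w
        using p(2)[OF that, of x] p(2)[OF that, of y] by (simp add: cinner.diff_right cinner_add_right)
    qed
    show "p (r *\<^sub>R x) = r *\<^sub>R p x" for r x
    proof (rule uniq)
      show "r *\<^sub>R p x \<in> C" using p(1) C(2) by (simp add: cvec.subspace_scale scaleR_scaleC)
      show "cinner w (r *\<^sub>R x - r *\<^sub>R p x) = 0" if "w \<in> C" for w
        using p(2)[OF that, of x] by (simp add: cinner.diff_right cinner.scaleR_right)
    qed
    show "norm (p x) \<le> norm x * 1" for x
    proof -
      have "inner (p x) (x - p x) = 0" using p(2)[OF p(1)] by (simp add: inner_eq_Re_cinner)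
      then have "(norm x)\<^sup>2 = (norm (p x))\<^sup>2 + (norm (x - p x))\<^sup>2"
        by (simp add: power2_norm_eq_inner inner_diff_left inner_diff_right inner_commute)
      then have "(norm (p x))\<^sup>2 \<le> (norm x)\<^sup>2" by simp
      then show ?thesis by (simp add: power2_le_iff_abs_le)
    qed
  qed
  then have "\<exists>P :: 'a \<Rightarrow>\<^sub>L 'a. \<forall>x. P x \<in> C \<and> (\<forall>w\<in>C. cinner w (x - P x) = 0)"
    using p by (intro exI[of _ "Blinfun p"]) (simp add: bounded_linear_Blinfun_apply)
  then have "\<forall>x. orth_proj C x \<in> C \<and> (\<forall>w\<in>C. cinner w (x - orth_proj C x) = 0)"
    unfolding orth_proj_def by (rule someI_ex)
  then show "orth_proj C x \<in> C" "w \<in> C \<Longrightarrow> cinner w (x - orth_proj C x) = 0" by blast+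
qed

subsection \<open>Adjoints\<close>

lemma adj_eqI:
  assumes "\<And>x y. cinner (blinfun_apply B x) y = cinner x (blinfun_apply A y)"
  shows "adj A = B"
  unfolding adj_def
proof (rule some_equality)
  fix B' assume "\<forall>x y. cinner (blinfun_apply B' x) y = cinner x (blinfun_apply A y)"
  then show "B' = B" using assms by (intro blinfun_eqI) (rule cinner_ext, simp)
qed (use assms in simp)

text \<open>The real Riesz representation gives an operator that matches the real parts; complex
  linearity of \<open>A\<close> transfers the identity to the imaginary parts.\<close>

lemma cinner_adj_left:
  assumes A: "clinear_op A"
  shows "cinner (adj A x) y = cinner x (blinfun_apply A y)"
proof -
  have "\<exists>v. \<forall>y. inner x (A y) = inner v y" for x
    by (rule riesz_representation)
      (intro bounded_linear_compose[OF bounded_linear_inner_right] blinfun.bounded_linear_right)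
  then obtain b where b: "\<And>x y. inner (b x) y = inner x (A y)" by metis
  have cb: "cinner (b x) y = cinner x (A y)" for x y
  proof (rule complex_eqI)
    show "Re (cinner (b x) y) = Re (cinner x (A y))"
      using b by (simp only: inner_eq_Re_cinner)
    have "inner x (A ((- \<i>) *\<^sub>C y)) = inner x ((- \<i>) *\<^sub>C A y)"
      using A by (simp only: clinear_op_def)
    then show "Im (cinner (b x) y) = Im (cinner x (A y))"
      using b by (simp only: Im_cinner)
  qed
  have "bounded_linear b"
  proof (rule bounded_linear_intro[where K = "norm A"])
    show "b (x + y) = b x + b y" for x y by (rule cinner_ext) (simp add: cb cinner_add_left)
    show "b (r *\<^sub>R x) = r *\<^sub>R b x" for r x by (rule cinner_ext) (simp add: cb cinner.scaleR_left)
    show "norm (b x) \<le> norm x * norm A" for x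
    proof (cases "b x = 0")
      case False
      have "norm (b x) * norm (b x) = inner x (A (b x))"
        using b[of x "b x"] by (simp add: power2_norm_eq_inner[symmetric] power2_eq_square)
      also have "\<dots> \<le> norm x * (norm A * norm (b x))"
        by (rule order_trans[OF norm_cauchy_schwarz]) (intro mult_left_mono norm_blinfun norm_ge_zero)
      finally show ?thesis using False by (simp add: mult.assoc[symmetric])
    qed simp
  qed
  then have "\<exists>B. \<forall>x y. cinner (blinfun_apply B x) y = cinner x (blinfun_apply A y)"
    by (intro exI[of _ "Blinfun b"]) (simp add: bounded_linear_Blinfun_apply cb)
  then have "\<forall>x y. cinner (adj A x) y = cinner x (blinfun_apply A y)"
    unfolding adj_def by (rule someI_ex)
  then show ?thesis by blast
qed

lemma cinner_adj_right: "clinear_op A \<Longrightarrow> cinner y (adj A x) = cinner (blinfun_apply A y) x"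
  by (metis cinner_adj_left cinner_commute)

text \<open>Elements of the operator type are only real-linear. Being a formal adjoint forces
  complex linearity; self-adjoint operators are the case \<open>B = A\<close>.\<close>

lemma clinear_opI_adjoint:
  assumes "\<And>x y. cinner (blinfun_apply B x) y = cinner x (blinfun_apply A y)"
  shows "clinear_op B"
  unfolding clinear_op_def by (intro allI) (rule cinner_ext, simp add: assms cinner_scaleC_left)

lemma clinear_op_adj: "clinear_op A \<Longrightarrow> clinear_op (adj A)"
  by (rule clinear_opI_adjoint) (rule cinner_adj_left)

lemma selfadjoint_clinear: "selfadjoint A \<Longrightarrow> clinear_op A"
  by (rule clinear_opI_adjoint) (auto simp: selfadjoint_def)

lemma adj_selfadjoint: "selfadjoint A \<Longrightarrow> adj A = A"
  by (rule adj_eqI) (simp add: selfadjoint_def)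

lemma clinear_op_compose: "clinear_op A \<Longrightarrow> clinear_op B \<Longrightarrow> clinear_op (A o\<^sub>L B)"
  by (simp add: clinear_op_def)

lemma clinear_op_diff: "clinear_op A \<Longrightarrow> clinear_op B \<Longrightarrow> clinear_op (A - B)"
  by (simp add: clinear_op_def blinfun.diff_left scaleC.diff_right)

lemma clinear_op_sum: "(\<And>i. i \<in> I \<Longrightarrow> clinear_op (A i)) \<Longrightarrow> clinear_op (\<Sum>i\<in>I. A i)"
  by (simp add: clinear_op_def blinfun.sum_left scaleC.sum_right)

lemma selfadjoint_re_op:
  assumes "clinear_op T"
  shows "selfadjoint (re_op T)"
  using assms by (simp add: selfadjoint_def re_op_def blinfun.add_left cinner_scaleC_left
      cinner_scaleC_right cinner_add_left cinner_add_right cinner_adj_left cinner_adj_right)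

lemma selfadjoint_im_op:
  assumes "clinear_op T"
  shows "selfadjoint (im_op T)"
  using assms by (simp add: selfadjoint_def im_op_def blinfun.diff_left cinner_scaleC_left
      cinner_scaleC_right cinner.diff_left cinner.diff_right cinner_adj_left cinner_adj_right algebra_simps)

lemma cinner_im_op:
  assumes "clinear_op T"
  shows "cinner x (im_op T x) = complex_of_real (Im (cinner x (blinfun_apply T x)))"
proof -
  have "cinner x (im_op T x) = (1 / (2 * \<i>)) * (cinner x (T x) - cinner (T x) x)"
    unfolding im_op_def blinfun_apply_blinfun_compose scalar_op_apply blinfun.diff_left
      cinner_scaleC_right cinner.diff_right cinner_adj_right[OF assms] ..
  also have "cinner (T x) x = cnj (cinner x (T x))" by (rule cinner_commute)
  finally show ?thesis by (simp add: complex_eq_iff)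
qed

subsection \<open>Square roots of positive operators\<close>

lemma selfadjoint_cinner_real: "selfadjoint A \<Longrightarrow> Im (cinner x (blinfun_apply A x)) = 0"
  by (metis cinner_commute cnj.simps(2) equal_neg_zero selfadjoint_def)

text \<open>The form of \<open>A\<close> along \<open>x + t y\<close> is a quadratic polynomial in
  \<open>t\<close> that is never negative, so its discriminant is at most zero.\<close>

lemma positive_op_cauchy_schwarz:
  fixes A :: "'a::complex_hilbert \<Rightarrow>\<^sub>L 'a"
  assumes "positive_op A"
  shows "(inner x (A y))\<^sup>2 \<le> inner x (A x) * inner y (A y)"
proof -
  have pos: "0 \<le> inner z (A z)" for z using assms by (simp add: positive_op_def inner_eq_Re_cinner)
  have sym: "inner y (A x) = inner x (A y)"
    using assms by (metis inner_commute inner_eq_Re_cinner positive_op_def selfadjoint_def)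
  have q: "0 \<le> inner x (A x) + 2 * t * inner x (A y) + t\<^sup>2 * inner y (A y)" for t
    using pos[of "x + t *\<^sub>R y"] sym
    by (simp add: blinfun.add_right blinfun.scaleR_right inner_add_left inner_add_right
        power2_eq_square algebra_simps)
  show ?thesis
  proof (cases "inner y (A y) = 0")
    case True
    have "inner x (A y) = 0"
    proof (rule ccontr)
      assume n: "inner x (A y) \<noteq> 0"
      \<comment> \<open>With vanishing leading coefficient the polynomial is affine, and this
        \<open>t\<close> gives it the value \<open>-1\<close>.\<close>
      then show False using q[of "- (inner x (A x) + 1) / (2 * inner x (A y))"] True by (simp add: divide_simps)
    qed
    then show ?thesis using True by simp
  next
    case False
    then have p: "0 < inner y (A y)" using pos[of y] by simp
    have "0 \<le> inner y (A y) * (inner x (A x) + 2 * (- inner x (A y) / inner y (A y)) * inner x (A y)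
        + (- inner x (A y) / inner y (A y))\<^sup>2 * inner y (A y))"
      by (intro mult_nonneg_nonneg less_imp_le[OF p] q)
    also have "\<dots> = inner x (A x) * inner y (A y) - (inner x (A y))\<^sup>2"
      using p by (simp add: field_simps power2_eq_square)
    finally show ?thesis by simp
  qed
qed

text \<open>Cauchy-Schwarz for the form, applied to the pair \<open>A x\<close>, \<open>x\<close>,
  bounds the fourth power of the norm of \<open>A x\<close> by \<open>c^2\<close> times the squared
  norms of \<open>A x\<close> and \<open>x\<close>.\<close>

lemma norm_positive_op_le:
  fixes A :: "'a::complex_hilbert \<Rightarrow>\<^sub>L 'a"
  assumes A: "positive_op A" and c: "0 \<le> c" "\<And>x. inner x (A x) \<le> c * (norm x)\<^sup>2"
  shows "norm A \<le> c"
proof (rule norm_blinfun_bound)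
  fix x
  have "(inner (A x) (A x))\<^sup>2 \<le> inner (A x) (A (A x)) * inner x (A x)"
    by (rule positive_op_cauchy_schwarz[OF A])
  also have "\<dots> \<le> (c * (norm (A x))\<^sup>2) * (c * (norm x)\<^sup>2)"
    using c A by (intro mult_mono) (auto simp: positive_op_def inner_eq_Re_cinner)
  finally have "(norm (A x))\<^sup>2 * (norm (A x))\<^sup>2 \<le> (norm (A x))\<^sup>2 * (c * norm x)\<^sup>2"
    by (simp add: power2_norm_eq_inner[symmetric] power2_eq_square mult_ac)
  then have "(norm (A x))\<^sup>2 \<le> (c * norm x)\<^sup>2" if "A x \<noteq> 0"
    by (rule mult_left_le_imp_le) (use that in simp)
  then show "norm (A x) \<le> c * norm x"
    using c(1) by (cases "A x = 0") (auto simp: power2_le_iff_abs_le)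
qed (rule c)

lemma positive_op_scaleR: "positive_op A \<Longrightarrow> 0 \<le> r \<Longrightarrow> positive_op (r *\<^sub>R A)"
  by (simp add: positive_op_def selfadjoint_def blinfun.scaleR_left cinner.scaleR_left cinner.scaleR_right)

text \<open>Majorising the operator iteration by the scalar iteration with \<open>A = 1\<close> gives convergence in
  norm.\<close>

lemma ex_sqrt_contraction:
  fixes A :: "'a::complex_hilbert \<Rightarrow>\<^sub>L 'a"
  assumes A: "selfadjoint A" "norm A \<le> 1"
  shows "\<exists>B. positive_op B \<and> B o\<^sub>L B = id_blinfun - A"
proof -
  \<comment> \<open>A fixed point \<open>Z = (A + Z^2) / 2\<close> is exactly a solution of
    \<open>(1 - Z)^2 = 1 - A\<close>.\<close>
  define Y where "Y = rec_nat 0 (\<lambda>_ Z. (1/2) *\<^sub>R (A + (Z o\<^sub>L Z)))"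
  define y where "y = rec_nat 0 (\<lambda>_ z. (1/2) * (1 + z * z :: real))"
  have Y: "Y 0 = 0" "\<And>n. Y (Suc n) = (1/2) *\<^sub>R (A + (Y n o\<^sub>L Y n))" by (simp_all add: Y_def)
  have y: "y 0 = 0" "\<And>n. y (Suc n) = (1/2) * (1 + y n * y n)" by (simp_all add: y_def)
  have y01: "0 \<le> y n \<and> y n \<le> 1" for n
    by (induction n) (auto simp: y mult_le_one)
  have nY: "norm (Y n) \<le> y n" for n
  proof (induction n)
    case (Suc n)
    have "norm (A + (Y n o\<^sub>L Y n)) \<le> 1 + y n * y n"
      using norm_triangle_ineq[of A "Y n o\<^sub>L Y n"] norm_blinfun_compose[of "Y n" "Y n"]
        mult_mono[OF Suc Suc] y01[of n] A(2) by fastforce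
    then show ?case by (simp add: Y y)
  qed (simp add: Y y)
  have dY: "norm (Y (Suc n) - Y n) \<le> y (Suc n) - y n" for n
  proof (induction n)
    case 0
    then show ?case using A(2) by (simp add: Y y)
  next
    case (Suc n)
    have "Y (Suc (Suc n)) - Y (Suc n)
        = (1/2) *\<^sub>R (A + (Y (Suc n) o\<^sub>L Y (Suc n))) - (1/2) *\<^sub>R (A + (Y n o\<^sub>L Y n))"
      by (simp only: Y)
    \<comment> \<open>The difference of two squares is split without commuting any factors, so that
      each term contains the previous increment; the scalar increments obey the same
      recursion.\<close>
    also have "\<dots> = (1/2) *\<^sub>R (((Y (Suc n) - Y n) o\<^sub>L Y (Suc n)) + (Y n o\<^sub>L (Y (Suc n) - Y n)))"
      by (rule blinfun_eqI)
        (simp add: blinfun.diff_left blinfun.add_left blinfun.scaleR_left blinfun.diff_right algebra_simps)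
    finally have "norm (Y (Suc (Suc n)) - Y (Suc n))
        \<le> (1/2) * (norm ((Y (Suc n) - Y n) o\<^sub>L Y (Suc n)) + norm (Y n o\<^sub>L (Y (Suc n) - Y n)))"
      using norm_triangle_ineq by simp
    also have "\<dots> \<le> (1/2) * ((y (Suc n) - y n) * y (Suc n) + y n * (y (Suc n) - y n))"
    proof (intro mult_left_mono add_mono)
      show "norm ((Y (Suc n) - Y n) o\<^sub>L Y (Suc n)) \<le> (y (Suc n) - y n) * y (Suc n)"
        by (rule order_trans[OF norm_blinfun_compose])
          (use Suc nY norm_ge_zero order_trans in \<open>blast intro: mult_mono\<close>)
      show "norm (Y n o\<^sub>L (Y (Suc n) - Y n)) \<le> y n * (y (Suc n) - y n)"
        by (rule order_trans[OF norm_blinfun_compose])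
          (use Suc nY y01 in \<open>blast intro: mult_mono norm_ge_zero\<close>)
    qed simp
    also have "\<dots> = y (Suc (Suc n)) - y (Suc n)"
      using y(2)[of "Suc n"] y(2)[of n] by (simp add: algebra_simps)
    finally show ?case .
  qed
  have "incseq y"
    by (rule incseq_SucI) (metis dY diff_ge_0_iff_ge norm_ge_zero order_trans)
  then obtain L where "y \<longlonglongrightarrow> L" using incseq_convergent[of y 1] y01 by blast
  then have "summable (\<lambda>n. y (Suc n) - y n)" by (rule telescope_summable)
  then have "summable (\<lambda>n. Y (Suc n) - Y n)"
    by (rule summable_comparison_test'[where N = 0]) (rule dY)
  then have "(\<lambda>n. \<Sum>i<n. Y (Suc i) - Y i) \<longlonglongrightarrow> (\<Sum>n. Y (Suc n) - Y n)"
    by (rule summable_LIMSEQ)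
  then have "Y \<longlonglongrightarrow> (\<Sum>n. Y (Suc n) - Y n)"
    unfolding sum_lessThan_telescope by (simp only: Y(1) diff_zero)
  then obtain Z where Z: "Y \<longlonglongrightarrow> Z" by blast
  have "(\<lambda>n. Y (Suc n)) \<longlonglongrightarrow> (1/2) *\<^sub>R (A + (Z o\<^sub>L Z))"
    unfolding Y(2) by (intro tendsto_intros bounded_bilinear.tendsto[OF bounded_bilinear_blinfun_compose] Z)
  then have Zeq: "Z = (1/2) *\<^sub>R (A + (Z o\<^sub>L Z))"
    using LIMSEQ_Suc[OF Z] LIMSEQ_unique by blast
  have sY: "selfadjoint (Y n)" for n
    using A(1) by (induction n) (simp_all add: Y selfadjoint_def blinfun.add_left blinfun.scaleR_left
        cinner.scaleR_left cinner.scaleR_right cinner_add_left cinner_add_right cinner.zero_left cinner.zero_right)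
  have sZ: "cinner (Z u) v = cinner u (Z v)" for u v
  proof (rule LIMSEQ_unique)
    show "(\<lambda>n. cinner (Y n u) v) \<longlonglongrightarrow> cinner (Z u) v"
      by (intro cinner.tendsto blinfun.tendsto Z tendsto_const)
    have "(\<lambda>n. cinner u (Y n v)) \<longlonglongrightarrow> cinner u (Z v)"
      by (intro cinner.tendsto blinfun.tendsto Z tendsto_const)
    moreover have "cinner (Y n u) v = cinner u (Y n v)" for n
      using sY[of n] unfolding selfadjoint_def by blast
    ultimately show "(\<lambda>n. cinner (Y n u) v) \<longlonglongrightarrow> cinner u (Z v)" by (simp only:)
  qed
  have nZ: "norm Z \<le> 1"
    by (rule LIMSEQ_le_const2[OF tendsto_norm[OF Z]]) (meson nY y01 order_trans)
  have "positive_op (id_blinfun - Z)"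
    unfolding positive_op_def selfadjoint_def
  proof (intro conjI allI)
    show "cinner ((id_blinfun - Z) u) v = cinner u ((id_blinfun - Z) v)" for u v
      by (simp add: blinfun.diff_left cinner.diff_left cinner.diff_right sZ)
    have "inner u (Z u) \<le> inner u u" for u
    proof -
      have "norm (Z u) \<le> norm u"
        using norm_blinfun[of Z u] mult_right_mono[OF nZ norm_ge_zero[of u]] by simp
      then have "inner u (Z u) \<le> norm u * norm u"
        by (intro order_trans[OF norm_cauchy_schwarz] mult_left_mono) auto
      then show ?thesis by (simp add: power2_norm_eq_inner[symmetric] power2_eq_square)
    qed
    then show "0 \<le> Re (cinner u ((id_blinfun - Z) u))" for u
      by (simp add: inner_eq_Re_cinner[symmetric] blinfun.diff_left inner_diff_right)
  qed
  moreover have "(id_blinfun - Z) o\<^sub>L (id_blinfun - Z) = id_blinfun - A"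
  proof (rule blinfun_eqI)
    fix x
    have "Z x = (1/2) *\<^sub>R (A x + Z (Z x))"
      by (subst Zeq) (simp add: blinfun.scaleR_left blinfun.add_left)
    then have "2 *\<^sub>R Z x = 2 *\<^sub>R (1/2) *\<^sub>R (A x + Z (Z x))" by (rule arg_cong)
    then have "2 *\<^sub>R Z x = A x + Z (Z x)" by (simp only: scaleR_scaleR) simp
    then have "Z (Z x) = Z x + Z x - A x" by (simp add: scaleR_2)
    then show "((id_blinfun - Z) o\<^sub>L (id_blinfun - Z)) x = (id_blinfun - A) x"
      by (simp add: blinfun.diff_left blinfun.diff_right)
  qed
  ultimately show ?thesis by blast
qed

text \<open>Write \<open>A = c (1 - D)\<close>, where \<open>D = 1 - A / c\<close> has its form
  between \<open>0\<close> and \<open>1\<close> and is therefore a contraction. The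
  \<open>+ 1\<close> in \<open>c\<close> covers \<open>A = 0\<close>.\<close>

lemma ex_sqrt_op:
  fixes A :: "'a::complex_hilbert \<Rightarrow>\<^sub>L 'a"
  assumes A: "positive_op A"
  shows "\<exists>B. positive_op B \<and> B o\<^sub>L B = A"
proof -
  define c where "c = norm A + 1"
  have c: "0 < c" by (simp add: c_def add_nonneg_pos)
  define D where "D = id_blinfun - (1 / c) *\<^sub>R A"
  have le: "inner x (A x) \<le> c * (norm x)\<^sup>2" for x
  proof -
    have "inner x (A x) \<le> norm x * (norm A * norm x)"
      by (rule order_trans[OF norm_cauchy_schwarz]) (intro mult_left_mono norm_blinfun norm_ge_zero)
    also have "\<dots> \<le> c * (norm x)\<^sup>2" by (simp add: c_def power2_eq_square algebra_simps)
    finally show ?thesis .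
  qed
  have "positive_op D"
    using A le c by (auto simp: D_def positive_op_def selfadjoint_def blinfun.diff_left blinfun.scaleR_left
        cinner.diff_left cinner.diff_right cinner.scaleR_left cinner.scaleR_right
        inner_eq_Re_cinner[symmetric] power2_norm_eq_inner[symmetric] inner_diff_right divide_simps mult.commute)
  moreover have "inner x (D x) \<le> 1 * (norm x)\<^sup>2" for x
    using A c by (simp add: D_def positive_op_def blinfun.diff_left blinfun.scaleR_left inner_diff_right
        power2_norm_eq_inner inner_eq_Re_cinner[symmetric])
  ultimately obtain B where B: "positive_op B" "B o\<^sub>L B = id_blinfun - D"
    using norm_positive_op_le[of D 1] ex_sqrt_contraction[of D] by (auto simp: positive_op_def)
  have "(sqrt c *\<^sub>R B) o\<^sub>L (sqrt c *\<^sub>R B) = c *\<^sub>R (B o\<^sub>L B)"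
    using c by (intro blinfun_eqI) (simp add: blinfun.scaleR_left blinfun.scaleR_right)
  also have "\<dots> = A" unfolding B(2) D_def using c by simp
  finally have "(sqrt c *\<^sub>R B) o\<^sub>L (sqrt c *\<^sub>R B) = A" .
  moreover have "positive_op (sqrt c *\<^sub>R B)" using B(1) c by (intro positive_op_scaleR) auto
  ultimately show ?thesis by blast
qed

lemma sqrt_op_works:
  assumes "positive_op A"
  shows "positive_op (sqrt_op A)" and "sqrt_op A o\<^sub>L sqrt_op A = A"
proof -
  have "positive_op (sqrt_op A) \<and> sqrt_op A o\<^sub>L sqrt_op A = A"
    unfolding sqrt_op_def by (rule someI_ex) (rule ex_sqrt_op[OF assms])
  then show "positive_op (sqrt_op A)" "sqrt_op A o\<^sub>L sqrt_op A = A" by simp_all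
qed

text \<open>Hilbert-Schmidt norms and traces are treated as sums in \<open>ennreal\<close>, where
  every family is summable and sums may be interchanged freely.\<close>

lemma summable_ennreal: "(f :: 'i \<Rightarrow> ennreal) summable_on A"
  by (rule nonneg_summable_on_complete) simp

section \<open>Orthonormal bases and the Hilbert--Schmidt norm\<close>

lemma sum_le_infsum_ennreal:
  fixes f :: "'i \<Rightarrow> ennreal"
  shows "finite F \<Longrightarrow> F \<subseteq> A \<Longrightarrow> sum f F \<le> infsum f A"
  by (subst nonneg_infsum_complete) (auto intro: SUP_upper)

lemma infsum_leI_ennreal:
  fixes f :: "'i \<Rightarrow> ennreal"
  shows "(\<And>F. finite F \<Longrightarrow> F \<subseteq> A \<Longrightarrow> sum f F \<le> b) \<Longrightarrow> infsum f A \<le> b"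
  by (rule infsum_le_finite_sums[OF summable_ennreal])

lemma infsum_mono_ennreal:
  fixes f g :: "'i \<Rightarrow> ennreal"
  shows "(\<And>x. x \<in> A \<Longrightarrow> f x \<le> g x) \<Longrightarrow> infsum f A \<le> infsum g A"
  by (rule infsum_mono[OF summable_ennreal summable_ennreal])

lemma infsum_mono_set_ennreal:
  fixes f :: "'i \<Rightarrow> ennreal"
  shows "A \<subseteq> B \<Longrightarrow> infsum f A \<le> infsum f B"
  by (rule infsum_leI_ennreal) (auto intro: sum_le_infsum_ennreal)

lemma infsum_add_ennreal:
  fixes f g :: "'i \<Rightarrow> ennreal"
  shows "(\<Sum>\<^sub>\<infinity>x\<in>A. f x + g x) = infsum f A + infsum g A"
  by (rule infsum_add[OF summable_ennreal summable_ennreal])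

lemma infsum_sum_ennreal:
  fixes f :: "'j \<Rightarrow> 'i \<Rightarrow> ennreal"
  assumes "finite F"
  shows "(\<Sum>\<^sub>\<infinity>y\<in>B. \<Sum>x\<in>F. f x y) = (\<Sum>x\<in>F. \<Sum>\<^sub>\<infinity>y\<in>B. f x y)"
  using assms by (induction F rule: finite_induct) (auto simp: infsum_add_ennreal)

lemma infsum_cmult_ennreal:
  fixes f :: "'i \<Rightarrow> ennreal"
  shows "(\<Sum>\<^sub>\<infinity>x\<in>A. c * f x) = c * infsum f A"
proof -
  have "(\<Sum>\<^sub>\<infinity>x\<in>A. c * f x) = (SUP F\<in>{F. finite F \<and> F \<subseteq> A}. c * sum f F)"
    by (subst nonneg_infsum_complete) (auto simp: sum_distrib_left)
  also have "\<dots> = c * (SUP F\<in>{F. finite F \<and> F \<subseteq> A}. sum f F)"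
    by (rule SUP_mult_left_ennreal[symmetric])
  finally show ?thesis by (subst (2) nonneg_infsum_complete) auto
qed

text \<open>A finite outer sum commutes with the inner one exactly; the supremum over finite sets
  gives one inequality, and exchanging the roles of the variables gives the other.\<close>

lemma infsum_swap_le_ennreal:
  fixes f :: "'i \<Rightarrow> 'j \<Rightarrow> ennreal"
  shows "(\<Sum>\<^sub>\<infinity>x\<in>A. \<Sum>\<^sub>\<infinity>y\<in>B. f x y) \<le> (\<Sum>\<^sub>\<infinity>y\<in>B. \<Sum>\<^sub>\<infinity>x\<in>A. f x y)"
proof (rule infsum_leI_ennreal)
  fix F assume F: "finite F" "F \<subseteq> A"
  have "(\<Sum>x\<in>F. \<Sum>\<^sub>\<infinity>y\<in>B. f x y) = (\<Sum>\<^sub>\<infinity>y\<in>B. \<Sum>x\<in>F. f x y)"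
    using F by (simp add: infsum_sum_ennreal)
  also have "\<dots> \<le> (\<Sum>\<^sub>\<infinity>y\<in>B. \<Sum>\<^sub>\<infinity>x\<in>A. f x y)"
    using F by (intro infsum_mono_ennreal sum_le_infsum_ennreal)
  finally show "(\<Sum>x\<in>F. \<Sum>\<^sub>\<infinity>y\<in>B. f x y) \<le> \<dots>" .
qed

lemma infsum_swap_ennreal:
  fixes f :: "'i \<Rightarrow> 'j \<Rightarrow> ennreal"
  shows "(\<Sum>\<^sub>\<infinity>x\<in>A. \<Sum>\<^sub>\<infinity>y\<in>B. f x y) = (\<Sum>\<^sub>\<infinity>y\<in>B. \<Sum>\<^sub>\<infinity>x\<in>A. f x y)"
  by (intro antisym infsum_swap_le_ennreal)

text \<open>A finite subset of the product lies in the product of its two projections.\<close>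

lemma infsum_Times_le_ennreal:
  fixes f :: "'i \<times> 'j \<Rightarrow> ennreal"
  shows "infsum f (A \<times> B) \<le> (\<Sum>\<^sub>\<infinity>x\<in>A. \<Sum>\<^sub>\<infinity>y\<in>B. f (x, y))"
proof (rule infsum_leI_ennreal)
  fix F assume F: "finite F" "F \<subseteq> A \<times> B"
  have "sum f F \<le> sum f (fst ` F \<times> snd ` F)"
    using F by (intro sum_mono2) (auto simp: subset_fst_snd intro: rev_image_eqI)
  also have "\<dots> = (\<Sum>x\<in>fst ` F. \<Sum>y\<in>snd ` F. f (x, y))" by (simp add: sum.cartesian_product)
  also have "\<dots> \<le> (\<Sum>x\<in>fst ` F. \<Sum>\<^sub>\<infinity>y\<in>B. f (x, y))"
    using F by (intro sum_mono sum_le_infsum_ennreal) auto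
  also have "\<dots> \<le> (\<Sum>\<^sub>\<infinity>x\<in>A. \<Sum>\<^sub>\<infinity>y\<in>B. f (x, y))"
    using F by (intro sum_le_infsum_ennreal) auto
  finally show "sum f F \<le> \<dots>" .
qed

section \<open>Orthonormal families, Bessel's inequality and Parseval's identity\<close>

definition orthonormal :: "'a::complex_hilbert set \<Rightarrow> bool" where
  "orthonormal E \<longleftrightarrow> (\<forall>e\<in>E. \<forall>e'\<in>E. cinner e e' = (if e = e' then 1 else 0))"

lemma orthonormal_subset: "orthonormal E \<Longrightarrow> F \<subseteq> E \<Longrightarrow> orthonormal F"
  unfolding orthonormal_def by blast

lemma norm_eq_1_cinner: "norm (x :: 'a::complex_hilbert) = 1 \<longleftrightarrow> cinner x x = 1"
  by (metis cinner_self norm_ge_zero of_real_1 of_real_eq_1_iff one_power2 power2_eq_1_iff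
      le_minus_one_simps(3))

lemma orthonormal_norm: "orthonormal E \<Longrightarrow> e \<in> E \<Longrightarrow> norm e = 1"
  by (simp add: orthonormal_def norm_eq_1_cinner)

lemma orthonormal_insert:
  assumes "orthonormal E" "norm x = 1" "\<And>e. e \<in> E \<Longrightarrow> cinner e x = 0"
  shows "orthonormal (insert x E)" "x \<notin> E"
  using assms cinner_eq_0_commute[of x] by (auto simp: orthonormal_def norm_eq_1_cinner)

lemma orthonormal_singleton: "norm x = 1 \<Longrightarrow> orthonormal {x}"
  by (simp add: orthonormal_def norm_eq_1_cinner)

lemma csubspace_closure_cspan: "csubspace (closure (cspan E))"
  by (intro csubspace_closure cvec.subspace_span)

text \<open>The difference between \<open>x\<close> and its projection onto the closed span of
  \<open>E\<close> is orthogonal to \<open>E\<close>, hence zero, so \<open>x\<close> lies in that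
  span.\<close>

lemma is_onbI:
  assumes E: "orthonormal E" and 0: "\<And>x. (\<And>e. e \<in> E \<Longrightarrow> cinner e x = 0) \<Longrightarrow> x = 0"
  shows "is_onb E"
proof -
  have "x \<in> closure (cspan E)" for x
  proof -
    let ?P = "orth_proj (closure (cspan E))"
    note P = orth_proj_works[where C = "closure (cspan E)", OF closed_closure csubspace_closure_cspan]
    have "E \<subseteq> closure (cspan E)" using cvec.span_superset closure_subset by blast
    then have "x - ?P x = 0" using P(2) by (intro 0) blast
    then show ?thesis using P(1)[of x] by simp
  qed
  then show ?thesis using E by (auto simp: is_onb_def orthonormal_def)
qed

lemma is_onb_orthonormal: "is_onb E \<Longrightarrow> orthonormal E"
  by (simp add: is_onb_def orthonormal_def)

text \<open>Zorn's lemma: a nonzero vector orthogonal to a maximal orthonormal family could be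
  normalised and added to it.\<close>

lemma ex_onb_extending:
  assumes F: "orthonormal (F :: 'a::complex_hilbert set)"
  shows "\<exists>E. F \<subseteq> E \<and> is_onb E"
proof -
  let ?A = "{E. F \<subseteq> E \<and> orthonormal E}"
  have "\<exists>M\<in>?A. \<forall>X\<in>?A. M \<subseteq> X \<longrightarrow> X = M"
  proof (rule subset_Zorn_nonempty)
    show "?A \<noteq> {}" using F by blast
    fix C assume C: "C \<noteq> {}" "subset.chain ?A C"
    have "orthonormal (\<Union>C)"
      unfolding orthonormal_def
    proof (intro ballI)
      fix e e' assume "e \<in> \<Union>C" "e' \<in> \<Union>C"
      then obtain X X' where X: "e \<in> X" "X \<in> C" "e' \<in> X'" "X' \<in> C" by blast
      then have "X \<subseteq> X' \<or> X' \<subseteq> X" using C(2) by (auto simp: subset_chain_def)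
      then obtain Z where "e \<in> Z" "e' \<in> Z" "Z \<in> C" using X by blast
      moreover then have "orthonormal Z" using C(2) by (auto simp: subset_chain_def)
      ultimately show "cinner e e' = (if e = e' then 1 else 0)" by (simp add: orthonormal_def)
    qed
    moreover have "F \<subseteq> \<Union>C" using C unfolding subset_chain_def by blast
    ultimately show "\<Union>C \<in> ?A" by blast
  qed
  then obtain M where M: "F \<subseteq> M" "orthonormal M" and max: "\<forall>X\<in>?A. M \<subseteq> X \<longrightarrow> X = M"
    by auto
  have "x = 0" if "\<And>e. e \<in> M \<Longrightarrow> cinner e x = 0" for x
  proof (rule ccontr)
    assume "x \<noteq> 0"
    define y where "y = inverse (norm x) *\<^sub>R x"
    have "norm y = 1" using \<open>x \<noteq> 0\<close> by (simp add: y_def)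
    moreover have "cinner e y = 0" if "e \<in> M" for e
      using \<open>\<And>e. e \<in> M \<Longrightarrow> cinner e x = 0\<close>[OF that] by (simp add: y_def cinner.scaleR_right)
    ultimately have "orthonormal (insert y M)" "y \<notin> M"
      using orthonormal_insert[OF M(2)] by blast+
    then show False using M(1) max[rule_format, of "insert y M"] by blast
  qed
  then have "is_onb M" by (rule is_onbI[OF M(2)])
  then show ?thesis using M(1) by blast
qed

lemma ex_onb: "\<exists>E. is_onb (E :: 'a::complex_hilbert set)"
  using ex_onb_extending[of "{}"] by (auto simp: orthonormal_def)

lemma norm_sq_orthonormal_sum:
  assumes "finite F" "orthonormal F"
  shows "(norm (\<Sum>e\<in>F. c e *\<^sub>C e))\<^sup>2 = (\<Sum>e\<in>F. (cmod (c e))\<^sup>2)"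
proof -
  have "cinner e (\<Sum>e'\<in>F. c e' *\<^sub>C e') = c e" if "e \<in> F" for e
  proof -
    have "cinner e (\<Sum>e'\<in>F. c e' *\<^sub>C e') = (\<Sum>e'\<in>F. if e = e' then c e' else 0)"
      unfolding cinner.sum_right using assms that
      by (intro sum.cong) (auto simp: cinner_scaleC_right orthonormal_def)
    then show ?thesis using assms(1) that by (simp add: sum.delta)
  qed
  then have "cinner (\<Sum>e\<in>F. c e *\<^sub>C e) (\<Sum>e\<in>F. c e *\<^sub>C e) = (\<Sum>e\<in>F. cnj (c e) * c e)"
    unfolding cinner.sum_left by (intro sum.cong) (auto simp: cinner_scaleC_left)
  then have "complex_of_real ((norm (\<Sum>e\<in>F. c e *\<^sub>C e))\<^sup>2) = complex_of_real (\<Sum>e\<in>F. (cmod (c e))\<^sup>2)"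
    unfolding cinner_self of_real_sum complex_norm_square by (simp add: mult.commute)
  then show ?thesis by (simp only: of_real_eq_iff)
qed

text \<open>Pythagoras through the orthogonal projection \<open>p\<close> of \<open>x\<close> onto
  the span. Taking \<open>y = p\<close> yields Bessel's inequality; letting \<open>y\<close>
  approximate \<open>x\<close> yields Parseval's identity.\<close>

lemma bessel_identity:
  assumes F: "finite F" "orthonormal F" and y: "y \<in> cspan F"
  shows "(norm (x - y))\<^sup>2
    = ((norm x)\<^sup>2 - (\<Sum>e\<in>F. (cmod (cinner e x))\<^sup>2)) + (norm ((\<Sum>e\<in>F. cinner e x *\<^sub>C e) - y))\<^sup>2"
proof -
  define p where "p = (\<Sum>e\<in>F. cinner e x *\<^sub>C e)"
  have p: "p \<in> cspan F"
    unfolding p_def by (intro cvec.span_sum cvec.span_scale cvec.span_base)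
  have "cinner e p = cinner e x" if "e \<in> F" for e
  proof -
    have "cinner e p = (\<Sum>e'\<in>F. if e = e' then cinner e' x else 0)"
      unfolding p_def cinner.sum_right using F that
      by (intro sum.cong) (auto simp: cinner_scaleC_right orthonormal_def)
    then show ?thesis using F(1) that by (simp add: sum.delta)
  qed
  then have "cinner (x - p) e = 0" if "e \<in> F" for e
    using that cinner_eq_0_commute[of "x - p" e] by (simp add: cinner.diff_right)
  then have "cinner (x - p) w = 0" if "w \<in> cspan F" for w
    using that by (rule cinner_eq_0_cspan)
  then have orth: "inner (x - p) w = 0" if "w \<in> cspan F" for w
    using that by (simp add: inner_eq_Re_cinner)
  have pyth: "(norm (x - w))\<^sup>2 = (norm (x - p))\<^sup>2 + (norm (p - w))\<^sup>2" if "w \<in> cspan F" for w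
  proof -
    have "inner (x - p) (p - w) = 0" using p that by (intro orth cvec.span_diff)
    moreover have "x - w = (x - p) + (p - w)" by simp
    ultimately show ?thesis
      by (metis (no_types) norm_add_Pythagorean orthogonal_def)
  qed
  have "(norm p)\<^sup>2 = (\<Sum>e\<in>F. (cmod (cinner e x))\<^sup>2)"
    unfolding p_def by (rule norm_sq_orthonormal_sum[OF F])
  then show ?thesis
    using pyth[OF y] pyth[OF cvec.span_zero] unfolding p_def[symmetric] by simp
qed

lemma bessel_inequality:
  assumes "finite F" "orthonormal F"
  shows "(\<Sum>e\<in>F. (cmod (cinner e x))\<^sup>2) \<le> (norm x)\<^sup>2"
proof -
  have "(\<Sum>e\<in>F. cinner e x *\<^sub>C e) \<in> cspan F"
    by (intro cvec.span_sum cvec.span_scale cvec.span_base)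
  from bessel_identity[OF assms this, of x] show ?thesis
    using zero_le_power2[of "norm (x - (\<Sum>e\<in>F. cinner e x *\<^sub>C e))"] by simp
qed

lemma parseval:
  assumes E: "is_onb E"
  shows "(\<Sum>\<^sub>\<infinity>e\<in>E. ennreal ((cmod (cinner e x))\<^sup>2)) = ennreal ((norm x)\<^sup>2)"
proof (rule antisym)
  have on: "orthonormal F" if "F \<subseteq> E" for F
    using E that orthonormal_subset is_onb_orthonormal by blast
  show "(\<Sum>\<^sub>\<infinity>e\<in>E. ennreal ((cmod (cinner e x))\<^sup>2)) \<le> ennreal ((norm x)\<^sup>2)"
    using on by (intro infsum_leI_ennreal) (simp add: sum_ennreal bessel_inequality)
  show "ennreal ((norm x)\<^sup>2) \<le> (\<Sum>\<^sub>\<infinity>e\<in>E. ennreal ((cmod (cinner e x))\<^sup>2))"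
  proof (rule ennreal_le_epsilon)
    fix d :: real assume d: "0 < d"
    have "x \<in> closure (cspan E)" using E by (simp add: is_onb_def)
    then obtain y where y: "y \<in> cspan E" "dist y x < sqrt d"
      using d unfolding closure_approachable by (meson real_sqrt_gt_zero)
    then obtain F r where F: "finite F" "F \<subseteq> E" and "y = (\<Sum>a\<in>F. r a *\<^sub>C a)"
      by (auto simp: cvec.span_explicit)
    then have yF: "y \<in> cspan F" by (simp only:) (intro cvec.span_sum cvec.span_scale cvec.span_base)
    have "(norm (x - y))\<^sup>2 \<le> (sqrt d)\<^sup>2"
      using y(2) by (intro power_mono) (auto simp: dist_norm norm_minus_commute)
    then have "(norm x)\<^sup>2 \<le> (\<Sum>e\<in>F. (cmod (cinner e x))\<^sup>2) + d"
      using bessel_identity[OF F(1) on[OF F(2)] yF, of x] real_sqrt_pow2[OF less_imp_le[OF d]]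
        zero_le_power2[of "norm ((\<Sum>e\<in>F. cinner e x *\<^sub>C e) - y)"] by linarith
    then have "ennreal ((norm x)\<^sup>2) \<le> ennreal ((\<Sum>e\<in>F. (cmod (cinner e x))\<^sup>2) + d)"
      by (rule ennreal_leI)
    also have "\<dots> = (\<Sum>e\<in>F. ennreal ((cmod (cinner e x))\<^sup>2)) + ennreal d"
      using d by (subst ennreal_plus) (auto intro: sum_nonneg simp: sum_ennreal)
    also have "\<dots> \<le> (\<Sum>\<^sub>\<infinity>e\<in>E. ennreal ((cmod (cinner e x))\<^sup>2)) + ennreal d"
      using F by (intro add_right_mono sum_le_infsum_ennreal)
    finally show "ennreal ((norm x)\<^sup>2) \<le> \<dots>" .
  qed
qed

text \<open>Parseval turns both sides into the double sum of the squared matrix entries, where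
  Tonelli applies. As the two bases are chosen independently, this also shows that the sum does not
  depend on the basis.\<close>

lemma infsum_norm_sq_adj:
  assumes A: "clinear_op A" and E: "is_onb E" "is_onb E'"
  shows "(\<Sum>\<^sub>\<infinity>e\<in>E. ennreal ((norm (blinfun_apply A e))\<^sup>2)) = (\<Sum>\<^sub>\<infinity>e\<in>E'. ennreal ((norm (adj A e))\<^sup>2))"
proof -
  have "(\<Sum>\<^sub>\<infinity>e\<in>E. ennreal ((norm (A e))\<^sup>2))
      = (\<Sum>\<^sub>\<infinity>e\<in>E. \<Sum>\<^sub>\<infinity>e'\<in>E'. ennreal ((cmod (cinner e' (A e)))\<^sup>2))"
    by (simp add: parseval[OF E(2)])
  also have "\<dots> = (\<Sum>\<^sub>\<infinity>e'\<in>E'. \<Sum>\<^sub>\<infinity>e\<in>E. ennreal ((cmod (cinner e' (A e)))\<^sup>2))"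
    by (rule infsum_swap_ennreal)
  also have "\<dots> = (\<Sum>\<^sub>\<infinity>e'\<in>E'. \<Sum>\<^sub>\<infinity>e\<in>E. ennreal ((cmod (cinner e (adj A e')))\<^sup>2))"
    by (subst (2) cinner_commute) (simp add: cinner_adj_left[OF A])
  also have "\<dots> = (\<Sum>\<^sub>\<infinity>e\<in>E'. ennreal ((norm (adj A e))\<^sup>2))"
    by (simp add: parseval[OF E(1)])
  finally show ?thesis .
qed

text \<open>The basis chosen inside \<open>hs_sq\<close> and the basis \<open>E\<close> are compared
  through one common sum for the adjoint.\<close>

lemma hs_sq_eq_infsum:
  assumes A: "clinear_op A" and E: "is_onb E"
  shows "hs_sq A = (\<Sum>\<^sub>\<infinity>e\<in>E. ennreal ((norm (blinfun_apply A e))\<^sup>2))"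
  using infsum_norm_sq_adj[OF A someI_ex[OF ex_onb]] infsum_norm_sq_adj[OF A E] ex_onb
  by (metis hs_sq_def)

lemma hs_sq_adj: "clinear_op A \<Longrightarrow> hs_sq (adj A) = hs_sq A"
  using ex_onb infsum_norm_sq_adj[of A] hs_sq_eq_infsum clinear_op_adj by metis

lemma infsum_orthonormal_le_hs_sq:
  assumes A: "clinear_op A" and F: "orthonormal F"
  shows "(\<Sum>\<^sub>\<infinity>e\<in>F. ennreal ((norm (blinfun_apply A e))\<^sup>2)) \<le> hs_sq A"
proof -
  obtain E where E: "F \<subseteq> E" "is_onb E" using ex_onb_extending[OF F] by blast
  then show ?thesis unfolding hs_sq_eq_infsum[OF A E(2)] by (intro infsum_mono_set_ennreal)
qed

lemma sum_orthonormal_le_hs_sq: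
  assumes "clinear_op A" "orthonormal F" "finite F"
  shows "(\<Sum>e\<in>F. ennreal ((norm (blinfun_apply A e))\<^sup>2)) \<le> hs_sq A"
  using infsum_orthonormal_le_hs_sq[OF assms(1,2)] assms(3) by simp

lemma norm_sq_le_hs_sq:
  assumes A: "clinear_op A" and c: "hs_sq A \<le> ennreal (c\<^sup>2)" "0 \<le> c"
  shows "norm A \<le> c"
proof (rule norm_blinfun_bound[OF c(2)])
  fix x
  show "norm (A x) \<le> c * norm x"
  proof (cases "x = 0")
    case False
    define y where "y = inverse (norm x) *\<^sub>R x"
    have y: "norm y = 1" using False by (simp add: y_def)
    have "ennreal ((norm (A y))\<^sup>2) \<le> hs_sq A"
      using sum_orthonormal_le_hs_sq[OF A orthonormal_singleton[OF y]] by simp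
    also note c(1)
    finally have "(norm (A y))\<^sup>2 \<le> c\<^sup>2" by (simp add: ennreal_le_iff)
    then have "norm (A y) \<le> c" using c(2) by (rule power2_le_imp_le)
    then show ?thesis using False by (simp add: y_def blinfun.scaleR_right field_simps)
  qed simp
qed

lemma eq_0_of_hs_sq: "clinear_op A \<Longrightarrow> hs_sq A = 0 \<Longrightarrow> A = 0"
  using norm_sq_le_hs_sq[of A 0] by simp

lemma norm_adj_le: "clinear_op A \<Longrightarrow> norm (adj A) \<le> norm A"
proof (rule norm_blinfun_bound[OF norm_ge_zero])
  fix x assume A: "clinear_op A"
  have "norm (adj A x) * norm (adj A x) = Re (cinner (adj A x) (adj A x))"
    by (simp add: cinner_self power2_eq_square)
  also have "\<dots> = inner x (A (adj A x))" by (simp only: cinner_adj_left[OF A] inner_eq_Re_cinner)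
  also have "\<dots> \<le> norm x * (norm A * norm (adj A x))"
    by (rule order_trans[OF norm_cauchy_schwarz]) (intro mult_left_mono norm_blinfun norm_ge_zero)
  finally have "norm (adj A x) * norm (adj A x) \<le> norm (adj A x) * (norm A * norm x)"
    by (simp only: mult_ac)
  then show "norm (adj A x) \<le> norm A * norm x"
    by (cases "norm (adj A x) = 0") (auto dest: mult_left_le_imp_le)
qed

lemma hs_sq_compose_left: "hs_sq (B o\<^sub>L A) \<le> ennreal ((norm B)\<^sup>2) * hs_sq A"
  unfolding hs_sq_def infsum_cmult_ennreal[symmetric]
proof (rule infsum_mono_ennreal)
  fix e
  have "(norm (B (A e)))\<^sup>2 \<le> (norm B * norm (A e))\<^sup>2" by (intro power_mono norm_blinfun norm_ge_zero)
  then show "ennreal ((norm ((B o\<^sub>L A) e))\<^sup>2) \<le> ennreal ((norm B)\<^sup>2) * ennreal ((norm (A e))\<^sup>2)"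
    by (simp add: ennreal_mult[symmetric] power_mult_distrib)
qed

lemma adj_compose:
  "clinear_op A \<Longrightarrow> clinear_op B \<Longrightarrow> adj (A o\<^sub>L B) = adj B o\<^sub>L adj A"
  by (rule adj_eqI) (simp add: cinner_adj_left)

text \<open>Taking adjoints moves the bounded factor to the left, where the estimate holds column by
  column.\<close>

lemma hs_sq_compose_right:
  assumes "clinear_op A" "clinear_op B"
  shows "hs_sq (A o\<^sub>L B) \<le> ennreal ((norm B)\<^sup>2) * hs_sq A"
proof -
  have "hs_sq (A o\<^sub>L B) = hs_sq (adj B o\<^sub>L adj A)"
    using hs_sq_adj[OF clinear_op_compose[OF assms]] by (simp add: adj_compose assms)
  also have "\<dots> \<le> ennreal ((norm (adj B))\<^sup>2) * hs_sq (adj A)" by (rule hs_sq_compose_left)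
  also have "\<dots> \<le> ennreal ((norm B)\<^sup>2) * hs_sq A"
    using norm_adj_le[OF assms(2)]
    by (intro mult_mono) (auto intro!: ennreal_leI power_mono simp: hs_sq_adj assms)
  finally show ?thesis .
qed

text \<open>For squared norms, Cauchy-Schwarz replaces the triangle inequality; this is the origin
  of \<open>card I\<close>.\<close>

lemma hs_sq_sum_le:
  assumes "finite I"
  shows "hs_sq (\<Sum>i\<in>I. A i) \<le> of_nat (card I) * (\<Sum>i\<in>I. hs_sq (A i))"
proof -
  have "ennreal ((norm ((\<Sum>i\<in>I. A i) e))\<^sup>2) \<le> of_nat (card I) * (\<Sum>i\<in>I. ennreal ((norm (A i e))\<^sup>2))" for e
  proof -
    have "(norm ((\<Sum>i\<in>I. A i) e))\<^sup>2 \<le> (\<Sum>i\<in>I. norm (A i e))\<^sup>2"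
      by (intro power_mono) (auto simp: blinfun.sum_left norm_sum)
    also have "\<dots> \<le> real (card I) * (\<Sum>i\<in>I. (norm (A i e))\<^sup>2)"
      using sum_squared_le_sum_of_squares[of "\<lambda>i. norm (A i e)" I] by (simp add: mult.commute)
    finally have "ennreal ((norm ((\<Sum>i\<in>I. A i) e))\<^sup>2) \<le> ennreal (real (card I) * (\<Sum>i\<in>I. (norm (A i e))\<^sup>2))"
      by (rule ennreal_leI)
    then show ?thesis by (simp add: ennreal_mult sum_nonneg sum_ennreal ennreal_of_nat_eq_real_of_nat)
  qed
  then show ?thesis
    unfolding hs_sq_def infsum_sum_ennreal[OF assms, symmetric] infsum_cmult_ennreal[symmetric]
    by (intro infsum_mono_ennreal)
qed

lemma hs_sq_add_le: "hs_sq (A + B) \<le> 2 * (hs_sq A + hs_sq B)"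
  using hs_sq_sum_le[of "{False, True}" "\<lambda>b. if b then A else B"]
  by (simp add: add.commute)

lemma hs_sq_uminus: "hs_sq (- A) = hs_sq A"
  by (simp add: hs_sq_def blinfun.minus_left)

text \<open>With \<open>R = sqrt_op Y\<close> the left side is a partial sum of the squared
  Hilbert-Schmidt norm of \<open>R S\<close>, while that of \<open>R\<close> is the trace of
  \<open>Y\<close>. A trace bound is thus carried through a bounded factor by means of
  Hilbert-Schmidt norms alone.\<close>

lemma trace_compose_le:
  assumes Y: "positive_op Y" and S: "clinear_op S"
    and F: "finite F" "orthonormal F" and E: "is_onb E"
  shows "(\<Sum>f\<in>F. ennreal (inner (S f) (Y (S f))))
    \<le> ennreal ((norm S)\<^sup>2) * (\<Sum>\<^sub>\<infinity>e\<in>E. ennreal (inner e (blinfun_apply Y e)))"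
proof -
  let ?R = "sqrt_op Y"
  note R = sqrt_op_works[OF Y]
  have cR: "clinear_op ?R" using R(1) by (simp add: positive_op_def selfadjoint_clinear)
  have R2: "inner x (Y x) = (norm (?R x))\<^sup>2" for x
  proof -
    have "Y x = ?R (?R x)" by (metis R(2) blinfun_apply_blinfun_compose)
    then have "cinner x (Y x) = cinner (?R x) (?R x)"
      using R(1) by (simp add: positive_op_def selfadjoint_def)
    then show ?thesis by (simp add: inner_eq_Re_cinner cinner_self)
  qed
  have "(\<Sum>f\<in>F. ennreal (inner (S f) (Y (S f)))) = (\<Sum>f\<in>F. ennreal ((norm ((?R o\<^sub>L S) f))\<^sup>2))"
    by (simp add: R2)
  also have "\<dots> \<le> hs_sq (?R o\<^sub>L S)"
    using F by (intro sum_orthonormal_le_hs_sq clinear_op_compose cR S)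
  also have "\<dots> \<le> ennreal ((norm S)\<^sup>2) * hs_sq ?R" by (rule hs_sq_compose_right[OF cR S])
  finally show ?thesis unfolding R2 hs_sq_eq_infsum[OF cR E] .
qed

section \<open>The product basis of the square-summable functions with values in the fiber\<close>

lemma cinner_tensor_delta: "cinner (tensor_vec (delta n) g) \<phi> = cinner g (ell2_apply \<phi> n)"
proof -
  have "cinner (tensor_vec (delta n) g) \<phi>
      = (\<Sum>\<^sub>\<infinity>m. if m = n then cinner g (ell2_apply \<phi> n) else 0)"
    unfolding cinner_ell2_def tensor_vec.rep_eq delta.rep_eq
    by (intro infsum_cong) (simp add: scaleC_one cinner.zero_left)
  also have "\<dots> = (\<Sum>\<^sub>\<infinity>m\<in>{n}. cinner g (ell2_apply \<phi> n))"
    by (rule infsum_cong_neutral) auto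
  finally show ?thesis by simp
qed

lemma ell2_apply_tensor_delta:
  "ell2_apply (tensor_vec (delta n) g) m = (if m = n then g else 0)"
  by (simp add: tensor_vec.rep_eq delta.rep_eq scaleC_one)

lemma is_onb_tensor_delta:
  assumes E: "is_onb E"
  shows "is_onb ((\<lambda>(n, e). tensor_vec (delta n) e) ` (UNIV \<times> E))"
proof (rule is_onbI)
  have on: "orthonormal E" by (rule is_onb_orthonormal[OF E])
  show "orthonormal ((\<lambda>(n, e). tensor_vec (delta n) e) ` (UNIV \<times> E))"
    unfolding orthonormal_def
  proof safe
    fix n e m e' assume e: "e \<in> E" "e' \<in> E"
    have "tensor_vec (delta n) e = tensor_vec (delta m) e' \<longleftrightarrow> n = m \<and> e = e'"
    proof
      assume "tensor_vec (delta n) e = tensor_vec (delta m) e'"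
      then have "ell2_apply (tensor_vec (delta n) e) n = ell2_apply (tensor_vec (delta m) e') n" by simp
      moreover have "e \<noteq> 0" using orthonormal_norm[OF on e(1)] by auto
      ultimately show "n = m \<and> e = e'" by (simp add: ell2_apply_tensor_delta split: if_splits)
    qed simp
    then show "cinner (tensor_vec (delta n) e) (tensor_vec (delta m) e')
        = (if tensor_vec (delta n) e = tensor_vec (delta m) e' then 1 else 0)"
      using on e by (auto simp: cinner_tensor_delta ell2_apply_tensor_delta orthonormal_def cinner.zero_right)
  qed
  fix \<phi> :: "'a ell2"
  assume *: "\<And>e. e \<in> (\<lambda>(n, e). tensor_vec (delta n) e) ` (UNIV \<times> E) \<Longrightarrow> cinner e \<phi> = 0"
  show "\<phi> = 0"
  proof (rule ell2_eqI)
    fix n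
    have "cinner e (ell2_apply \<phi> n) = 0" if "e \<in> E" for e
      using *[of "tensor_vec (delta n) e"] that by (force simp: cinner_tensor_delta)
    then have "(\<Sum>\<^sub>\<infinity>e\<in>E. ennreal ((cmod (cinner e (ell2_apply \<phi> n)))\<^sup>2)) = (\<Sum>\<^sub>\<infinity>e\<in>E. 0)"
      by (intro infsum_cong) simp
    then show "ell2_apply \<phi> n = ell2_apply 0 n" by (simp add: parseval[OF E] zero_ell2.rep_eq)
  qed
qed

text \<open>A finite part of the image is the injective image of finitely many pairs, so no term is
  counted more often on the left than on the right.\<close>

lemma infsum_tensor_delta_le:
  fixes f :: "'g::complex_hilbert ell2 \<Rightarrow> ennreal"
  shows "infsum f ((\<lambda>(n, e). tensor_vec (delta n) e) ` (UNIV \<times> E))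
    \<le> (\<Sum>\<^sub>\<infinity>n. \<Sum>\<^sub>\<infinity>e\<in>E. f (tensor_vec (delta n) e))"
proof (rule order_trans)
  let ?t = "\<lambda>(n, e). tensor_vec (delta n) e"
  show "infsum f (?t ` (UNIV \<times> E)) \<le> infsum (f \<circ> ?t) (UNIV \<times> E)"
  proof (rule infsum_leI_ennreal)
    fix F assume "finite F" "F \<subseteq> ?t ` (UNIV \<times> E)"
    then obtain C where C: "C \<subseteq> UNIV \<times> E" "finite C" "F = ?t ` C" "inj_on ?t C"
      by (metis finite_imageD subset_image_inj)
    have "sum f F = sum (f \<circ> ?t) C" unfolding C(3) by (rule sum.reindex[OF C(4)])
    also have "\<dots> \<le> infsum (f \<circ> ?t) (UNIV \<times> E)" by (rule sum_le_infsum_ennreal[OF C(2,1)])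
    finally show "sum f F \<le> infsum (f \<circ> ?t) (UNIV \<times> E)" .
  qed
  show "infsum (f \<circ> ?t) (UNIV \<times> E) \<le> (\<Sum>\<^sub>\<infinity>n. \<Sum>\<^sub>\<infinity>e\<in>E. f (tensor_vec (delta n) e))"
    by (rule order_trans[OF infsum_Times_le_ennreal]) simp
qed

lemma hs_sq_ell2_le:
  assumes "clinear_op A" "is_onb E"
  shows "hs_sq A \<le> (\<Sum>\<^sub>\<infinity>n. \<Sum>\<^sub>\<infinity>e\<in>E. ennreal ((norm (blinfun_apply A (tensor_vec (delta n) e)))\<^sup>2))"
  unfolding hs_sq_eq_infsum[OF assms(1) is_onb_tensor_delta[OF assms(2)]]
  by (rule infsum_tensor_delta_le)

section \<open>Counting eigenvalues\<close>

text \<open>The projection onto the span of \<open>W\<close> cannot be injective on the span of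
  \<open>E\<close>, because \<open>card W < card E\<close>; a nonzero vector of its kernel is
  normalised.\<close>

lemma ex_unit_orthogonal_in_cspan:
  assumes E: "finite E" "orthonormal E" and W: "finite W" "orthonormal W" and less: "card W < card E"
  shows "\<exists>x. x \<in> cspan E \<and> norm x = 1 \<and> (\<forall>w\<in>W. cinner w x = 0)"
proof -
  define p where "p x = (\<Sum>w\<in>W. cinner w x *\<^sub>C w)" for x
  have p_span: "p x \<in> cspan W" for x
    unfolding p_def by (intro cvec.span_sum cvec.span_scale cvec.span_base)
  have p_sum: "p (\<Sum>e\<in>E. c e *\<^sub>C e) = (\<Sum>e\<in>E. c e *\<^sub>C p e)" for c
    unfolding p_def cinner.sum_right cinner_scaleC_right scaleC.sum_left scaleC.sum_right scaleC_scaleC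
    by (rule sum.swap)
  have ker: "cinner w x = 0" if "p x = 0" "w \<in> W" for w x
  proof -
    have "(\<Sum>w\<in>W. (cmod (cinner w x))\<^sup>2) = 0"
      using norm_sq_orthonormal_sum[OF W, of "\<lambda>w. cinner w x"] that(1) by (simp add: p_def)
    then show ?thesis using W(1) that(2) by (simp add: sum_nonneg_eq_0_iff)
  qed
  have "\<exists>x. x \<in> cspan E \<and> x \<noteq> 0 \<and> p x = 0"
  proof (cases "inj_on p E")
    case False
    \<comment> \<open>Equal images collapse to one element of the image set, where the linear
      dependence would go unnoticed, so their difference is taken as the kernel vector
      directly.\<close>
    then obtain e e' where e: "e \<in> E" "e' \<in> E" "e \<noteq> e'" "p e = p e'" by (auto simp: inj_on_def)
    have "p (e - e') = p e - p e'"
      by (simp add: p_def cinner.diff_right scaleC.diff_left sum_subtractf)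
    then show ?thesis
      using e by (intro exI[of _ "e - e'"]) (simp add: cvec.span_diff cvec.span_base)
  next
    case True
    have "cdependent (p ` E)"
    proof (rule ccontr)
      assume "\<not> cdependent (p ` E)"
      moreover have "p ` E \<subseteq> cspan W" using p_span by blast
      ultimately have "card (p ` E) \<le> card W" using cvec.independent_span_bound[OF W(1)] by blast
      then show False using less True by (simp add: card_image)
    qed
    then obtain u v where u: "(\<Sum>v\<in>p ` E. u v *\<^sub>C v) = 0" "v \<in> p ` E" "u v \<noteq> 0"
      using cvec.dependent_finite[of "p ` E"] E(1) by blast
    define x where "x = (\<Sum>e\<in>E. u (p e) *\<^sub>C e)"
    have "p x = 0" using u(1) True unfolding x_def p_sum by (simp add: sum.reindex)
    moreover have "x \<noteq> 0"
    proof
      assume "x = 0"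
      then have "(\<Sum>e\<in>E. (cmod (u (p e)))\<^sup>2) = 0"
        using norm_sq_orthonormal_sum[OF E, of "\<lambda>e. u (p e)"] by (simp add: x_def)
      then show False using u(2,3) E(1) by (auto simp: sum_nonneg_eq_0_iff)
    qed
    moreover have "x \<in> cspan E"
      unfolding x_def by (intro cvec.span_sum cvec.span_scale cvec.span_base)
    ultimately show ?thesis by blast
  qed
  then obtain x where x: "x \<in> cspan E" "x \<noteq> 0" "p x = 0" by blast
  define y where "y = inverse (norm x) *\<^sub>R x"
  have "y \<in> cspan E" using x(1) by (simp add: y_def scaleR_scaleC cvec.span_scale)
  moreover have "norm y = 1" using x(2) by (simp add: y_def)
  moreover have "cinner w y = 0" if "w \<in> W" for w
    using ker[OF x(3) that] by (simp add: y_def cinner.scaleR_right)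
  ultimately show ?thesis by blast
qed

text \<open>Repeated use of \<open>ex_unit_orthogonal_in_cspan\<close>, with the vectors already
  found joined to \<open>W\<close>.\<close>

lemma ex_orthonormal_in_complement:
  assumes E: "finite E" "orthonormal E" and W: "finite W" "orthonormal W"
  shows "k + card W \<le> card E \<Longrightarrow>
    \<exists>D. finite D \<and> card D = k \<and> orthonormal (D \<union> W) \<and> D \<inter> W = {} \<and> D \<subseteq> cspan E"
proof (induction k)
  case 0
  then show ?case using W by (intro exI[of _ "{}"]) auto
next
  case (Suc k)
  then obtain D where D: "finite D" "card D = k" "orthonormal (D \<union> W)" "D \<inter> W = {}" "D \<subseteq> cspan E"
    by auto
  have "card (D \<union> W) < card E" using D W Suc.prems by (simp add: card_Un_disjoint)
  then obtain x where x: "x \<in> cspan E" "norm x = 1" "\<forall>w\<in>D \<union> W. cinner w x = 0"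
    using ex_unit_orthogonal_in_cspan[OF E _ D(3)] D(1) W(1) by blast
  have "orthonormal (insert x (D \<union> W))" "x \<notin> D \<union> W"
    using orthonormal_insert[OF D(3) x(2)] x(3) by blast+
  then show ?case
    using D x(1) by (intro exI[of _ "insert x D"]) auto
qed

lemma eigenspace_csubspace: "clinear_op S \<Longrightarrow> csubspace (eigenspace S \<mu>)"
  unfolding cvec.subspace_def eigenspace_def clinear_op_def
  by (auto simp: blinfun.add_right scaleC_add_right scaleR_scaleC scaleC_scaleC mult.commute)

lemma eigenspace_orthogonal:
  assumes S: "selfadjoint S" and x: "x \<in> eigenspace S \<mu>" "y \<in> eigenspace S \<mu>'" "\<mu> \<noteq> \<mu>'"
  shows "cinner x y = 0"
proof -
  have "cinner (S x) y = cinner x (S y)" using S by (simp add: selfadjoint_def)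
  then have "\<mu> * cinner x y = \<mu>' * cinner x y"
    using x(1,2) by (simp add: eigenspace_def cinner.scaleR_left cinner.scaleR_right scaleR_conv_of_real)
  then show ?thesis using x(3) by simp
qed

text \<open>Distinct eigenspaces are orthogonal, so on a finite sum of eigenvectors the form of
  \<open>S\<close> is diagonal with weights above \<open>r\<close>.\<close>

lemma cspan_eigenspaces_form_ge:
  assumes S: "selfadjoint S" and x: "x \<in> cspan (\<Union>\<mu>\<in>{r<..}. eigenspace S \<mu>)"
  shows "r * inner x x \<le> inner x (blinfun_apply S x)"
proof -
  note sub = eigenspace_csubspace[OF selfadjoint_clinear[OF S]]
  \<comment> \<open>Terms with the same eigenvalue are collected, so that \<open>x\<close> has one
    component per eigenvalue and all cross terms vanish.\<close>
  have "\<exists>T y. finite T \<and> T \<subseteq> {r<..} \<and> (\<forall>\<mu>. y \<mu> \<in> eigenspace S \<mu>) \<and> (\<forall>\<mu>. \<mu> \<notin> T \<longrightarrow> y \<mu> = 0)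
      \<and> x = (\<Sum>\<mu>\<in>T. y \<mu>)"
    using x
  proof (induction rule: cvec.span_induct_alt)
    case base
    show ?case
      by (rule exI[of _ "{}"], rule exI[of _ "\<lambda>_. 0"]) (use cvec.subspace_0[OF sub] in auto)
  next
    case (step c a z)
    then obtain \<nu> T y where \<nu>: "r < \<nu>" "a \<in> eigenspace S \<nu>"
      and T: "finite T" "T \<subseteq> {r<..}" "\<And>\<mu>. y \<mu> \<in> eigenspace S \<mu>" "\<And>\<mu>. \<mu> \<notin> T \<Longrightarrow> y \<mu> = 0"
        "z = (\<Sum>\<mu>\<in>T. y \<mu>)" by blast
    let ?y = "\<lambda>\<mu>. y \<mu> + (if \<mu> = \<nu> then c *\<^sub>C a else 0)"
    have "(\<Sum>\<mu>\<in>insert \<nu> T. ?y \<mu>) = (\<Sum>\<mu>\<in>insert \<nu> T. y \<mu>) + c *\<^sub>C a"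
      unfolding sum.distrib using T(1) by simp
    also have "(\<Sum>\<mu>\<in>insert \<nu> T. y \<mu>) = z"
      unfolding T(5) using T(1,4) by (intro sum.mono_neutral_right) auto
    finally have "c *\<^sub>C a + z = (\<Sum>\<mu>\<in>insert \<nu> T. ?y \<mu>)" by simp
    moreover have "?y \<mu> \<in> eigenspace S \<mu>" for \<mu>
      using T(3) \<nu>(2) sub cvec.subspace_add cvec.subspace_scale by (cases "\<mu> = \<nu>") (auto, blast)
    ultimately show ?case
      using T \<nu>(1) by (intro exI[of _ "insert \<nu> T"] exI[of _ ?y]) auto
  qed
  then obtain T y where T: "finite T" "T \<subseteq> {r<..}" and y: "\<And>\<mu>. y \<mu> \<in> eigenspace S \<mu>"
    and x: "x = (\<Sum>\<mu>\<in>T. y \<mu>)" by blast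
  have orth: "inner (y \<mu>) (y \<mu>') = 0" if "\<mu> \<noteq> \<mu>'" for \<mu> \<mu>'
    using eigenspace_orthogonal[OF S y y that] by (simp add: inner_eq_Re_cinner)
  have Sy: "S (y \<mu>) = \<mu> *\<^sub>R y \<mu>" for \<mu> using y[of \<mu>] by (simp add: eigenspace_def)
  have diag: "inner x (\<Sum>\<mu>\<in>T. c \<mu> *\<^sub>R y \<mu>) = (\<Sum>\<mu>\<in>T. c \<mu> * inner (y \<mu>) (y \<mu>))" for c
  proof -
    have "inner (y \<nu>) (\<Sum>\<mu>\<in>T. c \<mu> *\<^sub>R y \<mu>) = (\<Sum>\<mu>\<in>T. if \<nu> = \<mu> then c \<mu> * inner (y \<mu>) (y \<mu>) else 0)" for \<nu>
      unfolding inner_sum_right using orth[of \<nu>] by (intro sum.cong) auto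
    then show ?thesis unfolding x inner_sum_left using T(1) by (intro sum.cong) auto
  qed
  have "r * inner x x = r * inner x (\<Sum>\<mu>\<in>T. 1 *\<^sub>R y \<mu>)" using x by simp
  also have "\<dots> = (\<Sum>\<mu>\<in>T. r * inner (y \<mu>) (y \<mu>))" unfolding diag by (simp add: sum_distrib_left)
  also have "\<dots> \<le> (\<Sum>\<mu>\<in>T. \<mu> * inner (y \<mu>) (y \<mu>))"
    using T(2) by (intro sum_mono mult_right_mono) auto
  also have "\<dots> = inner x (\<Sum>\<mu>\<in>T. \<mu> *\<^sub>R y \<mu>)" by (rule diag[symmetric])
  also have "(\<Sum>\<mu>\<in>T. \<mu> *\<^sub>R y \<mu>) = S x" unfolding x blinfun.sum_right by (simp add: Sy)
  finally show ?thesis .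
qed

text \<open>The form inequality extends by continuity to the closed spectral subspace
  \<open>G\<close>, so orthonormal subsets of \<open>G\<close> have at most \<open>m\<close>
  elements, and one of maximal size spans \<open>G\<close>. Counting is thereby reduced to quadratic
  forms on finite-dimensional spaces.\<close>

lemma count_plus_le:
  assumes S: "selfadjoint S"
    and le: "\<And>E. finite E \<Longrightarrow> orthonormal E \<Longrightarrow>
      (\<And>x. x \<in> cspan E \<Longrightarrow> r * inner x x \<le> inner x (blinfun_apply S x)) \<Longrightarrow> card E \<le> m"
  shows "count_plus r S \<le> enat m"
proof -
  define G where "G = closure (cspan (\<Union>\<mu>\<in>{r<..}. eigenspace S \<mu>))"
  have subG: "csubspace G" unfolding G_def by (rule csubspace_closure_cspan)
  have form: "r * inner x x \<le> inner x (S x)" if "x \<in> G" for x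
  proof -
    have "closed {x. r * inner x x \<le> inner x (S x)}"
      by (intro closed_Collect_le continuous_intros)
    then have "G \<subseteq> {x. r * inner x x \<le> inner x (S x)}"
      unfolding G_def by (rule closure_minimal[rotated]) (use cspan_eigenspaces_form_ge[OF S] in blast)
    then show ?thesis using that by blast
  qed
  define N where "N = card ` {E. finite E \<and> orthonormal E \<and> E \<subseteq> G}"
  have card_le: "card E \<le> m" if "finite E" "orthonormal E" "E \<subseteq> G" for E
    by (rule le[OF that(1,2)]) (use form cvec.span_minimal[OF that(3) subG] in blast)
  then have "N \<subseteq> {..m}" by (auto simp: N_def)
  then have N: "finite N" by (rule finite_subset) simp
  have "0 \<in> N" unfolding N_def by (rule image_eqI[of _ _ "{}"]) (auto simp: orthonormal_def)
  then have "Max N \<in> N" using N by (intro Max_in) auto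
  then obtain F where F: "finite F" "orthonormal F" "F \<subseteq> G" "card F = Max N" by (auto simp: N_def)
  have span: "G \<subseteq> cspan F"
  proof
    fix x assume x: "x \<in> G"
    define p where "p = (\<Sum>e\<in>F. cinner e x *\<^sub>C e)"
    have p: "p \<in> cspan F"
      unfolding p_def by (intro cvec.span_sum cvec.span_scale cvec.span_base)
    have orth: "cinner e (x - p) = 0" if "e \<in> F" for e
    proof -
      have "cinner e p = (\<Sum>e'\<in>F. if e = e' then cinner e' x else 0)"
        unfolding p_def cinner.sum_right using F that
        by (intro sum.cong) (auto simp: cinner_scaleC_right orthonormal_def)
      then show ?thesis using F(1) that by (simp add: cinner.diff_right)
    qed
    have "x = p"
    proof (rule ccontr)
      assume "x \<noteq> p"
      define y where "y = inverse (norm (x - p)) *\<^sub>R (x - p)"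
      have "norm y = 1" using \<open>x \<noteq> p\<close> by (simp add: y_def)
      moreover have "cinner e y = 0" if "e \<in> F" for e
        using orth[OF that] by (simp add: y_def cinner.scaleR_right)
      ultimately have i: "orthonormal (insert y F)" "y \<notin> F" using orthonormal_insert[OF F(2)] by blast+
      have "p \<in> G" using p cvec.span_minimal[OF F(3) subG] by blast
      then have "y \<in> G"
        using x subG by (simp add: y_def scaleR_scaleC cvec.subspace_scale cvec.subspace_diff)
      then have "card (insert y F) \<in> N" using i F unfolding N_def by blast
      then have "card (insert y F) \<le> Max N" using N by (intro Max_ge)
      then show False using i F by simp
    qed
    then show "x \<in> cspan F" using p by simp
  qed
  let ?P = "spectral_proj {r<..} S"
  have "range ?P \<subseteq> G"
    unfolding spectral_proj_def G_def[symmetric] using orth_proj_works(1)[of G] subG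
    by (auto simp: G_def)
  then have P: "range ?P \<subseteq> cspan F" using span by blast
  then have "rank_op ?P = enat (cdim (range ?P))" using F(1) by (auto simp: rank_op_def)
  moreover have "cdim (range ?P) \<le> card F" by (rule cvec.dim_le_card[OF P F(1)])
  moreover have "card F \<le> m" using F by (intro card_le)
  ultimately show ?thesis by (simp add: count_plus_def)
qed

text \<open>The supremum of the form over the unit vectors orthogonal to \<open>W\<close> may fail
  to be attained; a vector reaching half of it is taken instead, hence the factor
  \<open>2\<close>.\<close>

lemma ex_almost_maximizer:
  fixes B :: "'a::complex_hilbert \<Rightarrow>\<^sub>L 'a"
  assumes B: "positive_op B"
  shows "\<exists>e. (\<forall>w\<in>W. cinner w e = 0) \<and> (e = 0 \<or> norm e = 1) \<and>
    (\<forall>x. (\<forall>w\<in>W. cinner w x = 0) \<longrightarrow> inner x (B x) \<le> 2 * inner e (B e) * (norm x)\<^sup>2)"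
proof -
  define f where "f x = inner x (B x)" for x
  have f_scale: "f (r *\<^sub>R x) = r\<^sup>2 * f x" for r x
    by (simp add: f_def blinfun.scaleR_right power2_eq_square)
  define A where "A = {x. (\<forall>w\<in>W. cinner w x = 0) \<and> norm x = 1}"
  have normed: "inverse (norm x) *\<^sub>R x \<in> A" if "\<forall>w\<in>W. cinner w x = 0" "x \<noteq> 0" for x
    using that by (simp add: A_def cinner.scaleR_right)
  have f_normed: "f x = (norm x)\<^sup>2 * f (inverse (norm x) *\<^sub>R x)" if "x \<noteq> 0" for x
    using that unfolding f_scale by (simp add: power_inverse)
  show ?thesis
  proof (cases "\<exists>x\<in>A. 0 < f x")
    case False
    \<comment> \<open>If the form is nowhere positive on these unit vectors, \<open>e = 0\<close>
      serves as the default: no direction is left that could contribute.\<close>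
    have "f x \<le> 0" if "\<forall>w\<in>W. cinner w x = 0" for x
    proof (cases "x = 0")
      case False
      then have "f (inverse (norm x) *\<^sub>R x) \<le> 0"
        using normed[OF that False] \<open>\<not> (\<exists>x\<in>A. 0 < f x)\<close> by force
      then show ?thesis unfolding f_normed[OF False] by (simp add: mult_nonneg_nonpos)
    qed (simp add: f_def)
    then show ?thesis by (intro exI[of _ 0]) (simp add: f_def cinner.zero_right)
  next
    case True
    then obtain x0 where x0: "x0 \<in> A" "0 < f x0" by blast
    have bdd: "bdd_above (f ` A)"
    proof (rule bdd_aboveI2)
      fix x assume "x \<in> A"
      then have "norm x = 1" by (simp add: A_def)
      then show "f x \<le> norm B"
        unfolding f_def using norm_cauchy_schwarz[of x "B x"] norm_blinfun[of B x] by simp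
    qed
    define s where "s = Sup (f ` A)"
    have s: "f x \<le> s" if "x \<in> A" for x unfolding s_def using that bdd by (intro cSup_upper) auto
    have "0 < s" using s[OF x0(1)] x0(2) by simp
    then have "s / 2 < Sup (f ` A)" by (simp add: s_def[symmetric])
    then obtain e where e: "e \<in> A" "s / 2 < f e"
      using less_cSupD[of "f ` A" "s / 2"] x0(1) by blast
    have "f x \<le> 2 * f e * (norm x)\<^sup>2" if "\<forall>w\<in>W. cinner w x = 0" for x
    proof (cases "x = 0")
      case False
      have "f (inverse (norm x) *\<^sub>R x) \<le> 2 * f e" using s[OF normed[OF that False]] e(2) by simp
      then have "(norm x)\<^sup>2 * f (inverse (norm x) *\<^sub>R x) \<le> (norm x)\<^sup>2 * (2 * f e)"
        by (intro mult_left_mono) auto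
      then show ?thesis by (simp only: f_normed[OF False, symmetric] mult.commute)
    qed (simp add: f_def)
    then show ?thesis using e(1) by (intro exI[of _ e]) (auto simp: A_def f_def)
  qed
qed

text \<open>A greedy choice of almost maximizing vectors replaces the eigenvectors of \<open>B\<close>, so that the
  spectral theorem is not needed.\<close>

lemma ex_greedy_sequence:
  fixes B :: "'a::complex_hilbert \<Rightarrow>\<^sub>L 'a"
  assumes B: "positive_op B"
  shows "\<exists>e :: nat \<Rightarrow> 'a. \<forall>n. (\<forall>i<n. cinner (e i) (e n) = 0) \<and> (e n = 0 \<or> norm (e n) = 1) \<and>
    (\<forall>x. (\<forall>i<n. cinner (e i) x = 0) \<longrightarrow> inner x (B x) \<le> 2 * inner (e n) (B (e n)) * (norm x)\<^sup>2)"
proof -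
  have "\<exists>e :: nat \<Rightarrow> 'a. \<forall>n. (\<forall>w\<in>e ` {..<n}. cinner w (e n) = 0) \<and> (e n = 0 \<or> norm (e n) = 1) \<and>
    (\<forall>x. (\<forall>w\<in>e ` {..<n}. cinner w x = 0) \<longrightarrow> inner x (B x) \<le> 2 * inner (e n) (B (e n)) * (norm x)\<^sup>2)"
  \<comment> \<open>The condition on the \<open>n\<close>-th vector sees the earlier ones only
    through the set of their values.\<close>
  proof (rule dependent_wellorder_choice)
    fix r and f g :: "nat \<Rightarrow> 'a" and n :: nat
    assume "\<And>y. y < n \<Longrightarrow> f y = g y"
    then have "f ` {..<n} = g ` {..<n}" by (intro image_cong) auto
    then show "((\<forall>w\<in>f ` {..<n}. cinner w r = 0) \<and> (r = 0 \<or> norm r = 1) \<and>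
        (\<forall>x. (\<forall>w\<in>f ` {..<n}. cinner w x = 0) \<longrightarrow> inner x (B x) \<le> 2 * inner r (B r) * (norm x)\<^sup>2)) =
      ((\<forall>w\<in>g ` {..<n}. cinner w r = 0) \<and> (r = 0 \<or> norm r = 1) \<and>
        (\<forall>x. (\<forall>w\<in>g ` {..<n}. cinner w x = 0) \<longrightarrow> inner x (B x) \<le> 2 * inner r (B r) * (norm x)\<^sup>2))"
      by (simp only:)
  qed (rule ex_almost_maximizer[OF B])
  then show ?thesis by (simp add: lessThan_def)
qed

text \<open>The default \<open>0\<close> may be repeated, whereas the unit vectors are pairwise
  orthogonal and hence distinct.\<close>

lemma orthonormal_greedy:
  fixes e :: "nat \<Rightarrow> 'a::complex_hilbert"
  assumes "\<And>n. (\<forall>i<n. cinner (e i) (e n) = 0) \<and> (e n = 0 \<or> norm (e n) = 1)"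
  shows "orthonormal (e ` I - {0})" and "inj_on e {i\<in>I. e i \<noteq> 0}"
proof -
  have orth: "cinner (e i) (e j) = 0" if "i \<noteq> j" for i j :: nat
    using assms[of i] assms[of j] that cinner_eq_0_commute by (metis linorder_neqE_nat)
  have one: "cinner (e i) (e i) = 1" if "e i \<noteq> 0" for i
    using assms[of i] that norm_eq_1_cinner by blast
  show "inj_on e {i\<in>I. e i \<noteq> 0}"
    by (rule inj_onI) (metis (mono_tags, lifting) mem_Collect_eq one orth zero_neq_one)
  show "orthonormal (e ` I - {0})"
    unfolding orthonormal_def using one orth by (auto split: if_splits) metis+
qed

text \<open>On the span of \<open>E\<close> the form of \<open>A + t B\<close> is at least that of
  the identity. Discarding the first \<open>j\<close> greedy directions leaves at least
  \<open>card E - j\<close> orthonormal vectors \<open>f\<close> at which \<open>t B\<close>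
  contributes at most \<open>1/2\<close>, so \<open>A f\<close> has norm at least
  \<open>1/2\<close>; the Hilbert-Schmidt bound permits at most \<open>4 a\<close> such
  vectors.\<close>

lemma count_plus_add_scaled_le:
  fixes A B :: "'a::complex_hilbert \<Rightarrow>\<^sub>L 'a"
  assumes A: "selfadjoint A"
      "\<And>F. finite F \<Longrightarrow> orthonormal F \<Longrightarrow> (\<Sum>f\<in>F. (norm (A f))\<^sup>2) \<le> a"
    and B: "positive_op B"
    and e: "\<And>n. (\<forall>i<n. cinner (e i) (e n) = 0) \<and> (e n = 0 \<or> norm (e n) = 1)"
    and j: "\<And>x. (\<forall>i<j. cinner (e i) x = 0) \<Longrightarrow> 2 * \<bar>t\<bar> * inner x (B x) \<le> (norm x)\<^sup>2"
  shows "count_plus 1 (A + t *\<^sub>R B) \<le> enat (nat \<lfloor>4 * a\<rfloor> + j)"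
proof (rule count_plus_le)
  have a: "0 \<le> a" using A(2)[of "{}"] by (simp add: orthonormal_def)
  have "selfadjoint B" using B by (simp add: positive_op_def)
  then show "selfadjoint (A + t *\<^sub>R B)"
    using A(1) by (simp add: selfadjoint_def blinfun.add_left blinfun.scaleR_left cinner_add_left
        cinner_add_right cinner.scaleR_left cinner.scaleR_right)
  fix E :: "'a set"
  assume E: "finite E" "orthonormal E"
    and form: "\<And>x. x \<in> cspan E \<Longrightarrow> 1 * inner x x \<le> inner x ((A + t *\<^sub>R B) x)"
  define W where "W = e ` {..<j} - {0}"
  have W: "finite W" "orthonormal W" unfolding W_def by (auto intro: orthonormal_greedy[OF e])
  have cW: "card W \<le> j"
    using card_mono[of "e ` {..<j}" W] card_image_le[of "{..<j}" e] by (auto simp: W_def)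
  show "card E \<le> nat \<lfloor>4 * a\<rfloor> + j"
  proof (cases "card W \<le> card E")
    case True
    define k where "k = card E - card W"
    obtain D where D: "finite D" "card D = k" "orthonormal (D \<union> W)" "D \<inter> W = {}" "D \<subseteq> cspan E"
      using ex_orthonormal_in_complement[OF E W, of k] True by (auto simp: k_def)
    have oD: "orthonormal D" using D(3) by (rule orthonormal_subset) simp
    have "1 / 4 \<le> (norm (A f))\<^sup>2" if f: "f \<in> D" for f
    proof -
      have nf: "norm f = 1" using orthonormal_norm[OF oD f] .
      have "cinner (e i) f = 0" if "i < j" for i
      proof (cases "e i = 0")
        case False
        then have "e i \<in> W" using that by (simp add: W_def)
        then have "e i \<noteq> f" using D(4) f by blast
        then show ?thesis using D(3) f \<open>e i \<in> W\<close> by (simp add: orthonormal_def)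
      qed (simp add: cinner.zero_left)
      then have "2 * \<bar>t\<bar> * inner f (B f) \<le> 1" using j[of f] nf by simp
      moreover have "0 \<le> inner f (B f)" using B by (simp add: positive_op_def inner_eq_Re_cinner)
      then have "t * inner f (B f) \<le> \<bar>t\<bar> * inner f (B f)" by (intro mult_right_mono) auto
      moreover have "1 \<le> inner f (A f) + t * inner f (B f)"
        using form[of f] D(5) f nf
        by (auto simp: blinfun.add_left blinfun.scaleR_left inner_add_right power2_norm_eq_inner[symmetric])
      moreover have "inner f (A f) \<le> norm (A f)" using norm_cauchy_schwarz[of f "A f"] nf by simp
      ultimately have "1 / 2 \<le> norm (A f)" by linarith
      then have "(1 / 2)\<^sup>2 \<le> (norm (A f))\<^sup>2" by (intro power_mono) auto
      then show ?thesis by (simp add: power2_eq_square)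
    qed
    then have "(\<Sum>f\<in>D. 1 / 4) \<le> (\<Sum>f\<in>D. (norm (A f))\<^sup>2)" by (intro sum_mono)
    also have "\<dots> \<le> a" by (rule A(2)[OF D(1) oD])
    finally have "real k \<le> 4 * a" using D(2) by simp
    then have "k \<le> nat \<lfloor>4 * a\<rfloor>" by (simp add: le_nat_floor)
    then show ?thesis using cW True by (simp add: k_def)
  qed (use cW in simp)
qed

section \<open>Tails of the Cauchy density and the integrated counting function\<close>

lemma nn_integral_arctan_tail:
  fixes c :: real
  assumes "0 \<le> c"
  shows "(\<integral>\<^sup>+t. ennreal (1 / (1 + t\<^sup>2)) * indicator {c..} t \<partial>lborel) = ennreal (pi / 2 - arctan c)"
proof (rule nn_integral_FTC_atLeast)
  show "(arctan \<longlongrightarrow> pi / 2) at_top" by (rule tendsto_arctan_at_top)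
  show "(arctan has_real_derivative 1 / (1 + x\<^sup>2)) (at x)" for x
    using DERIV_arctan[of x] by (simp add: divide_inverse)
qed (auto simp: add_nonneg_nonneg)

lemma nn_integral_arctan_symmetric_tail:
  fixes c :: real
  assumes "0 \<le> c"
  shows "(\<integral>\<^sup>+t. ennreal (1 / (1 + t\<^sup>2)) * indicator {t. c \<le> \<bar>t\<bar>} t \<partial>lborel) \<le> ennreal (pi - 2 * arctan c)"
proof -
  let ?f = "\<lambda>t :: real. ennreal (1 / (1 + t\<^sup>2)) * indicator {c..} t"
  have "(\<integral>\<^sup>+t. ennreal (1 / (1 + t\<^sup>2)) * indicator {t. c \<le> \<bar>t\<bar>} t \<partial>lborel)
      \<le> (\<integral>\<^sup>+t. ?f t + ?f (- t) \<partial>lborel)"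
    by (intro nn_integral_mono) (auto simp: indicator_def split: if_splits)
  also have "\<dots> = (\<integral>\<^sup>+t. ?f t \<partial>lborel) + (\<integral>\<^sup>+t. ?f (- t) \<partial>lborel)"
    by (rule nn_integral_add) measurable
  also have "(\<integral>\<^sup>+t. ?f (- t) \<partial>lborel) = (\<integral>\<^sup>+t. ?f t \<partial>lborel)"
    using nn_integral_real_affine[of ?f "-1" 0] by simp
  also have "(\<integral>\<^sup>+t. ?f t \<partial>lborel) = ennreal (pi / 2 - arctan c)" by (rule nn_integral_arctan_tail[OF assms])
  also have "ennreal (pi / 2 - arctan c) + ennreal (pi / 2 - arctan c) = ennreal (pi - 2 * arctan c)"
    using arctan_ubound[of c] by (subst ennreal_plus[symmetric]) auto
  finally show ?thesis .
qed

text \<open>The complement \<open>pi / 2 - arctan c\<close> equals \<open>arctan (1 / c)\<close>,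
  which is at most \<open>1 / c\<close>.\<close>

lemma pi_minus_arctan_le:
  assumes "0 < c"
  shows "pi - 2 * arctan c \<le> 2 / c"
  using arctan_inverse[of c] arctan_le_self[of "1 / c"] assms
  by (simp add: sgn_if inverse_eq_divide)

text \<open>Bounding \<open>\<N>(1, A + tB)\<close> by \<open>\<N>(1/2, A) + \<N>(1/2, tB)\<close> and integrating the second term one
  eigenvalue at a time gives the trace norm of \<open>B\<close>; the pointwise Markov bound \<open>O(t)\<close> would not be
  integrable.\<close>

lemma nn_integral_count_le:
  fixes A B :: "'a::complex_hilbert \<Rightarrow>\<^sub>L 'a"
  assumes A: "selfadjoint A"
      "\<And>F. finite F \<Longrightarrow> orthonormal F \<Longrightarrow> (\<Sum>f\<in>F. (norm (A f))\<^sup>2) \<le> a"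
    and B: "positive_op B"
      "\<And>F. finite F \<Longrightarrow> orthonormal F \<Longrightarrow> (\<Sum>f\<in>F. inner f (B f)) \<le> b"
  shows "(\<integral>\<^sup>+t. ennreal_of_enat (count_plus 1 (A + t *\<^sub>R B)) * ennreal (1 / (1 + t\<^sup>2)) \<partial>lborel)
      \<le> ennreal (4 * a * pi + 8 * b)"
    and "(\<integral>\<^sup>+t. ennreal_of_enat (count_minus 1 (A + t *\<^sub>R B)) * ennreal (1 / (1 + t\<^sup>2)) \<partial>lborel)
      \<le> ennreal (4 * a * pi + 8 * b)"
proof -
  have a: "0 \<le> a" using A(2)[of "{}"] by (simp add: orthonormal_def)
  obtain e :: "nat \<Rightarrow> 'a" where
      e: "\<And>n. (\<forall>i<n. cinner (e i) (e n) = 0) \<and> (e n = 0 \<or> norm (e n) = 1)"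
    and greedy: "\<And>n x. (\<forall>i<n. cinner (e i) x = 0) \<Longrightarrow>
      inner x (B x) \<le> 2 * inner (e n) (B (e n)) * (norm x)\<^sup>2"
    using ex_greedy_sequence[OF B(1)] by blast
  \<comment> \<open>\<open>s n\<close> bounds the form of \<open>B\<close> on the complement of the
    first \<open>n\<close> greedy vectors and plays the role of an eigenvalue.\<close>
  define s where "s n = 2 * inner (e n) (B (e n))" for n
  have s0: "0 \<le> s n" for n using B(1) by (simp add: s_def positive_op_def inner_eq_Re_cinner)
  \<comment> \<open>The nonzero greedy vectors are orthonormal, so the trace bound controls the sum
    of their forms; the zero vectors contribute nothing.\<close>
  have s_sum: "(\<Sum>n<k. s n) \<le> 2 * b" for k
  proof -
    have "(\<Sum>n<k. s n) = (\<Sum>n\<in>{n\<in>{..<k}. e n \<noteq> 0}. s n)"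
      by (intro sum.mono_neutral_right) (auto simp: s_def)
    also have "\<dots> = 2 * (\<Sum>f\<in>e ` {n\<in>{..<k}. e n \<noteq> 0}. inner f (B f))"
      unfolding sum.reindex[OF orthonormal_greedy(2)[OF e]] by (simp add: s_def sum_distrib_left)
    also have "e ` {n\<in>{..<k}. e n \<noteq> 0} = e ` {..<k} - {0}" by auto
    also have "2 * (\<Sum>f\<in>e ` {..<k} - {0}. inner f (B f)) \<le> 2 * b"
      by (intro mult_left_mono B(2) orthonormal_greedy(1)[OF e]) auto
    finally show ?thesis .
  qed
  have sums: "summable s" by (rule summableI_nonneg_bounded[OF s0 s_sum])
  \<comment> \<open>Direction \<open>n\<close> has to be removed only if
    \<open>|t| > 1 / (2 s n)\<close>. Recording this as an indicator in \<open>t\<close> allows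
    integration separately for each \<open>n\<close>.\<close>
  define g where "g t n = (indicator {t. 1 < 2 * \<bar>t\<bar> * s n} t :: ennreal)" for t :: real and n
  have count: "ennreal_of_enat (count_plus 1 (A' + t' *\<^sub>R B)) \<le> ennreal (4 * a) + (\<Sum>n. g t n)"
    if A': "selfadjoint A'" "\<And>F. finite F \<Longrightarrow> orthonormal F \<Longrightarrow> (\<Sum>f\<in>F. (norm (A' f))\<^sup>2) \<le> a"
      and t': "\<bar>t'\<bar> = \<bar>t\<bar>" for A' t' t
  proof -
    have "(\<lambda>n. 2 * \<bar>t\<bar> * s n) \<longlonglongrightarrow> 2 * \<bar>t\<bar> * 0"
      by (intro tendsto_mult_left summable_LIMSEQ_zero[OF sums])
    then have "\<forall>\<^sub>F n in sequentially. 2 * \<bar>t\<bar> * s n < 1" by (rule order_tendstoD) simp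
    then have ex: "\<exists>n. 2 * \<bar>t\<bar> * s n \<le> 1" by (meson eventually_happens less_imp_le trivial_limit_sequentially)
    \<comment> \<open>The first complement on which \<open>|t| B\<close> has form at most
      \<open>1/2\<close>; it exists because \<open>s\<close> tends to \<open>0\<close>. All smaller
      indices satisfy the strict reverse inequality, so \<open>j\<close> is at most the sum of the
      indicators even if \<open>s\<close> is not monotone.\<close>
    define j where "j = (LEAST n. 2 * \<bar>t\<bar> * s n \<le> 1)"
    have j: "2 * \<bar>t\<bar> * s j \<le> 1" unfolding j_def by (rule LeastI_ex[OF ex])
    have lt: "1 < 2 * \<bar>t\<bar> * s n" if "n < j" for n
      using not_less_Least[OF that[unfolded j_def]] by simp
    have "count_plus 1 (A' + t' *\<^sub>R B) \<le> enat (nat \<lfloor>4 * a\<rfloor> + j)"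
    proof (rule count_plus_add_scaled_le[OF A' B(1) e])
      fix x assume "\<forall>i<j. cinner (e i) x = 0"
      then have "inner x (B x) \<le> s j * (norm x)\<^sup>2" unfolding s_def by (rule greedy)
      then have "2 * \<bar>t\<bar> * inner x (B x) \<le> 2 * \<bar>t\<bar> * (s j * (norm x)\<^sup>2)" by (intro mult_left_mono) auto
      also have "\<dots> \<le> 1 * (norm x)\<^sup>2"
        unfolding mult.assoc[symmetric] using j by (intro mult_right_mono) auto
      finally show "2 * \<bar>t'\<bar> * inner x (B x) \<le> (norm x)\<^sup>2" by (simp add: t')
    qed
    then have "ennreal_of_enat (count_plus 1 (A' + t' *\<^sub>R B)) \<le> ennreal_of_enat (enat (nat \<lfloor>4 * a\<rfloor> + j))"
      by (simp only: ennreal_of_enat_le_iff)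
    also have "\<dots> = of_nat (nat \<lfloor>4 * a\<rfloor>) + of_nat j" by simp
    also have "\<dots> \<le> ennreal (4 * a) + (\<Sum>n. g t n)"
    proof (rule add_mono)
      show "of_nat (nat \<lfloor>4 * a\<rfloor>) \<le> ennreal (4 * a)"
        unfolding ennreal_of_nat_eq_real_of_nat using a by (intro ennreal_leI) simp
      have "of_nat j = (\<Sum>n<j. g t n)" using lt by (simp add: g_def)
      also have "\<dots> \<le> (\<Sum>n. g t n)" by (intro sum_le_suminf) auto
      finally show "of_nat j \<le> (\<Sum>n. g t n)" .
    qed
    finally show ?thesis .
  qed
  let ?w = "\<lambda>t :: real. ennreal (1 / (1 + t\<^sup>2))"
  \<comment> \<open>The tail starts at \<open>c = 1 / (2 s n)\<close> and has mass at most
    \<open>2 / c = 4 s n\<close>; the sum over \<open>n\<close> is then at most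
    \<open>8 b\<close>.\<close>
  have g_int: "(\<integral>\<^sup>+t. g t n * ?w t \<partial>lborel) \<le> ennreal (4 * s n)" for n
  proof (cases "s n = 0")
    case True
    then show ?thesis by (simp add: g_def)
  next
    case False
    then have s: "0 < s n" using s0[of n] by simp
    have "(\<integral>\<^sup>+t. g t n * ?w t \<partial>lborel)
        \<le> (\<integral>\<^sup>+t. ?w t * indicator {t. 1 / (2 * s n) \<le> \<bar>t\<bar>} t \<partial>lborel)"
      using s by (intro nn_integral_mono) (auto simp: g_def indicator_def field_simps)
    also have "\<dots> \<le> ennreal (pi - 2 * arctan (1 / (2 * s n)))"
      using s by (intro nn_integral_arctan_symmetric_tail) simp
    also have "\<dots> \<le> ennreal (4 * s n)"
      using pi_minus_arctan_le[of "1 / (2 * s n)"] s by (intro ennreal_leI) simp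
    finally show ?thesis .
  qed
  have "(\<integral>\<^sup>+t. (ennreal (4 * a) + (\<Sum>n. g t n)) * ?w t \<partial>lborel)
      = (\<integral>\<^sup>+t. ennreal (4 * a) * ?w t + (\<Sum>n. g t n * ?w t) \<partial>lborel)"
    by (simp add: distrib_right)
  also have "\<dots> = (\<integral>\<^sup>+t. ennreal (4 * a) * ?w t \<partial>lborel) + (\<integral>\<^sup>+t. (\<Sum>n. g t n * ?w t) \<partial>lborel)"
    unfolding g_def by (rule nn_integral_add) measurable
  also have "\<dots> \<le> ennreal (4 * a * pi) + ennreal (8 * b)"
  proof (rule add_mono)
    have "(\<integral>\<^sup>+t. ennreal (4 * a) * ?w t \<partial>lborel) = ennreal (4 * a) * (\<integral>\<^sup>+t. ?w t \<partial>lborel)"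
      by (rule nn_integral_cmult) measurable
    also have "\<dots> \<le> ennreal (4 * a) * ennreal pi"
      using nn_integral_arctan_symmetric_tail[of 0] by (intro mult_left_mono) (simp_all add: indicator_def)
    finally show "(\<integral>\<^sup>+t. ennreal (4 * a) * ?w t \<partial>lborel) \<le> ennreal (4 * a * pi)"
      using a by (simp add: ennreal_mult)
    have "(\<integral>\<^sup>+t. (\<Sum>n. g t n * ?w t) \<partial>lborel) = (\<Sum>n. \<integral>\<^sup>+t. g t n * ?w t \<partial>lborel)"
      unfolding g_def by (rule nn_integral_suminf) measurable
    also have "\<dots> \<le> (\<Sum>n. ennreal (4 * s n))" by (intro suminf_le g_int) auto
    also have "\<dots> = ennreal (\<Sum>n. 4 * s n)"
      using s0 by (intro suminf_ennreal2 summable_mult sums) simp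
    also have "\<dots> \<le> ennreal (8 * b)"
      using suminf_le_const[OF sums s_sum] by (intro ennreal_leI) (simp add: suminf_mult[OF sums])
    finally show "(\<integral>\<^sup>+t. (\<Sum>n. g t n * ?w t) \<partial>lborel) \<le> ennreal (8 * b)" .
  qed
  also have "\<dots> = ennreal (4 * a * pi + 8 * b)"
    using a s_sum[of 0] by (intro ennreal_plus[symmetric]) auto
  finally have int: "(\<integral>\<^sup>+t. (ennreal (4 * a) + (\<Sum>n. g t n)) * ?w t \<partial>lborel) \<le> ennreal (4 * a * pi + 8 * b)" .
  show "(\<integral>\<^sup>+t. ennreal_of_enat (count_plus 1 (A + t *\<^sub>R B)) * ?w t \<partial>lborel) \<le> ennreal (4 * a * pi + 8 * b)"
    by (rule order_trans[OF nn_integral_mono int]) (intro mult_right_mono count[OF A], auto)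
  \<comment> \<open>Since \<open>- (A + t B) = - A + (- t) B\<close> and the bound
    \<open>count\<close> sees only the modulus of \<open>t\<close>, negative eigenvalues are covered
    by the same estimate.\<close>
  have A': "selfadjoint (- A)" using A(1)
    by (simp add: selfadjoint_def blinfun.minus_left cinner.minus_left cinner.minus_right)
  have "ennreal_of_enat (count_minus 1 (A + t *\<^sub>R B)) \<le> ennreal (4 * a) + (\<Sum>n. g t n)" for t
    using count[OF A', of "- t" t] A(2) by (simp add: count_minus_def count_plus_def blinfun.minus_left)
  then show "(\<integral>\<^sup>+t. ennreal_of_enat (count_minus 1 (A + t *\<^sub>R B)) * ?w t \<partial>lborel) \<le> ennreal (4 * a * pi + 8 * b)"
    by (intro order_trans[OF nn_integral_mono int] mult_right_mono) auto
qed

section \<open>Operators on the lattice\<close>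

lemma ennreal_infsum:
  fixes f :: "'i \<Rightarrow> real"
  assumes "f summable_on A" "\<And>x. x \<in> A \<Longrightarrow> 0 \<le> f x"
  shows "ennreal (infsum f A) = (\<Sum>\<^sub>\<infinity>x\<in>A. ennreal (f x))"
proof -
  have "ennreal (infsum f A) = (SUP F\<in>{F. finite F \<and> F \<subseteq> A}. ennreal (sum f F))"
    using assms by (rule infsum_nonneg_is_SUPREMUM_ennreal)
  also have "\<dots> = (SUP F\<in>{F. finite F \<and> F \<subseteq> A}. \<Sum>x\<in>F. ennreal (f x))"
    using assms(2) by (intro SUP_cong refl sum_ennreal[symmetric]) auto
  also have "\<dots> = (\<Sum>\<^sub>\<infinity>x\<in>A. ennreal (f x))" by (rule nonneg_infsum_complete[symmetric]) simp
  finally show ?thesis .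
qed

lemma norm_ell2_sq_ennreal: "ennreal ((norm \<phi>)\<^sup>2) = (\<Sum>\<^sub>\<infinity>n. ennreal ((norm (ell2_apply \<phi> n))\<^sup>2))"
  unfolding norm_ell2_sq by (intro ennreal_infsum ell2_summable) simp

lemma has_sum_diff:
  fixes f g :: "'i \<Rightarrow> 'a::topological_ab_group_add"
  assumes "(f has_sum a) A" "(g has_sum b) A"
  shows "((\<lambda>x. f x - g x) has_sum (a - b)) A"
  using has_sum_add[OF assms(1), of "\<lambda>x. - g x" "- b"] assms(2) by (simp add: has_sum_uminus)

lemma bounded_linear_ell2_apply: "bounded_linear (\<lambda>\<phi>. ell2_apply \<phi> n)"
  by (rule bounded_linear_intro[where K = 1])
    (simp_all add: plus_ell2.rep_eq scaleR_ell2.rep_eq norm_ell2_apply_le)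

lemma cinner_tensor_mult_op:
  fixes K :: "'g::complex_hilbert \<Rightarrow>\<^sub>L 'g"
  assumes f: "bounded (range f)" "\<And>n. cnj (f n) = f n" and K: "clinear_op K"
  shows "cinner (tensor_op (mult_op f) (adj K) \<phi>) \<eta> = cinner \<phi> (tensor_op (mult_op f) K \<eta>)"
  unfolding cinner_ell2_def
  by (intro infsum_cong)
    (simp add: tensor_mult_op_apply f K clinear_op_adj cinner_scaleC_left cinner_scaleC_right cinner_adj_left)

lemma adj_tensor_mult_op:
  assumes "bounded (range f)" "\<And>n. cnj (f n) = f n" "clinear_op K"
  shows "adj (tensor_op (mult_op f) K) = tensor_op (mult_op f) (adj K)"
  by (rule adj_eqI) (rule cinner_tensor_mult_op[OF assms])

lemma clinear_op_tensor_mult_op: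
  assumes "bounded (range f)" "clinear_op K"
  shows "clinear_op (tensor_op (mult_op f) K)"
  unfolding clinear_op_def
proof (intro allI ell2_eqI)
  fix c \<phi> n
  show "ell2_apply (tensor_op (mult_op f) K (c *\<^sub>C \<phi>)) n = ell2_apply (c *\<^sub>C tensor_op (mult_op f) K \<phi>) n"
    using assms(2) by (simp add: tensor_mult_op_apply assms scaleC_ell2.rep_eq clinear_op_def scaleC_scaleC
        mult.commute)
qed

lemma cinner_translate: "cinner (translate k \<phi>) \<eta> = cinner \<phi> (translate (- k) \<eta>)"
proof -
  have "cinner \<phi> (translate (- k) \<eta>)
      = (\<Sum>\<^sub>\<infinity>n. cinner (ell2_apply \<phi> (n + k)) (ell2_apply (translate (- k) \<eta>) (n + k)))"
    unfolding cinner_ell2_def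
    by (rule infsum_reindex_bij_betw[symmetric]) (auto intro!: bij_betwI[where g = "\<lambda>n. n - k"])
  then show ?thesis by (simp add: cinner_ell2_def translate.rep_eq)
qed

lemma H_op_eq:
  assumes Q: "clinear_op Q"
  shows "H_op h Q \<phi> = (1 / h\<^sup>2) *\<^sub>R (2 *\<^sub>R \<phi> - translate 1 \<phi> - translate (- 1) \<phi>)
      + tensor_op (mult_op (\<lambda>_. 1)) Q \<phi>"
  by (rule ell2_eqI) (simp add: H_op_apply[OF Q] tensor_mult_op_apply Q plus_ell2.rep_eq minus_ell2.rep_eq
      scaleR_ell2.rep_eq translate.rep_eq scaleC_one)

lemma selfadjoint_H_op:
  assumes Q: "selfadjoint Q"
  shows "selfadjoint (H_op h Q)"
proof -
  have "cinner (tensor_op (mult_op (\<lambda>_. 1)) Q \<phi>) \<eta> = cinner \<phi> (tensor_op (mult_op (\<lambda>_. 1)) Q \<eta>)" for \<phi> \<eta>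
    using cinner_tensor_mult_op[of "\<lambda>_. 1" Q \<phi> \<eta>] Q by (simp add: adj_selfadjoint selfadjoint_clinear)
  then show ?thesis
    unfolding selfadjoint_def H_op_eq[OF selfadjoint_clinear[OF Q]]
    by (simp add: cinner_add_left cinner_add_right cinner.scaleR_left cinner.scaleR_right
        cinner.diff_left cinner.diff_right cinner_translate)
qed

section \<open>Kernel operators with square-summable weights\<close>

lemma kernel_sum_bound:
  fixes J :: "'g::complex_hilbert \<Rightarrow>\<^sub>L 'g" and \<phi> :: "'g ell2"
  assumes a: "\<And>k. cmod (a k) \<le> c"
  shows "(\<lambda>k. (a k * ell2_apply p k) *\<^sub>C J (ell2_apply \<phi> k)) abs_summable_on UNIV"
    and "norm (\<Sum>\<^sub>\<infinity>k. (a k * ell2_apply p k) *\<^sub>C J (ell2_apply \<phi> k)) \<le> c * norm J * norm p * norm \<phi>"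
proof -
  let ?f = "\<lambda>k. (a k * ell2_apply p k) *\<^sub>C J (ell2_apply \<phi> k)"
  have c: "0 \<le> c" using a[of 0] norm_ge_zero order_trans by blast
  \<comment> \<open>Cauchy-Schwarz pairs the weight \<open>p\<close> with the argument, so
    boundedness of \<open>a\<close> suffices. No decay of the Green function is available at real
    energies inside a band.\<close>
  have fin: "(\<Sum>k\<in>F. norm (?f k)) \<le> c * norm J * norm p * norm \<phi>" if F: "finite F" for F
  proof -
    have "(\<Sum>k\<in>F. norm (?f k)) \<le> (\<Sum>k\<in>F. c * norm J * (\<bar>cmod (ell2_apply p k)\<bar> * \<bar>norm (ell2_apply \<phi> k)\<bar>))"
    proof (rule sum_mono)
      fix k
      have "norm (?f k) \<le> (c * cmod (ell2_apply p k)) * (norm J * norm (ell2_apply \<phi> k))"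
        unfolding norm_scaleC norm_mult using c
        by (intro mult_mono a norm_blinfun mult_nonneg_nonneg) auto
      then show "norm (?f k) \<le> c * norm J * (\<bar>cmod (ell2_apply p k)\<bar> * \<bar>norm (ell2_apply \<phi> k)\<bar>)"
        by (simp add: mult_ac)
    qed
    also have "\<dots> \<le> c * norm J * (L2_set (\<lambda>k. cmod (ell2_apply p k)) F * L2_set (\<lambda>k. norm (ell2_apply \<phi> k)) F)"
      unfolding sum_distrib_left[symmetric] using c by (intro mult_left_mono L2_set_mult_ineq) auto
    also have "\<dots> \<le> c * norm J * (norm p * norm \<phi>)"
      using c norm_ell2_finite_le[OF F, of p] norm_ell2_finite_le[OF F, of \<phi>]
      by (intro mult_left_mono mult_mono) (auto simp: L2_set_def sum_nonneg intro!: real_le_lsqrt)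
    finally show ?thesis by (simp add: mult.assoc)
  qed
  show sum: "?f abs_summable_on UNIV"
    by (rule nonneg_bdd_above_summable_on) (use fin in \<open>auto intro!: bdd_aboveI\<close>)
  have "norm (infsum ?f UNIV) \<le> (\<Sum>\<^sub>\<infinity>k. norm (?f k))" by (rule norm_infsum_bound[OF sum])
  also have "\<dots> \<le> c * norm J * norm p * norm \<phi>" by (rule infsum_le_finite_sums[OF sum fin])
  finally show "norm (infsum ?f UNIV) \<le> c * norm J * norm p * norm \<phi>" .
qed

text \<open>\<open>kernel_op p a J\<close> is the operator with the matrix entries \<open>p(n) a(m - n) p(m) J\<close>.\<close>

definition kernel_op ::
  "complex ell2 \<Rightarrow> (int \<Rightarrow> complex) \<Rightarrow> ('g::complex_hilbert \<Rightarrow>\<^sub>L 'g) \<Rightarrow> 'g ell2 \<Rightarrow>\<^sub>L 'g ell2" where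
  "kernel_op p a J = Blinfun (\<lambda>\<phi>. Abs_ell2 (\<lambda>n. ell2_apply p n *\<^sub>C
     (\<Sum>\<^sub>\<infinity>k. (a k * ell2_apply p (n + k)) *\<^sub>C J (ell2_apply \<phi> (n + k)))))"

lemma
  fixes J :: "'g::complex_hilbert \<Rightarrow>\<^sub>L 'g" and \<phi> :: "'g ell2"
  assumes a: "\<And>k. cmod (a k) \<le> c"
  shows kernel_op_apply: "ell2_apply (kernel_op p a J \<phi>) n
      = ell2_apply p n *\<^sub>C (\<Sum>\<^sub>\<infinity>k. (a k * ell2_apply p (n + k)) *\<^sub>C J (ell2_apply \<phi> (n + k)))"
    and kernel_summable:
      "(\<lambda>k. (a k * ell2_apply p (n + k)) *\<^sub>C J (ell2_apply \<phi> (n + k))) summable_on UNIV"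
proof -
  have c: "0 \<le> c" using a[of 0] norm_ge_zero order_trans by blast
  define f where "f = (\<lambda>\<phi> n k. (a k * ell2_apply p (n + k)) *\<^sub>C J (ell2_apply \<phi> (n + k)))"
  \<comment> \<open>Translation carries row \<open>n\<close> to row \<open>0\<close>, where
    \<open>kernel_sum_bound\<close> applies, and preserves both norms, so the bound is uniform in
    \<open>n\<close>.\<close>
  have f: "f \<phi> n = (\<lambda>k. (a k * ell2_apply (translate n p) k) *\<^sub>C J (ell2_apply (translate n \<phi>) k))" for \<phi> n
    by (rule ext) (simp add: f_def translate.rep_eq add.commute)
  have sum: "f \<phi> n summable_on UNIV" for \<phi> n
    unfolding f by (rule abs_summable_summable, rule kernel_sum_bound(1), rule a)
  from sum[of \<phi> n, unfolded f_def]
  show "(\<lambda>k. (a k * ell2_apply p (n + k)) *\<^sub>C J (ell2_apply \<phi> (n + k))) summable_on UNIV" .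
  have bound: "norm (infsum (f \<phi> n) UNIV) \<le> c * norm J * norm p * norm \<phi>" for \<phi> n
    using kernel_sum_bound(2)[of a c "translate n p" J "translate n \<phi>", OF a]
    unfolding f norm_translate .
  have le: "norm (ell2_apply p n *\<^sub>C infsum (f \<phi> n) UNIV)
      \<le> (c * norm J * norm p * norm \<phi>) * norm (ell2_apply p n)" for \<phi> n
    unfolding norm_scaleC using mult_right_mono[OF bound norm_ge_zero] by (simp add: mult.commute)
  let ?T = "\<lambda>\<phi>. Abs_ell2 (\<lambda>n. ell2_apply p n *\<^sub>C infsum (f \<phi> n) UNIV)"
  have T: "ell2_apply (?T \<phi>) n = ell2_apply p n *\<^sub>C infsum (f \<phi> n) UNIV" for \<phi> n
    by (subst Abs_ell2_inverse) (use sq_summable_bound[OF ell2_summable le] in auto)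
  have "bounded_linear ?T"
  proof (rule bounded_linear_intro[where K = "c * norm J * norm p * norm p"])
    show "?T (\<phi> + \<eta>) = ?T \<phi> + ?T \<eta>" for \<phi> \<eta>
    proof (rule ell2_eqI)
      fix n
      have "f (\<phi> + \<eta>) n = (\<lambda>k. f \<phi> n k + f \<eta> n k)"
        by (simp add: f_def plus_ell2.rep_eq blinfun.add_right scaleC_add_right)
      then show "ell2_apply (?T (\<phi> + \<eta>)) n = ell2_apply (?T \<phi> + ?T \<eta>) n"
        unfolding plus_ell2.rep_eq T by (simp only: infsum_add[OF sum sum] scaleC_add_right)
    qed
    show "?T (r *\<^sub>R \<phi>) = r *\<^sub>R ?T \<phi>" for r \<phi>
    proof (rule ell2_eqI)
      fix n
      have "f (r *\<^sub>R \<phi>) n = (\<lambda>k. r *\<^sub>R f \<phi> n k)"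
        by (simp add: f_def scaleR_ell2.rep_eq blinfun.scaleR_right scaleC.scaleR_right)
      moreover have "(\<Sum>\<^sub>\<infinity>k. r *\<^sub>R f \<phi> n k) = r *\<^sub>R infsum (f \<phi> n) UNIV"
        by (intro infsumI has_sum_bounded_linear[OF bounded_linear_scaleR_right] has_sum_infsum sum)
      ultimately show "ell2_apply (?T (r *\<^sub>R \<phi>)) n = ell2_apply (r *\<^sub>R ?T \<phi>) n"
        unfolding scaleR_ell2.rep_eq T by (simp only: scaleC.scaleR_right)
    qed
    show "norm (?T \<phi>) \<le> norm \<phi> * (c * norm J * norm p * norm p)" for \<phi>
    proof (rule norm_ell2_leI)
      fix F :: "int set" assume F: "finite F"
      let ?b = "c * norm J * norm p * norm \<phi>"
      have "(\<Sum>n\<in>F. (norm (ell2_apply (?T \<phi>) n))\<^sup>2) \<le> (\<Sum>n\<in>F. (?b * norm (ell2_apply p n))\<^sup>2)"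
        unfolding T by (intro sum_mono power_mono le) auto
      also have "\<dots> = ?b\<^sup>2 * (\<Sum>n\<in>F. (norm (ell2_apply p n))\<^sup>2)"
        by (simp only: power_mult_distrib sum_distrib_left)
      also have "\<dots> \<le> ?b\<^sup>2 * (norm p)\<^sup>2"
        by (intro mult_left_mono norm_ell2_finite_le F) simp
      finally show "(\<Sum>n\<in>F. (norm (ell2_apply (?T \<phi>) n))\<^sup>2) \<le> (norm \<phi> * (c * norm J * norm p * norm p))\<^sup>2"
        by (simp add: power_mult_distrib mult_ac)
    qed (simp add: c)
  qed
  then have "kernel_op p a J \<phi> = ?T \<phi>"
    unfolding kernel_op_def f_def by (simp add: bounded_linear_Blinfun_apply)
  then show "ell2_apply (kernel_op p a J \<phi>) n
      = ell2_apply p n *\<^sub>C (\<Sum>\<^sub>\<infinity>k. (a k * ell2_apply p (n + k)) *\<^sub>C J (ell2_apply \<phi> (n + k)))"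
    by (simp only: T) (simp only: f_def)
qed

lemma clinear_op_kernel_op:
  assumes a: "\<And>k. cmod (a k) \<le> c" and J: "clinear_op J"
  shows "clinear_op (kernel_op p a J)"
  unfolding clinear_op_def
proof (intro allI ell2_eqI)
  fix z \<phi> n
  let ?f = "\<lambda>k. (a k * ell2_apply p (n + k)) *\<^sub>C J (ell2_apply \<phi> (n + k))"
  have "(\<Sum>\<^sub>\<infinity>k. z *\<^sub>C ?f k) = z *\<^sub>C infsum ?f UNIV"
    by (intro infsumI has_sum_bounded_linear[OF scaleC.bounded_linear_right] has_sum_infsum
        kernel_summable[OF a])
  moreover have "(a k * ell2_apply p (n + k)) *\<^sub>C J (ell2_apply (z *\<^sub>C \<phi>) (n + k)) = z *\<^sub>C ?f k" for k
    using J by (simp add: clinear_op_def scaleC_ell2.rep_eq scaleC_scaleC mult_ac)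
  ultimately show "ell2_apply (kernel_op p a J (z *\<^sub>C \<phi>)) n = ell2_apply (z *\<^sub>C kernel_op p a J \<phi>) n"
    by (simp add: scaleC_ell2.rep_eq kernel_op_apply[OF a] scaleC_scaleC mult.commute)
qed

lemma kernel_op_diff:
  assumes a: "\<And>k. cmod (a k) \<le> c" and b: "\<And>k. cmod (b k) \<le> c'"
  shows "kernel_op p a J - kernel_op p b J = kernel_op p (\<lambda>k. a k - b k) J"
proof (intro blinfun_eqI ell2_eqI)
  fix \<phi> n
  have ab: "cmod (a k - b k) \<le> c + c'" for k
    using norm_triangle_ineq4[of "a k" "b k"] a[of k] b[of k] by linarith
  have "(\<Sum>\<^sub>\<infinity>k. ((a k - b k) * ell2_apply p (n + k)) *\<^sub>C J (ell2_apply \<phi> (n + k)))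
      = (\<Sum>\<^sub>\<infinity>k. (a k * ell2_apply p (n + k)) *\<^sub>C J (ell2_apply \<phi> (n + k)))
        - (\<Sum>\<^sub>\<infinity>k. (b k * ell2_apply p (n + k)) *\<^sub>C J (ell2_apply \<phi> (n + k)))"
    unfolding left_diff_distrib scaleC.diff_left
    by (intro infsumI has_sum_diff has_sum_infsum kernel_summable[OF a] kernel_summable[OF b])
  then show "ell2_apply ((kernel_op p a J - kernel_op p b J) \<phi>) n
      = ell2_apply (kernel_op p (\<lambda>k. a k - b k) J \<phi>) n"
    by (simp add: blinfun.diff_left minus_ell2.rep_eq kernel_op_apply[OF a] kernel_op_apply[OF b]
        kernel_op_apply[OF ab] scaleC.diff_right)
qed

lemma kernel_op_tensor_delta:
  assumes a: "\<And>k. cmod (a k) \<le> c"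
  shows "ell2_apply (kernel_op p a J (tensor_vec (delta m) e)) n
    = (ell2_apply p n * (a (m - n) * ell2_apply p m)) *\<^sub>C J e"
proof -
  have "(\<Sum>\<^sub>\<infinity>k. (a k * ell2_apply p (n + k)) *\<^sub>C J (ell2_apply (tensor_vec (delta m) e) (n + k)))
      = (\<Sum>\<^sub>\<infinity>k\<in>{m - n}. (a (m - n) * ell2_apply p m) *\<^sub>C J e)"
    by (rule infsum_cong_neutral) (auto simp: ell2_apply_tensor_delta blinfun.zero_right scaleC.zero_right)
  then show ?thesis by (simp add: kernel_op_apply[OF a] scaleC_scaleC)
qed

text \<open>The weight with which the \<open>k\<close>-th diagonal enters the squared
  Hilbert-Schmidt norm of a kernel operator.\<close>

definition autocorrelation :: "complex ell2 \<Rightarrow> int \<Rightarrow> ennreal" where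
  "autocorrelation p k = (\<Sum>\<^sub>\<infinity>m. ennreal ((cmod (ell2_apply p m))\<^sup>2) * ennreal ((cmod (ell2_apply p (m - k)))\<^sup>2))"

text \<open>The total weight is finite, so the autocorrelation can act as the finite measure in
  dominated convergence over the diagonals.\<close>

lemma infsum_autocorrelation: "(\<Sum>\<^sub>\<infinity>k. autocorrelation p k) = ennreal ((norm p)\<^sup>2) * ennreal ((norm p)\<^sup>2)"
proof -
  have "(\<Sum>\<^sub>\<infinity>k. ennreal ((cmod (ell2_apply p (m - k)))\<^sup>2)) = ennreal ((norm p)\<^sup>2)" for m
    unfolding norm_ell2_sq_ennreal
    by (rule infsum_reindex_bij_betw[where g = "\<lambda>k. m - k" and f = "\<lambda>n. ennreal ((cmod (ell2_apply p n))\<^sup>2)"])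
      (auto intro!: bij_betwI[where g = "\<lambda>n. m - n"])
  then have "(\<Sum>\<^sub>\<infinity>k. autocorrelation p k) = (\<Sum>\<^sub>\<infinity>m. ennreal ((norm p)\<^sup>2) * ennreal ((cmod (ell2_apply p m))\<^sup>2))"
    unfolding autocorrelation_def
    by (subst infsum_swap_ennreal) (simp add: infsum_cmult_ennreal mult.commute)
  then show ?thesis
    by (simp add: infsum_cmult_ennreal norm_ell2_sq_ennreal[symmetric])
qed

text \<open>The columns are explicit in the product basis. Collecting entries along the diagonals
  \<open>k = m - n\<close> separates the kernel \<open>a\<close> from the weights and from
  \<open>J\<close>.\<close>

lemma hs_sq_kernel_op_le:
  fixes J :: "'g::complex_hilbert \<Rightarrow>\<^sub>L 'g"
  assumes a: "\<And>k. cmod (a k) \<le> c" and J: "clinear_op J"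
  shows "hs_sq (kernel_op p a J) \<le> hs_sq J * (\<Sum>\<^sub>\<infinity>k. ennreal ((cmod (a k))\<^sup>2) * autocorrelation p k)"
proof -
  obtain E :: "'g set" where E: "is_onb E" using ex_onb by blast
  define q where "q n = ennreal ((cmod (ell2_apply p n))\<^sup>2)" for n
  define X where "X m = (\<Sum>\<^sub>\<infinity>k. ennreal ((cmod (a k))\<^sup>2) * (q m * q (m - k)))" for m
  have col: "ennreal ((norm (kernel_op p a J (tensor_vec (delta m) e)))\<^sup>2) = X m * ennreal ((norm (J e))\<^sup>2)" for m e
  proof -
    have "ennreal ((norm (kernel_op p a J (tensor_vec (delta m) e)))\<^sup>2)
        = (\<Sum>\<^sub>\<infinity>n. ennreal ((norm (J e))\<^sup>2) * (ennreal ((cmod (a (m - n)))\<^sup>2) * (q m * q n)))"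
      unfolding norm_ell2_sq_ennreal kernel_op_tensor_delta[OF a]
      by (intro infsum_cong) (simp add: norm_scaleC norm_mult power_mult_distrib q_def ennreal_mult[symmetric] mult_ac)
    also have "\<dots> = ennreal ((norm (J e))\<^sup>2) * (\<Sum>\<^sub>\<infinity>n. ennreal ((cmod (a (m - n)))\<^sup>2) * (q m * q n))"
      by (rule infsum_cmult_ennreal)
    also have "(\<Sum>\<^sub>\<infinity>n. ennreal ((cmod (a (m - n)))\<^sup>2) * (q m * q n)) = X m"
      unfolding X_def
      by (subst infsum_reindex_bij_betw[where g = "\<lambda>k. m - k" and A = UNIV and B = UNIV, symmetric])
        (auto intro!: bij_betwI[where g = "\<lambda>n. m - n"])
    finally show ?thesis by (simp add: mult.commute)
  qed
  have "hs_sq (kernel_op p a J)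
      \<le> (\<Sum>\<^sub>\<infinity>m. \<Sum>\<^sub>\<infinity>e\<in>E. ennreal ((norm (kernel_op p a J (tensor_vec (delta m) e)))\<^sup>2))"
    by (rule hs_sq_ell2_le[OF clinear_op_kernel_op[OF a J] E])
  also have "\<dots> = (\<Sum>\<^sub>\<infinity>m. hs_sq J * X m)"
    unfolding col by (simp add: infsum_cmult_ennreal hs_sq_eq_infsum[OF J E] mult.commute)
  also have "\<dots> = hs_sq J * (\<Sum>\<^sub>\<infinity>m. X m)" by (rule infsum_cmult_ennreal)
  also have "(\<Sum>\<^sub>\<infinity>m. X m) = (\<Sum>\<^sub>\<infinity>k. ennreal ((cmod (a k))\<^sup>2) * autocorrelation p k)"
    unfolding X_def
    by (subst infsum_swap_ennreal) (simp add: infsum_cmult_ennreal autocorrelation_def q_def)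
  finally show ?thesis .
qed

lemma hs_sq_kernel_op_bound:
  assumes a: "\<And>k. cmod (a k) \<le> c" and J: "clinear_op J"
  shows "hs_sq (kernel_op p a J) \<le> hs_sq J * (ennreal (c\<^sup>2) * (ennreal ((norm p)\<^sup>2) * ennreal ((norm p)\<^sup>2)))"
proof -
  have c: "0 \<le> c" using a[of 0] norm_ge_zero order_trans by blast
  have "hs_sq (kernel_op p a J) \<le> hs_sq J * (\<Sum>\<^sub>\<infinity>k. ennreal ((cmod (a k))\<^sup>2) * autocorrelation p k)"
    by (rule hs_sq_kernel_op_le[OF a J])
  also have "\<dots> \<le> hs_sq J * (\<Sum>\<^sub>\<infinity>k. ennreal (c\<^sup>2) * autocorrelation p k)"
    using a by (intro mult_left_mono infsum_mono_ennreal mult_right_mono ennreal_leI power_mono) auto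
  also have "\<dots> = hs_sq J * (ennreal (c\<^sup>2) * (ennreal ((norm p)\<^sup>2) * ennreal ((norm p)\<^sup>2)))"
    by (simp only: infsum_cmult_ennreal infsum_autocorrelation)
  finally show ?thesis .
qed

lemma tendsto_0_ennreal:
  fixes f :: "'x \<Rightarrow> ennreal"
  assumes "\<And>d :: real. 0 < d \<Longrightarrow> \<forall>\<^sub>F x in F. f x \<le> ennreal d"
  shows "(f \<longlongrightarrow> 0) F"
proof (rule order_tendstoI)
  fix y :: ennreal assume "0 < y"
  then obtain r :: real where r: "0 < r" "ennreal r < y"
    by (metis ennreal_enn2real ennreal_zero_less_top dense ennreal_less_zero_iff enn2real_nonneg
        less_le order_less_trans top.not_eq_extremum)
  show "\<forall>\<^sub>F x in F. f x < y"
    using assms[OF r(1)] by eventually_elim (use r(2) in order)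
qed simp

text \<open>Dominated convergence over an arbitrary index set along an arbitrary filter: outside a
  finite set \<open>G\<close> the mass of \<open>v\<close> is small, and on \<open>G\<close> only
  finitely many limits are involved.\<close>

lemma infsum_dominated_tendsto_0:
  fixes v :: "'i \<Rightarrow> ennreal" and b :: "'x \<Rightarrow> 'i \<Rightarrow> real"
  assumes v: "infsum v UNIV < \<infinity>"
    and b: "\<And>x k. 0 \<le> b x k" "\<forall>\<^sub>F x in F. \<forall>k. b x k \<le> M" "\<And>k. ((\<lambda>x. b x k) \<longlongrightarrow> 0) F"
  shows "((\<lambda>x. \<Sum>\<^sub>\<infinity>k. ennreal (b x k) * v k) \<longlongrightarrow> 0) F"
proof (rule tendsto_0_ennreal)
  fix d :: real assume d: "0 < d"
  \<comment> \<open>The tolerance for the tail is divided by this bound, which must therefore be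
    positive.\<close>
  define M' where "M' = max M 1"
  have M': "0 < M'" by (simp add: M'_def)
  define u where "u k = enn2real (v k)" for k
  obtain s where s: "0 \<le> s" "infsum v UNIV = ennreal s" using v by (cases "infsum v UNIV") auto
  have "v k \<le> infsum v UNIV" for k using sum_le_infsum_ennreal[of "{k}" UNIV v] by simp
  then have "v k < top" for k using v by (metis infinity_ennreal_def order_le_less_trans)
  then have vu: "v k = ennreal (u k)" for k by (simp add: u_def)
  have u0: "0 \<le> u k" for k by (simp add: u_def)
  have le_s: "sum u G \<le> s" if "finite G" for G
  proof -
    have "ennreal (sum u G) = (\<Sum>k\<in>G. v k)" using u0 by (simp add: vu sum_ennreal)
    also have "\<dots> \<le> ennreal s" using sum_le_infsum_ennreal[OF that, of UNIV v] s(2) by simp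
    finally show ?thesis using s(1) by simp
  qed
  have sum_u: "u summable_on UNIV"
    by (rule nonneg_bdd_above_summable_on) (use u0 le_s in \<open>auto intro!: bdd_aboveI\<close>)
  obtain G where G: "finite G" "dist (sum u G) (infsum u UNIV) \<le> d / (2 * M')"
    using infsum_finite_approximation[OF sum_u, of "d / (2 * M')"] d M' by auto
  have "((\<lambda>x. \<Sum>k\<in>G. b x k * u k) \<longlongrightarrow> (\<Sum>k\<in>G. 0 * u k)) F"
    by (intro tendsto_intros b(3))
  then have "\<forall>\<^sub>F x in F. (\<Sum>k\<in>G. b x k * u k) < d / 2" using d by (intro order_tendstoD(2)) auto
  then show "\<forall>\<^sub>F x in F. (\<Sum>\<^sub>\<infinity>k. ennreal (b x k) * v k) \<le> ennreal d"
    using b(2)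
  proof eventually_elim
    case (elim x)
    show ?case
    proof (rule infsum_leI_ennreal)
      fix H :: "'i set" assume H: "finite H"
      have "(\<Sum>k\<in>H. b x k * u k) \<le> (\<Sum>k\<in>G \<union> (H - G). b x k * u k)"
        using G(1) H u0 b(1) by (intro sum_mono2) auto
      also have "\<dots> = (\<Sum>k\<in>G. b x k * u k) + (\<Sum>k\<in>H - G. b x k * u k)"
        using G(1) H by (intro sum.union_disjoint) auto
      also have "(\<Sum>k\<in>H - G. b x k * u k) \<le> (\<Sum>k\<in>H - G. M' * u k)"
      proof (intro sum_mono mult_right_mono u0)
        show "b x k \<le> M'" for k using elim(2) by (simp add: M'_def le_max_iff_disj)
      qed
      also have "\<dots> = M' * (sum u (G \<union> (H - G)) - sum u G)"
        using G(1) H by (subst sum.union_disjoint) (auto simp: sum_distrib_left)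
      also have "\<dots> \<le> M' * (d / (2 * M'))"
      proof (intro mult_left_mono)
        have "sum u (G \<union> (H - G)) \<le> infsum u UNIV"
          using G(1) H u0 by (intro finite_sum_le_infsum sum_u) auto
        then show "sum u (G \<union> (H - G)) - sum u G \<le> d / (2 * M')"
          using G(2) by (simp add: dist_real_def)
      qed (use M' in simp)
      also have "\<dots> = d / 2" using M' by simp
      finally have "(\<Sum>k\<in>H. b x k * u k) \<le> d" using elim(1) by simp
      then show "(\<Sum>k\<in>H. ennreal (b x k) * v k) \<le> ennreal d"
        using u0 b(1) by (simp add: vu ennreal_mult[symmetric] sum_ennreal ennreal_leI)
    qed
  qed
qed

text \<open>Near the real axis the kernels are only uniformly bounded and pointwise convergent; the
  finite weight \<open>autocorrelation p\<close> upgrades this to Hilbert-Schmidt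
  convergence.\<close>

lemma hs_sq_kernel_op_tendsto_0:
  fixes J :: "'g::complex_hilbert \<Rightarrow>\<^sub>L 'g"
  assumes a: "\<forall>\<^sub>F x in F. \<forall>k. cmod (a x k) \<le> c" "\<And>k. cmod (b k) \<le> c"
      "\<And>k. ((\<lambda>x. a x k) \<longlongrightarrow> b k) F"
    and J: "clinear_op J" "hs_sq J < \<infinity>"
  shows "((\<lambda>x. hs_sq (kernel_op p (a x) J - kernel_op p b J)) \<longlongrightarrow> 0) F"
proof (rule tendsto_sandwich[OF _ _ tendsto_const])
  let ?s = "\<lambda>x. \<Sum>\<^sub>\<infinity>k. ennreal ((cmod (a x k - b k))\<^sup>2) * autocorrelation p k"
  show "\<forall>\<^sub>F x in F. hs_sq (kernel_op p (a x) J - kernel_op p b J) \<le> hs_sq J * ?s x"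
    using a(1)
  proof eventually_elim
    case (elim x)
    have ab: "cmod (a x k - b k) \<le> c + c" for k
      using norm_triangle_ineq4[of "a x k" "b k"] elim a(2)[of k] by (meson add_mono order_trans)
    show ?case
      using hs_sq_kernel_op_le[OF ab J(1), of p] by (simp add: kernel_op_diff[OF elim[rule_format] a(2)])
  qed
  have "(?s \<longlongrightarrow> 0) F"
  proof (rule infsum_dominated_tendsto_0)
    show "infsum (autocorrelation p) UNIV < \<infinity>" by (simp add: infsum_autocorrelation ennreal_mult_less_top)
    show "\<forall>\<^sub>F x in F. \<forall>k. (cmod (a x k - b k))\<^sup>2 \<le> (c + c)\<^sup>2"
      using a(1)
    proof eventually_elim
      case (elim x)
      have "cmod (a x k - b k) \<le> c + c" for k
        using norm_triangle_ineq4[of "a x k" "b k"] elim a(2)[of k] by (meson add_mono order_trans)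
      then show ?case by (intro allI power_mono) auto
    qed
    have "((\<lambda>x. (cmod (a x k - b k))\<^sup>2) \<longlongrightarrow> (cmod (b k - b k))\<^sup>2) F" for k
      by (intro tendsto_intros a(3))
    then show "((\<lambda>x. (cmod (a x k - b k))\<^sup>2) \<longlongrightarrow> 0) F" for k by simp
  qed simp
  then have "((\<lambda>x. hs_sq J * ?s x) \<longlongrightarrow> hs_sq J * 0) F"
    by (intro ennreal_tendsto_cmult) (use J(2) in simp_all)
  then show "((\<lambda>x. hs_sq J * ?s x) \<longlongrightarrow> 0) F" by simp
qed simp

subsection \<open>The resolvent\<close>

text \<open>For absolutely summable \<open>a\<close> the series converges in operator norm; the
  Green function at energies in the upper half-plane is of this kind.\<close>

definition conv_op :: "(int \<Rightarrow> complex) \<Rightarrow> 'g::complex_hilbert ell2 \<Rightarrow>\<^sub>L 'g ell2" where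
  "conv_op a = (\<Sum>\<^sub>\<infinity>k. scalar_op (a k) o\<^sub>L translate_op k)"

lemma conv_op_has_sum:
  assumes a: "(\<lambda>k. cmod (a k)) summable_on UNIV"
  shows "((\<lambda>k. a k *\<^sub>C ell2_apply \<phi> (n + k)) has_sum ell2_apply (conv_op a \<phi>) n) UNIV"
proof -
  have "norm (scalar_op (a k) o\<^sub>L translate_op k :: 'a ell2 \<Rightarrow>\<^sub>L 'a ell2) \<le> cmod (a k)" for k
    by (rule norm_blinfun_bound) (simp_all add: translate_op.rep_eq norm_scaleC norm_translate)
  then have "(\<lambda>k. scalar_op (a k) o\<^sub>L translate_op k :: 'a ell2 \<Rightarrow>\<^sub>L 'a ell2) abs_summable_on UNIV"
    using a by (intro summable_on_comparison_test[OF a]) auto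
  then have "((\<lambda>k. scalar_op (a k) o\<^sub>L translate_op k) has_sum (conv_op a :: 'a ell2 \<Rightarrow>\<^sub>L 'a ell2)) UNIV"
    unfolding conv_op_def by (intro has_sum_infsum) (rule abs_summable_summable)
  from has_sum_bounded_linear[OF bounded_linear_ell2_apply
      has_sum_bounded_linear[OF blinfun.bounded_linear_left this]]
  show ?thesis by (simp add: translate_op.rep_eq scaleC_ell2.rep_eq translate.rep_eq)
qed

text \<open>The kernel \<open>a\<close> is a fundamental solution of the difference operator, so
  convolution with it is a right inverse. Shifting the summation index moves the differences from
  \<open>u\<close> onto \<open>a\<close>.\<close>

lemma conv_op_inverts:
  fixes \<phi> :: "'g::complex_hilbert ell2" and n :: int
  assumes a: "(\<lambda>k. cmod (a k)) summable_on UNIV"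
    and rec: "\<And>k. r * (2 * a k - a (k - 1) - a (k + 1)) - w * a k = (if k = 0 then 1 else 0)"
  defines "u \<equiv> ell2_apply (conv_op a \<phi>)"
  shows "r *\<^sub>C (2 *\<^sub>C u n - u (n + 1) - u (n - 1)) - w *\<^sub>C u n = ell2_apply \<phi> n"
proof -
  note hs = conv_op_has_sum[OF a, of \<phi>, folded u_def]
  have shift: "((\<lambda>k. a (k - i) *\<^sub>C ell2_apply \<phi> (n + k)) has_sum u (n + i)) UNIV" for i
  proof -
    have "bij_betw (\<lambda>k. k - i) UNIV UNIV" by (rule bij_betwI[where g = "\<lambda>n. n + i"]) auto
    from has_sum_reindex_bij_betw[OF this, THEN iffD2, OF hs[of "n + i"]]
    have "((\<lambda>k. a (k - i) *\<^sub>C ell2_apply \<phi> (n + i + (k - i))) has_sum u (n + i)) UNIV" .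
    then show ?thesis by simp
  qed
  note C = has_sum_bounded_linear[OF scaleC.bounded_linear_right]
  have "((\<lambda>k. r *\<^sub>C (2 *\<^sub>C (a k *\<^sub>C ell2_apply \<phi> (n + k)) - a (k - 1) *\<^sub>C ell2_apply \<phi> (n + k)
        - a (k - (- 1)) *\<^sub>C ell2_apply \<phi> (n + k)) - w *\<^sub>C (a k *\<^sub>C ell2_apply \<phi> (n + k)))
      has_sum (r *\<^sub>C (2 *\<^sub>C u n - u (n + 1) - u (n + (- 1))) - w *\<^sub>C u n)) UNIV"
    by (intro has_sum_diff C hs shift)
  moreover have "r *\<^sub>C (2 *\<^sub>C (a k *\<^sub>C x) - a (k - 1) *\<^sub>C x - a (k - (- 1)) *\<^sub>C x) - w *\<^sub>C (a k *\<^sub>C x)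
      = (if k = 0 then x else 0)" for k and x :: 'g
  proof -
    have "r *\<^sub>C (2 *\<^sub>C (a k *\<^sub>C x) - a (k - 1) *\<^sub>C x - a (k - (- 1)) *\<^sub>C x) - w *\<^sub>C (a k *\<^sub>C x)
        = (r * (2 * a k - a (k - 1) - a (k + 1)) - w * a k) *\<^sub>C x"
      by (simp only: scaleC_scaleC scaleC.diff_left[symmetric] diff_minus_eq_add)
    then show ?thesis unfolding rec by (simp add: scaleC_one)
  qed
  ultimately have 1: "((\<lambda>k. if k = 0 then ell2_apply \<phi> (n + k) else 0) has_sum
      (r *\<^sub>C (2 *\<^sub>C u n - u (n + 1) - u (n + (- 1))) - w *\<^sub>C u n)) UNIV" by simp
  have "((\<lambda>k. if k = 0 then ell2_apply \<phi> (n + k) else 0) has_sum ell2_apply \<phi> n) UNIV"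
    by (rule has_sum_finite_neutralI[of "{0}"]) auto
  from has_sum_unique[OF 1 this] show ?thesis by simp
qed

text \<open>The imaginary part of the form of \<open>H - z\<close> at \<open>y\<close> is
  \<open>- Im z\<close> times the squared norm of \<open>y\<close>. Hence \<open>H - z\<close> is
  injective and the right inverse \<open>R\<close> is two-sided; the same identity at
  \<open>y = R x\<close> gives the sign.\<close>

lemma selfadjoint_resolvent:
  fixes H :: "'a::complex_hilbert \<Rightarrow>\<^sub>L 'a"
  assumes H: "selfadjoint H" and z: "0 < Im z"
    and R: "\<And>x. H (blinfun_apply R x) - z *\<^sub>C R x = x"
  shows "inverse_op (H - scalar_op z) = R" and "0 \<le> Im (cinner x (R x))"
proof -
  have im: "Im (cinner y (H y - z *\<^sub>C y)) = - (Im z * (norm y)\<^sup>2)" for y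
    using selfadjoint_cinner_real[OF H, of y]
    by (simp add: cinner.diff_right cinner_scaleC_right cinner_self)
  have inj: "y = 0" if "H y - z *\<^sub>C y = 0" for y
    using im[of y] that z by (simp add: cinner.zero_right)
  have AR: "(H - scalar_op z) o\<^sub>L R = id_blinfun"
    by (rule blinfun_eqI) (simp add: blinfun.diff_left R)
  have RA: "R o\<^sub>L (H - scalar_op z) = id_blinfun"
  proof (rule blinfun_eqI)
    fix x
    let ?y = "R (H x - z *\<^sub>C x) - x"
    have "H ?y - z *\<^sub>C ?y = (H (R (H x - z *\<^sub>C x)) - z *\<^sub>C R (H x - z *\<^sub>C x)) - (H x - z *\<^sub>C x)"
      by (simp only: blinfun.diff_right scaleC.diff_right) simp
    then have "H ?y - z *\<^sub>C ?y = 0" unfolding R by simp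
    then have "?y = 0" by (rule inj)
    then show "(R o\<^sub>L (H - scalar_op z)) x = id_blinfun x" by (simp add: blinfun.diff_left)
  qed
  show "inverse_op (H - scalar_op z) = R"
    unfolding inverse_op_def
  proof (rule some_equality)
    fix B assume B: "(H - scalar_op z) o\<^sub>L B = id_blinfun \<and> B o\<^sub>L (H - scalar_op z) = id_blinfun"
    have "B x = R x" for x
    proof -
      have "B x = (R o\<^sub>L (H - scalar_op z)) (B x)" unfolding RA by simp
      also have "\<dots> = R (((H - scalar_op z) o\<^sub>L B) x)" by simp
      finally show ?thesis using B by simp
    qed
    then show "B = R" by (rule blinfun_eqI)
  qed (use AR RA in blast)
  have "cinner x (R x) = cnj (cinner (R x) (H (R x) - z *\<^sub>C R x))"
    unfolding R by (rule cinner_commute)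
  then show "0 \<le> Im (cinner x (R x))" using im[of "R x"] z by simp
qed

subsection \<open>The Green function of the discrete Laplacian\<close>

lemma summable_on_int_abs:
  fixes f :: "nat \<Rightarrow> real"
  assumes f: "summable f" "\<And>n. 0 \<le> f n"
  shows "(\<lambda>k :: int. f (nat \<bar>k\<bar>)) summable_on UNIV"
proof (rule nonneg_bdd_above_summable_on)
  have "(\<Sum>k\<in>F. f (nat \<bar>k\<bar>)) \<le> 2 * suminf f" if F: "finite F" for F :: "int set"
  proof -
    have half: "(\<Sum>k\<in>G. f (nat \<bar>k\<bar>)) \<le> suminf f" if "G \<subseteq> F" "inj_on (\<lambda>k. nat \<bar>k\<bar>) G" for G
    proof -
      have "(\<Sum>k\<in>G. f (nat \<bar>k\<bar>)) = sum f ((\<lambda>k. nat \<bar>k\<bar>) ` G)"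
        using that(2) by (simp add: sum.reindex)
      also have "\<dots> \<le> suminf f"
        using f finite_subset[OF that(1) F] by (intro sum_le_suminf) auto
      finally show ?thesis .
    qed
    have "(\<Sum>k\<in>F. f (nat \<bar>k\<bar>)) = (\<Sum>k\<in>F \<inter> {0..}. f (nat \<bar>k\<bar>)) + (\<Sum>k\<in>F - {0..}. f (nat \<bar>k\<bar>))"
      using F by (rule sum.Int_Diff)
    also have "\<dots> \<le> suminf f + suminf f"
      by (intro add_mono half) (auto simp: inj_on_def)
    finally show ?thesis by simp
  qed
  then show "bdd_above (sum (\<lambda>k. f (nat \<bar>k\<bar>)) ` {F. F \<subseteq> UNIV \<and> finite F})"
    by (intro bdd_aboveI[of _ "2 * suminf f"]) auto
qed (use f in simp)

text \<open>The ratio \<open>q\<close> and \<open>1 / q\<close> are the roots of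
  \<open>q + 1 / q = 2 - h^2 w\<close>, and the prefactor is \<open>h^2 / (1 / q - q)\<close>. Using
  two separate principal roots selects the solution with \<open>|q| \<le> 1\<close> for
  \<open>w\<close> in the closed upper half-plane and gives it limits from above.\<close>

definition green :: "real \<Rightarrow> complex \<Rightarrow> int \<Rightarrow> complex" where
  "green h w k =
    (let a = csqrt (of_real (h\<^sup>2) * w / 2 - 2); b = csqrt (of_real (h\<^sup>2) * w / 2)
     in - of_real (h\<^sup>2) / (2 * a * b) * (- ((b - a)\<^sup>2) / 2) ^ nat \<bar>k\<bar>)"

lemma green_recurrence:
  assumes h: "0 < h" and w: "w \<noteq> 0" "of_real (h\<^sup>2) * w \<noteq> 4"
  shows "1 / of_real (h\<^sup>2) * (2 * green h w k - green h w (k - 1) - green h w (k + 1)) - w * green h w k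
    = (if k = 0 then 1 else 0)"
proof -
  define a where "a = csqrt (of_real (h\<^sup>2) * w / 2 - 2)"
  define b where "b = csqrt (of_real (h\<^sup>2) * w / 2)"
  define c where "c = - of_real (h\<^sup>2) / (2 * a * b)"
  define q where "q = - ((b - a)\<^sup>2) / 2"
  define r where "r = - ((b + a)\<^sup>2) / 2"
  have g: "green h w k = c * q ^ nat \<bar>k\<bar>" for k
    by (simp add: green_def Let_def a_def b_def c_def q_def)
  define H where "H = complex_of_real (h\<^sup>2)"
  have H: "H \<noteq> 0" using h by (simp add: H_def)
  have a2: "a\<^sup>2 = H * w / 2 - 2" and b2: "b\<^sup>2 = H * w / 2" by (simp_all add: a_def b_def H_def)
  have "a\<^sup>2 \<noteq> 0" "b\<^sup>2 \<noteq> 0" unfolding a2 b2 using w H by (auto simp: H_def)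
  then have ab: "a \<noteq> 0" "b \<noteq> 0" by auto
  have "q * r = ((b\<^sup>2 - a\<^sup>2) / 2)\<^sup>2" by (simp add: q_def r_def power2_eq_square algebra_simps)
  then have qr: "q * r = 1" by (simp add: a2 b2)
  have "q + r = - (a\<^sup>2 + b\<^sup>2)" by (simp add: q_def r_def power2_eq_square field_simps)
  then have Hw: "H * w = 2 - q - r" by (simp add: a2 b2 algebra_simps)
  have "r - q = - (2 * a * b)" by (simp add: q_def r_def power2_eq_square field_simps)
  then have c: "c * (r - q) = H" using ab by (simp add: c_def H_def)
  \<comment> \<open>Away from \<open>k = 0\<close> the geometric sequence solves the homogeneous
    recurrence because \<open>q r = 1\<close>; at \<open>k = 0\<close> the kink contributes
    \<open>c (r - q) = h^2\<close>.\<close>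
  have "2 * green h w k - green h w (k - 1) - green h w (k + 1) - (2 - q - r) * green h w k
      = H * (if k = 0 then 1 else 0)"
  proof -
    consider "k = 0" | n where "k = int (Suc n)" | n where "k = - int (Suc n)"
      by (metis int_cases not0_implies_Suc of_nat_0 minus_zero)
    then show ?thesis
    proof cases
      case 1
      then show ?thesis by (simp add: g c[symmetric] algebra_simps)
    next
      case 2
      then have "nat \<bar>k\<bar> = Suc n" "nat \<bar>k - 1\<bar> = n" "nat \<bar>k + 1\<bar> = Suc (Suc n)" "k \<noteq> 0" by auto
      moreover have "2 * (c * q ^ Suc n) - c * q ^ n - c * q ^ Suc (Suc n) - (2 - q - r) * (c * q ^ Suc n)
          = c * q ^ n * (q * r - 1)" by (simp add: algebra_simps)
      ultimately show ?thesis by (simp add: g qr)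
    next
      case 3
      then have "nat \<bar>k\<bar> = Suc n" "nat \<bar>k + 1\<bar> = n" "nat \<bar>k - 1\<bar> = Suc (Suc n)" "k \<noteq> 0" by auto
      moreover have "2 * (c * q ^ Suc n) - c * q ^ Suc (Suc n) - c * q ^ n - (2 - q - r) * (c * q ^ Suc n)
          = c * q ^ n * (q * r - 1)" by (simp add: algebra_simps)
      ultimately show ?thesis by (simp add: g qr)
    qed
  qed
  then have "(2 * green h w k - green h w (k - 1) - green h w (k + 1) - H * w * green h w k) / H
      = (if k = 0 then 1 else 0)" using H by (simp add: Hw)
  then show ?thesis unfolding H_def[symmetric] using H by (simp add: field_simps)
qed

lemma csqrt_nonneg: "0 \<le> Re (csqrt z)" "0 \<le> Im z \<Longrightarrow> 0 \<le> Im (csqrt z)"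
  using complex_Re_le_cmod[of z] abs_Re_le_cmod[of z] by (auto simp: sgn_if)

lemma csqrt_pos: "0 < Im z \<Longrightarrow> 0 < Re (csqrt z)"
proof -
  assume z: "0 < Im z"
  have "\<bar>Re z\<bar> < cmod z"
    using z by (simp add: cmod_def real_less_rsqrt)
  then show ?thesis by simp
qed

text \<open>Both principal roots lie in the closed first quadrant, so
  \<open>|b - a| \<le> |b + a|\<close>. The two resulting ratios have product \<open>1\<close> and
  \<open>q\<close> is the smaller one; for \<open>Im u > 0\<close> both real parts are positive and
  the inequality is strict.\<close>

lemma green_ratio:
  fixes u :: complex
  assumes u: "0 \<le> Im u"
  defines "q \<equiv> - ((csqrt u - csqrt (u - 2))\<^sup>2) / 2"
  shows "cmod q \<le> 1" and "0 < Im u \<Longrightarrow> cmod q < 1"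
proof -
  define a where "a = csqrt (u - 2)"
  define b where "b = csqrt u"
  define r where "r = - ((b + a)\<^sup>2) / 2"
  have q: "q = - ((b - a)\<^sup>2) / 2" by (simp add: q_def a_def b_def)
  have "q * r = ((b\<^sup>2 - a\<^sup>2) / 2)\<^sup>2" by (simp add: q r_def power2_eq_square algebra_simps)
  then have "q * r = 1" by (simp add: a_def b_def)
  then have qr: "cmod q * cmod r = 1" by (metis norm_mult norm_one)
  have diff: "(cmod (b + a))\<^sup>2 - (cmod (b - a))\<^sup>2 = 4 * (Re a * Re b + Im a * Im b)"
    unfolding cmod_power2 by (simp add: power2_eq_square algebra_simps)
  have nn: "0 \<le> Re a" "0 \<le> Re b" "0 \<le> Im a" "0 \<le> Im b"
    using u unfolding a_def b_def by (auto intro!: csqrt_nonneg simp del: csqrt.simps)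
  have n: "cmod q = (cmod (b - a))\<^sup>2 / 2" "cmod r = (cmod (b + a))\<^sup>2 / 2"
    by (simp_all add: q r_def norm_divide norm_power)
  have "cmod q \<le> cmod r" using diff nn unfolding n by (smt (verit) mult_nonneg_nonneg divide_right_mono)
  then have "cmod q * cmod q \<le> 1" using qr mult_left_mono[of "cmod q" "cmod r" "cmod q"] by simp
  then show "cmod q \<le> 1" using abs_square_le_1[of "cmod q"] by (simp add: power2_eq_square)
  assume "0 < Im u"
  then have "0 < Re a" "0 < Re b" unfolding a_def b_def by (auto intro!: csqrt_pos simp del: csqrt.simps)
  then have "0 < Re a * Re b" "0 \<le> Im a * Im b" using nn by auto
  then have "cmod q < cmod r" using diff unfolding n by simp
  moreover have "cmod q \<noteq> 0" using qr by auto
  ultimately have "cmod q * cmod q < 1" using qr mult_strict_left_mono[of "cmod q" "cmod r" "cmod q"] by simp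
  then show "cmod q < 1" using abs_square_less_1[of "cmod q"] by (simp add: power2_eq_square)
qed

lemma summable_green:
  assumes "0 < h" "0 < Im w"
  shows "(\<lambda>k. cmod (green h w k)) summable_on UNIV"
proof -
  define u where "u = of_real (h\<^sup>2) * w / 2"
  define q where "q = - ((csqrt u - csqrt (u - 2))\<^sup>2) / 2"
  have "0 < Im u" using assms by (simp add: u_def)
  then have "cmod q < 1" using green_ratio(2)[of u] by (simp add: q_def)
  then have "summable (\<lambda>n. cmod q ^ n)" by (intro summable_geometric) simp
  then have "summable (\<lambda>n. cmod (- of_real (h\<^sup>2) / (2 * csqrt (u - 2) * csqrt u)) * cmod q ^ n)"
    by (rule summable_mult)
  from summable_on_int_abs[OF this, unfolded u_def q_def]
  show ?thesis unfolding green_def Let_def u_def q_def norm_mult norm_power by simp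
qed

text \<open>A bound uniform in the site and in the imaginary part of the energy:
  \<open>|q| \<le> 1\<close>, and for a fixed real part the moduli of the two roots are smallest on
  the real axis.\<close>

definition green_bound :: "real \<Rightarrow> real \<Rightarrow> real" where
  "green_bound h y = h\<^sup>2 / (2 * sqrt \<bar>h\<^sup>2 * y / 2 - 2\<bar> * sqrt \<bar>h\<^sup>2 * y / 2\<bar>)"

lemma cmod_green_le:
  assumes h: "0 < h" and y: "y \<noteq> 0" "h\<^sup>2 * y \<noteq> 4" and e: "0 \<le> e"
  shows "cmod (green h (Complex y e) k) \<le> green_bound h y"
proof -
  define u where "u = of_real (h\<^sup>2) * Complex y e / 2"
  define q where "q = - ((csqrt u - csqrt (u - 2))\<^sup>2) / 2"
  have u: "Re u = h\<^sup>2 * y / 2" "Im u = h\<^sup>2 * e / 2" by (simp_all add: u_def)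
  have "cmod q \<le> 1" using green_ratio(1)[of u] e by (simp add: q_def u)
  then have q: "cmod q ^ n \<le> 1" for n by (simp add: power_le_one)
  have 1: "sqrt \<bar>h\<^sup>2 * y / 2 - 2\<bar> \<le> cmod (csqrt (u - 2))"
    using abs_Re_le_cmod[of "u - 2"] u by (simp add: norm_csqrt)
  have 2: "sqrt \<bar>h\<^sup>2 * y / 2\<bar> \<le> cmod (csqrt u)"
    using abs_Re_le_cmod[of u] u by (simp add: norm_csqrt)
  have pos: "0 < sqrt \<bar>h\<^sup>2 * y / 2 - 2\<bar>" "0 < sqrt \<bar>h\<^sup>2 * y / 2\<bar>" using h y by auto
  have "cmod (green h (Complex y e) k)
      = h\<^sup>2 / (2 * cmod (csqrt (u - 2)) * cmod (csqrt u)) * cmod q ^ nat \<bar>k\<bar>"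
    by (simp add: green_def Let_def norm_mult norm_divide norm_power q_def u_def del: csqrt.simps)
  also have "\<dots> \<le> h\<^sup>2 / (2 * cmod (csqrt (u - 2)) * cmod (csqrt u)) * 1"
    by (intro mult_left_mono q) simp
  also have "\<dots> \<le> green_bound h y"
    unfolding green_bound_def mult_1_right using 1 2 pos
    by (intro divide_left_mono mult_mono mult_pos_pos) (auto intro: less_le_trans)
  finally show ?thesis .
qed

text \<open>The cut of the principal root is met at real energies below the upper band edge. From
  above the root is nevertheless continuous: for \<open>Im z \<ge> 0\<close> the sign in its
  imaginary part is constant, and the value on the cut is the limit from above.\<close>

lemma tendsto_csqrt_vertical:
  assumes "0 < c"
  shows "((\<lambda>e. csqrt (Complex x (c * e))) \<longlongrightarrow> csqrt (Complex x 0)) (at_right 0)"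
proof -
  define f where "f e = Complex (sqrt ((cmod (Complex x (c * e)) + x) / 2)) (sqrt ((cmod (Complex x (c * e)) - x) / 2))" for e
  have eq: "csqrt (Complex x (c * e)) = f e" if "0 \<le> e" for e
    using that assms by (auto simp: f_def complex_eq_iff sgn_if mult_le_0_iff)
  have "(f \<longlongrightarrow> f 0) (at_right 0)"
    unfolding f_def complex_norm by (intro tendsto_intros) simp_all
  moreover have "\<forall>\<^sub>F e in at_right 0. f e = csqrt (Complex x (c * e))"
    using eventually_at_right_less[of 0] by eventually_elim (simp add: eq)
  ultimately show ?thesis using eq[of 0] by (simp add: tendsto_cong)
qed

lemma tendsto_green:
  assumes h: "0 < h" and y: "y \<noteq> 0" "h\<^sup>2 * y \<noteq> 4"
  shows "((\<lambda>e. green h (Complex y e) k) \<longlongrightarrow> green h (Complex y 0) k) (at_right 0)"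
proof -
  have hp: "0 < h\<^sup>2 / 2" using h by simp
  have u: "of_real (h\<^sup>2) * Complex y e / 2 = Complex (h\<^sup>2 * y / 2) (h\<^sup>2 / 2 * e)"
    "of_real (h\<^sup>2) * Complex y e / 2 - 2 = Complex (h\<^sup>2 * y / 2 - 2) (h\<^sup>2 / 2 * e)" for e
    by (simp_all add: complex_eq_iff)
  have nz: "csqrt (Complex (h\<^sup>2 * y / 2 - 2) 0) \<noteq> 0" "csqrt (Complex (h\<^sup>2 * y / 2) 0) \<noteq> 0"
    unfolding csqrt_eq_0 using h y by (simp_all add: complex_eq_iff)
  have "((\<lambda>e. green h (Complex y e) k) \<longlongrightarrow>
      - of_real (h\<^sup>2) / (2 * csqrt (Complex (h\<^sup>2 * y / 2 - 2) 0) * csqrt (Complex (h\<^sup>2 * y / 2) 0)) *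
      (- ((csqrt (Complex (h\<^sup>2 * y / 2) 0) - csqrt (Complex (h\<^sup>2 * y / 2 - 2) 0))\<^sup>2) / 2) ^ nat \<bar>k\<bar>) (at_right 0)"
    unfolding green_def Let_def unfolding u(2) unfolding u(1)
    by (intro tendsto_intros tendsto_csqrt_vertical hp) (use nz in simp_all)
  then show ?thesis unfolding green_def Let_def unfolding u(2) unfolding u(1) by simp
qed

lemma continuous_on_green_bound:
  assumes "\<And>x. x \<in> S \<Longrightarrow> x \<noteq> m \<and> h\<^sup>2 * (x - m) \<noteq> 4" "0 < h"
  shows "continuous_on S (\<lambda>x. green_bound h (x - m))"
  unfolding green_bound_def
proof (intro continuous_intros ballI)
  fix x assume "x \<in> S"
  then show "2 * sqrt \<bar>h\<^sup>2 * (x - m) / 2 - 2\<bar> * sqrt \<bar>h\<^sup>2 * (x - m) / 2\<bar> \<noteq> 0"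
    using assms(1)[of x] assms(2) by simp
qed simp_all

subsection \<open>Spectral decomposition of the fiber operator\<close>

lemma orth_proj_eqI:
  assumes C: "closed C" "csubspace (C :: 'a::complex_hilbert set)"
    and y: "y \<in> C" "\<And>w. w \<in> C \<Longrightarrow> cinner w (x - y) = 0"
  shows "orth_proj C x = y"
proof -
  note P = orth_proj_works[OF C]
  have d: "orth_proj C x - y \<in> C" using P(1) y(1) C(2) by (simp add: cvec.subspace_diff)
  have "cinner (orth_proj C x - y) (orth_proj C x - y) = 0"
    using P(2)[OF d, of x] y(2)[OF d] by (simp add: cinner.diff_right)
  then show ?thesis by (simp add: cinner_self)
qed

lemma selfadjoint_orth_proj:
  assumes C: "closed C" "csubspace (C :: 'a::complex_hilbert set)"
  shows "selfadjoint (orth_proj C)" and "norm (orth_proj C) \<le> 1"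
proof -
  note P = orth_proj_works[OF C]
  have 1: "cinner (orth_proj C x) y = cinner (orth_proj C x) (orth_proj C y)" for x y
    using P(2)[OF P(1), of x y] by (simp add: cinner.diff_right)
  then have 2: "cinner y (orth_proj C x) = cinner (orth_proj C y) (orth_proj C x)" for x y
    by (metis cinner_commute)
  show "selfadjoint (orth_proj C)"
    unfolding selfadjoint_def using 1 2 by metis
  show "norm (orth_proj C) \<le> 1"
  proof (rule norm_blinfun_bound)
    fix x
    have "(norm (orth_proj C x))\<^sup>2 = inner (orth_proj C x) x"
      by (simp only: power2_norm_eq_inner inner_eq_Re_cinner 1[of x x])
    also have "\<dots> \<le> norm (orth_proj C x) * norm x" by (rule norm_cauchy_schwarz)
    finally have "norm (orth_proj C x) * norm (orth_proj C x) \<le> norm (orth_proj C x) * norm x"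
      by (simp only: power2_eq_square)
    then show "norm (orth_proj C x) \<le> 1 * norm x"
      by (cases "norm (orth_proj C x) = 0") (auto dest: mult_left_le_imp_le)
  qed simp
qed

text \<open>Distinct eigenspaces are orthogonal, so the components of the algebraic decomposition
  are orthogonal projections. Both alternatives for \<open>Q\<close> receive the same format, which
  removes the case distinction from what follows.\<close>

lemma ex_spectral_family:
  fixes Q :: "'g::complex_hilbert \<Rightarrow>\<^sub>L 'g"
  assumes Q: "selfadjoint Q" "Q = 0 \<or> (Q \<noteq> 0 \<and> eigen_decomposition Q d \<mu>)"
  obtains I :: "nat set" and m :: "nat \<Rightarrow> real" and P :: "nat \<Rightarrow> 'g \<Rightarrow>\<^sub>L 'g"
  where "finite I" "\<And>s. s \<in> I \<Longrightarrow> selfadjoint (P s)" "\<And>s. s \<in> I \<Longrightarrow> norm (P s) \<le> 1"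
    "\<And>s x. s \<in> I \<Longrightarrow> Q (P s x) = m s *\<^sub>R P s x" "\<And>x. (\<Sum>s\<in>I. P s x) = x"
    "threshold_set h Q d \<mu> = (\<Union>s\<in>I. {m s, m s + 4 / h\<^sup>2})"
proof (cases "Q = 0")
  case True
  show thesis
  \<comment> \<open>For \<open>Q = 0\<close> the whole fiber is treated as one eigenspace with
    eigenvalue \<open>0\<close>, which reproduces the threshold set.\<close>
  proof (rule that[of "{0}" "\<lambda>_. id_blinfun" "\<lambda>_. 0"])
    show "norm (id_blinfun :: 'g \<Rightarrow>\<^sub>L 'g) \<le> 1" by (rule norm_blinfun_id_le)
  qed (simp_all add: True threshold_set_def selfadjoint_def)
next
  case False
  then have ed: "inj_on \<mu> {1..d}"
      "\<And>x. \<exists>y. y \<in> (\<Pi>\<^sub>E s\<in>{1..d}. eigenspace Q (\<mu> s)) \<and> x = (\<Sum>s=1..d. y s)"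
    using Q(2) unfolding eigen_decomposition_def by blast+
  have sub: "csubspace (eigenspace Q \<nu>)" for \<nu>
    by (rule eigenspace_csubspace[OF selfadjoint_clinear[OF Q(1)]])
  have closed: "closed (eigenspace Q \<nu>)" for \<nu>
    unfolding eigenspace_def by (intro closed_Collect_eq continuous_intros)
  let ?P = "\<lambda>s. orth_proj (eigenspace Q (\<mu> s))"
  have sum: "(\<Sum>s=1..d. ?P s x) = x" for x
  proof -
    obtain y where y: "y \<in> (\<Pi>\<^sub>E s\<in>{1..d}. eigenspace Q (\<mu> s))" "x = (\<Sum>s=1..d. y s)"
      using ed(2)[of x] by blast
    have "?P s x = y s" if s: "s \<in> {1..d}" for s
    proof (rule orth_proj_eqI[OF closed sub])
      show "y s \<in> eigenspace Q (\<mu> s)" using y(1) s by (rule PiE_mem)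
      fix w assume w: "w \<in> eigenspace Q (\<mu> s)"
      have "x - y s = (\<Sum>t\<in>{1..d} - {s}. y t)" using s by (simp add: y(2) sum_diff1)
      moreover have "cinner w (y t) = 0" if t: "t \<in> {1..d} - {s}" for t
      proof (rule eigenspace_orthogonal[OF Q(1) w])
        show "y t \<in> eigenspace Q (\<mu> t)" by (rule PiE_mem[OF y(1)]) (use t in blast)
        show "\<mu> s \<noteq> \<mu> t" using ed(1) s t by (auto dest: inj_onD)
      qed
      ultimately show "cinner w (x - y s) = 0" by (simp add: cinner.sum_right)
    qed
    then show ?thesis using y(2) by simp
  qed
  show thesis
  proof (rule that[of "{1..d}" ?P \<mu>])
    show "Q (?P s x) = \<mu> s *\<^sub>R ?P s x" for s x
      using orth_proj_works(1)[OF closed sub, of "\<mu> s" x] unfolding eigenspace_def by blast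
    show "threshold_set h Q d \<mu> = (\<Union>s\<in>{1..d}. {\<mu> s, \<mu> s + 4 / h\<^sup>2})"
      using False by (simp add: threshold_set_def)
  qed (simp_all only: selfadjoint_orth_proj[OF closed sub] sum finite_atLeastAtMost)
qed

section \<open>The limiting absorption principle\<close>

lemma norm_apply_sq_le_hs_sq:
  assumes A: "clinear_op A"
  shows "ennreal ((norm (blinfun_apply A x))\<^sup>2) \<le> ennreal ((norm x)\<^sup>2) * hs_sq A"
proof (cases "x = 0")
  case False
  define y where "y = inverse (norm x) *\<^sub>R x"
  have y: "norm y = 1" and x: "x = norm x *\<^sub>R y" using False by (simp_all add: y_def)
  have "ennreal ((norm (A x))\<^sup>2) = ennreal ((norm x)\<^sup>2) * ennreal ((norm (A y))\<^sup>2)"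
    by (subst x) (simp add: blinfun.scaleR_right power_mult_distrib ennreal_mult)
  also have "\<dots> \<le> ennreal ((norm x)\<^sup>2) * hs_sq A"
    using sum_orthonormal_le_hs_sq[OF A orthonormal_singleton[OF y]] by (intro mult_left_mono) simp_all
  finally show ?thesis .
qed (simp add: blinfun.zero_right)

lemma tendsto_apply_of_hs_sq:
  assumes A: "\<And>e. clinear_op (A e - B)" and lim: "((\<lambda>e. hs_sq (A e - B)) \<longlongrightarrow> 0) F"
  shows "((\<lambda>e. blinfun_apply (A e) x) \<longlongrightarrow> blinfun_apply B x) F"
proof -
  have "((\<lambda>e. ennreal ((norm x)\<^sup>2) * hs_sq (A e - B)) \<longlongrightarrow> ennreal ((norm x)\<^sup>2) * 0) F"
    by (intro ennreal_tendsto_cmult lim) simp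
  then have lim': "((\<lambda>e. ennreal ((norm x)\<^sup>2) * hs_sq (A e - B)) \<longlongrightarrow> 0) F" by simp
  have "((\<lambda>e. ennreal ((norm ((A e - B) x))\<^sup>2)) \<longlongrightarrow> 0) F"
    by (rule tendsto_sandwich[OF _ _ tendsto_const lim']) (auto intro!: always_eventually norm_apply_sq_le_hs_sq A)
  then have "((\<lambda>e. (norm ((A e - B) x))\<^sup>2) \<longlongrightarrow> 0) F"
    by (intro tendsto_ennrealD) simp_all
  then have "((\<lambda>e. sqrt ((norm ((A e - B) x))\<^sup>2)) \<longlongrightarrow> sqrt 0) F" by (rule tendsto_real_sqrt)
  then have "((\<lambda>e. norm (A e x - B x)) \<longlongrightarrow> 0) F" by (simp add: blinfun.diff_left)
  then show ?thesis by (simp only: tendsto_norm_zero_iff Lim_null[symmetric])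
qed

text \<open>Two limits in the Hilbert-Schmidt sense differ by an operator of Hilbert-Schmidt norm
  zero, so the choice in \<open>boundary_value\<close> can only return \<open>L\<close>.\<close>

lemma boundary_value_eqI:
  assumes L: "hilbert_schmidt L"
    and lim: "((\<lambda>\<epsilon>. hs_sq (sandwiched_resolvent M H (Complex x \<epsilon>) - L)) \<longlongrightarrow> 0) (at_right 0)"
  shows "boundary_value M H x = L"
  unfolding boundary_value_def
proof (rule some_equality)
  let ?T = "\<lambda>\<epsilon>. sandwiched_resolvent M H (Complex x \<epsilon>)"
  fix L' assume L': "hilbert_schmidt L' \<and> ((\<lambda>\<epsilon>. hs_sq (?T \<epsilon> - L')) \<longlongrightarrow> 0) (at_right 0)"
  have "hs_sq (L' - L) \<le> 2 * (hs_sq (?T \<epsilon> - L) + hs_sq (?T \<epsilon> - L'))" for \<epsilon>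
    using hs_sq_add_le[of "?T \<epsilon> - L" "- (?T \<epsilon> - L')"] by (simp add: hs_sq_uminus[of "?T \<epsilon> - L'"] del: minus_diff_eq)
  moreover have "((\<lambda>\<epsilon>. 2 * (hs_sq (?T \<epsilon> - L) + hs_sq (?T \<epsilon> - L'))) \<longlongrightarrow> 2 * (0 + 0)) (at_right 0)"
    using L' by (intro ennreal_tendsto_cmult tendsto_add lim) simp_all
  ultimately have "hs_sq (L' - L) \<le> 2 * (0 + 0)"
    by (intro tendsto_lowerbound[of _ "2 * (0 + 0)" "at_right (0::real)"]) auto
  then have "hs_sq (L' - L) = 0" by simp
  moreover have "clinear_op (L' - L)"
    using L L' by (intro clinear_op_diff) (auto simp: hilbert_schmidt_def)
  ultimately show "L' = L" using eq_0_of_hs_sq by force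
qed (use L lim in simp)

lemma clinear_op_re_im_op:
  assumes "clinear_op T"
  shows "clinear_op (re_op T)" "clinear_op (im_op T)"
  using selfadjoint_re_op[OF assms] selfadjoint_im_op[OF assms] by (auto intro: selfadjoint_clinear)

text \<open>The constant is crude: the scalar \<open>1 / 2\<close> is estimated by \<open>1\<close>,
  and \<open>T\<close> and its adjoint contribute \<open>2\<close> each.\<close>

lemma hs_sq_re_op_le:
  assumes T: "clinear_op T"
  shows "hs_sq (re_op T) \<le> 4 * hs_sq T"
proof -
  have "norm (scalar_op (1 / 2) :: 'a \<Rightarrow>\<^sub>L 'a) \<le> 1"
    by (rule norm_blinfun_bound) (simp_all add: norm_scaleC)
  then have 1: "ennreal ((norm (scalar_op (1 / 2) :: 'a \<Rightarrow>\<^sub>L 'a))\<^sup>2) \<le> 1"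
    by (simp add: power_le_one)
  have "hs_sq (re_op T) \<le> ennreal ((norm (scalar_op (1 / 2) :: 'a \<Rightarrow>\<^sub>L 'a))\<^sup>2) * hs_sq (T + adj T)"
    unfolding re_op_def by (rule hs_sq_compose_left)
  also have "\<dots> \<le> 1 * (2 * (hs_sq T + hs_sq (adj T)))"
    by (intro mult_mono 1 hs_sq_add_le) simp_all
  also have "\<dots> = 4 * hs_sq T" by (simp add: hs_sq_adj[OF T] mult_2[symmetric] mult.assoc[symmetric])
  finally show ?thesis .
qed

text \<open>Here \<open>p\<close> stands for \<psi>, \<open>S\<close> for the root of
  \<open>W\<close>, and \<open>P s\<close>, \<open>m s\<close> for the spectral resolution of
  \<open>Q\<close>. That \<open>p\<close> is real makes multiplication by it symmetric.\<close>

locale lattice_hamiltonian =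
  fixes h :: real and Q K :: "'g::complex_hilbert \<Rightarrow>\<^sub>L 'g"
    and I :: "nat set" and m :: "nat \<Rightarrow> real" and P :: "nat \<Rightarrow> 'g \<Rightarrow>\<^sub>L 'g"
    and p :: "complex ell2" and S :: "'g ell2 \<Rightarrow>\<^sub>L 'g ell2"
  assumes h: "0 < h" and Q: "selfadjoint Q" and I: "finite I"
    and P: "\<And>s. s \<in> I \<Longrightarrow> selfadjoint (P s)" "\<And>s. s \<in> I \<Longrightarrow> norm (P s) \<le> 1"
    and QP: "\<And>s x. s \<in> I \<Longrightarrow> Q (P s x) = m s *\<^sub>R P s x"
    and sum_P: "\<And>x. (\<Sum>s\<in>I. P s x) = x"
    and K: "hilbert_schmidt K"
    and p_real: "\<And>n. cnj (ell2_apply p n) = ell2_apply p n"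
    and S: "selfadjoint S"
begin

lemma clinear: "clinear_op Q" "clinear_op K" "clinear_op (adj K)" "clinear_op S"
    "s \<in> I \<Longrightarrow> clinear_op (P s)"
  using Q K S P(1) by (auto simp: selfadjoint_clinear hilbert_schmidt_def clinear_op_adj)

definition J :: "nat \<Rightarrow> 'g \<Rightarrow>\<^sub>L 'g" where "J s = K o\<^sub>L P s o\<^sub>L adj K"

lemma clinear_J: "s \<in> I \<Longrightarrow> clinear_op (J s)"
  unfolding J_def by (intro clinear_op_compose clinear)

lemma hs_J: "s \<in> I \<Longrightarrow> hs_sq (J s) < \<infinity>"
proof -
  assume s: "s \<in> I"
  have "hs_sq (J s) \<le> ennreal ((norm (K o\<^sub>L P s))\<^sup>2) * hs_sq (adj K)"
    unfolding J_def by (rule hs_sq_compose_left)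
  also have "\<dots> < \<infinity>" using K by (simp add: hs_sq_adj hilbert_schmidt_def ennreal_mult_less_top)
  finally show ?thesis .
qed

text \<open>The factor of \<open>M\<close> that carries all the decay.\<close>

definition D :: "'g ell2 \<Rightarrow>\<^sub>L 'g ell2" where "D = tensor_op (mult_op (ell2_apply p)) K"

definition M :: "'g ell2 \<Rightarrow>\<^sub>L 'g ell2" where "M = S o\<^sub>L D"

lemma bounded_p: "bounded (range (ell2_apply p))"
  unfolding bounded_iff using norm_ell2_apply_le by blast

lemma adj_D: "adj D = tensor_op (mult_op (ell2_apply p)) (adj K)"
  unfolding D_def by (rule adj_tensor_mult_op[OF bounded_p p_real clinear(2)])

lemma clinear_D: "clinear_op D"
  unfolding D_def by (rule clinear_op_tensor_mult_op[OF bounded_p clinear(2)])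

lemma adj_M: "adj M = adj D o\<^sub>L S"
  unfolding M_def by (simp add: adj_compose clinear clinear_D adj_selfadjoint S)

text \<open>On the range of \<open>P s\<close> the Hamiltonian is the Laplacian shifted by
  \<open>m s\<close>, so the Green function is taken at \<open>z - m s\<close>.\<close>

definition resolvent :: "complex \<Rightarrow> 'g ell2 \<Rightarrow>\<^sub>L 'g ell2" where
  "resolvent z = (\<Sum>s\<in>I. conv_op (green h (z - m s)) o\<^sub>L tensor_op (mult_op (\<lambda>_. 1)) (P s))"

lemma fiber_apply: "s \<in> I \<Longrightarrow> ell2_apply (tensor_op (mult_op (\<lambda>_. 1)) (P s) \<phi>) n = P s (ell2_apply \<phi> n)"
  by (subst tensor_mult_op_apply) (simp_all add: clinear scaleC_one)

lemma resolvent_component: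
  assumes "0 < Im z" "s \<in> I"
  shows "((\<lambda>k. green h (z - m s) k *\<^sub>C P s (ell2_apply \<phi> (n + k))) has_sum
    ell2_apply (conv_op (green h (z - m s)) (tensor_op (mult_op (\<lambda>_. 1)) (P s) \<phi>)) n) UNIV"
  using conv_op_has_sum[OF summable_green[OF h], of "z - m s" "tensor_op (mult_op (\<lambda>_. 1)) (P s) \<phi>" n] assms
  by (simp add: fiber_apply)

lemma resolvent_apply:
  "ell2_apply (resolvent z \<phi>) n
    = (\<Sum>s\<in>I. ell2_apply (conv_op (green h (z - m s)) (tensor_op (mult_op (\<lambda>_. 1)) (P s) \<phi>)) n)"
  by (simp add: resolvent_def blinfun.sum_left sum_ell2_apply)

lemma resolvent_works:
  assumes z: "0 < Im z"
  shows "H_op h Q (resolvent z \<phi>) - z *\<^sub>C resolvent z \<phi> = \<phi>"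
proof (rule ell2_eqI)
  fix n
  define u where "u s = ell2_apply (conv_op (green h (z - m s)) (tensor_op (mult_op (\<lambda>_. 1)) (P s) \<phi>))" for s
  define r where "r = 1 / complex_of_real (h\<^sup>2)"
  have Ru: "ell2_apply (resolvent z \<phi>) i = (\<Sum>s\<in>I. u s i)" for i
    by (simp add: resolvent_apply u_def)
  \<comment> \<open>\<open>Q\<close> is continuous and acts as \<open>m s\<close> on each term of
    the convolution series, hence on its sum.\<close>
  have Qu: "Q (u s n) = complex_of_real (m s) *\<^sub>C u s n" if s: "s \<in> I" for s
  proof (rule has_sum_unique)
    note hs = resolvent_component[OF z s, of \<phi> n, folded u_def]
    show "((\<lambda>k. complex_of_real (m s) *\<^sub>C green h (z - m s) k *\<^sub>C P s (ell2_apply \<phi> (n + k)))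
        has_sum complex_of_real (m s) *\<^sub>C u s n) UNIV"
      by (rule has_sum_bounded_linear[OF scaleC.bounded_linear_right hs])
    have "Q (green h (z - m s) k *\<^sub>C P s y)
        = complex_of_real (m s) *\<^sub>C green h (z - m s) k *\<^sub>C P s y" for k y
      using clinear(1) QP[OF s, of y] by (simp add: clinear_op_def scaleR_scaleC scaleC_scaleC mult.commute)
    then show "((\<lambda>k. complex_of_real (m s) *\<^sub>C green h (z - m s) k *\<^sub>C P s (ell2_apply \<phi> (n + k)))
        has_sum Q (u s n)) UNIV"
      using has_sum_bounded_linear[OF blinfun.bounded_linear_right hs, of Q] by simp
  qed
  have inv: "r *\<^sub>C (2 *\<^sub>C u s n - u s (n + 1) - u s (n - 1)) - (z - m s) *\<^sub>C u s n = P s (ell2_apply \<phi> n)"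
    if s: "s \<in> I" for s
  proof -
    have im: "0 < Im (z - m s)" using z by simp
    then have "Im (complex_of_real (h\<^sup>2) * (z - m s)) \<noteq> 0" using h by simp
    then have "complex_of_real (h\<^sup>2) * (z - m s) \<noteq> 4" by (metis complex_Im_numeral)
    moreover have "z - m s \<noteq> 0" using im by auto
    ultimately show ?thesis
      unfolding u_def r_def
      by (subst conv_op_inverts[OF summable_green[OF h im] green_recurrence[OF h]])
        (simp_all add: fiber_apply s)
  qed
  have sR: "(1 / h\<^sup>2) *\<^sub>R x = r *\<^sub>C x" "2 *\<^sub>R x = 2 *\<^sub>C x" for x :: 'g
    by (simp_all add: r_def scaleR_scaleC)
  have "ell2_apply (H_op h Q (resolvent z \<phi>) - z *\<^sub>C resolvent z \<phi>) n
      = r *\<^sub>C (2 *\<^sub>C (\<Sum>s\<in>I. u s n) - (\<Sum>s\<in>I. u s (n + 1)) - (\<Sum>s\<in>I. u s (n - 1)))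
        + (\<Sum>s\<in>I. Q (u s n)) - z *\<^sub>C (\<Sum>s\<in>I. u s n)"
    by (simp only: minus_ell2.rep_eq scaleC_ell2.rep_eq H_op_apply[OF clinear(1)] Ru sR blinfun.sum_right)
  also have "\<dots> = (\<Sum>s\<in>I. r *\<^sub>C (2 *\<^sub>C u s n - u s (n + 1) - u s (n - 1)) + Q (u s n) - z *\<^sub>C u s n)"
    by (simp only: scaleC.sum_right scaleC.diff_right sum_subtractf sum.distrib)
  also have "\<dots> = (\<Sum>s\<in>I. P s (ell2_apply \<phi> n))"
  proof (rule sum.cong[OF refl])
    fix s assume s: "s \<in> I"
    show "r *\<^sub>C (2 *\<^sub>C u s n - u s (n + 1) - u s (n - 1)) + Q (u s n) - z *\<^sub>C u s n = P s (ell2_apply \<phi> n)"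
      unfolding Qu[OF s] inv[OF s, symmetric] scaleC.diff_left by simp
  qed
  also have "\<dots> = ell2_apply \<phi> n" by (rule sum_P)
  finally show "ell2_apply (H_op h Q (resolvent z \<phi>) - z *\<^sub>C resolvent z \<phi>) n = ell2_apply \<phi> n" .
qed

definition regular :: "real \<Rightarrow> bool" where
  "regular x \<longleftrightarrow> (\<forall>s\<in>I. x - m s \<noteq> 0 \<and> h\<^sup>2 * (x - m s) \<noteq> 4)"

text \<open>For \<open>\<epsilon> > 0\<close> this is \<open>D (H\<^sub>Q - x - i\<epsilon>)\<^sup>-\<^sup>1 D\<^sup>*\<close>; the formula also makes sense for \<open>\<epsilon> = 0\<close>.\<close>

definition N :: "real \<Rightarrow> real \<Rightarrow> 'g ell2 \<Rightarrow>\<^sub>L 'g ell2" where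
  "N x \<epsilon> = (\<Sum>s\<in>I. kernel_op p (green h (Complex (x - m s) \<epsilon>)) (J s))"

lemma green_le:
  "regular x \<Longrightarrow> s \<in> I \<Longrightarrow> 0 \<le> \<epsilon> \<Longrightarrow> cmod (green h (Complex (x - m s) \<epsilon>) k) \<le> green_bound h (x - m s)"
  using cmod_green_le[OF h] by (simp add: regular_def)

lemma clinear_N: "regular x \<Longrightarrow> 0 \<le> \<epsilon> \<Longrightarrow> clinear_op (N x \<epsilon>)"
  unfolding N_def by (intro clinear_op_sum clinear_op_kernel_op[OF green_le] clinear_J)

text \<open>The bounded complex-linear map \<open>K\<close> passes through the Green series, and the
  weights in \<open>D\<close> and its adjoint turn the convolution into a kernel operator.\<close>

lemma N_eq:
  assumes x: "regular x" and e: "0 < \<epsilon>"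
  shows "D o\<^sub>L resolvent (Complex x \<epsilon>) o\<^sub>L adj D = N x \<epsilon>"
proof (intro blinfun_eqI ell2_eqI)
  fix \<phi> n
  let ?z = "Complex x \<epsilon>"
  have z: "0 < Im ?z" "?z - m s = Complex (x - m s) \<epsilon>" for s using e by (simp_all add: complex_eq_iff)
  define u where "u s = ell2_apply (conv_op (green h (?z - m s)) (tensor_op (mult_op (\<lambda>_. 1)) (P s) (adj D \<phi>))) n" for s
  have Ku: "ell2_apply p n *\<^sub>C K (u s) = ell2_apply (kernel_op p (green h (Complex (x - m s) \<epsilon>)) (J s) \<phi>) n"
    if s: "s \<in> I" for s
  proof -
    note hs = resolvent_component[OF z(1) s, of "adj D \<phi>" n, folded u_def]
    have D: "ell2_apply (adj D \<phi>) i = ell2_apply p i *\<^sub>C adj K (ell2_apply \<phi> i)" for i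
      by (simp add: adj_D tensor_mult_op_apply bounded_p clinear)
    have "K (green h (?z - m s) k *\<^sub>C P s (ell2_apply (adj D \<phi>) i))
        = (green h (Complex (x - m s) \<epsilon>) k * ell2_apply p i) *\<^sub>C J s (ell2_apply \<phi> i)" for k i
      using clinear(2) clinear(5)[OF s]
      by (simp add: z(2) D clinear_op_def J_def scaleC_scaleC)
    then have "((\<lambda>k. (green h (Complex (x - m s) \<epsilon>) k * ell2_apply p (n + k)) *\<^sub>C J s (ell2_apply \<phi> (n + k)))
        has_sum K (u s)) UNIV"
      using has_sum_bounded_linear[OF blinfun.bounded_linear_right hs, of K] by simp
    then show ?thesis
      using kernel_op_apply[where a = "green h (Complex (x - m s) \<epsilon>)",
          OF green_le[OF x s less_imp_le[OF e]], of p "J s" \<phi> n] by (simp add: infsumI)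
  qed
  have "ell2_apply ((D o\<^sub>L resolvent ?z o\<^sub>L adj D) \<phi>) n = ell2_apply p n *\<^sub>C K (\<Sum>s\<in>I. u s)"
    unfolding D_def blinfun_apply_blinfun_compose tensor_mult_op_apply[OF bounded_p clinear(2)] resolvent_apply
    by (simp only: u_def D_def)
  also have "\<dots> = (\<Sum>s\<in>I. ell2_apply p n *\<^sub>C K (u s))"
    by (simp only: blinfun.sum_right scaleC.sum_right)
  also have "\<dots> = ell2_apply (N x \<epsilon> \<phi>) n"
    by (simp add: Ku N_def blinfun.sum_left sum_ell2_apply)
  finally show "ell2_apply ((D o\<^sub>L resolvent ?z o\<^sub>L adj D) \<phi>) n = ell2_apply (N x \<epsilon> \<phi>) n" .
qed

lemma sandwiched_resolvent_eq:
  assumes x: "regular x" and e: "0 < \<epsilon>"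
  shows "sandwiched_resolvent M (H_op h Q) (Complex x \<epsilon>) = S o\<^sub>L N x \<epsilon> o\<^sub>L S"
    and "0 \<le> Im (cinner \<phi> (N x \<epsilon> \<phi>))"
proof -
  have z: "0 < Im (Complex x \<epsilon>)" using e by simp
  note R = selfadjoint_resolvent[OF selfadjoint_H_op[OF Q] z resolvent_works[OF z]]
  show "sandwiched_resolvent M (H_op h Q) (Complex x \<epsilon>) = S o\<^sub>L N x \<epsilon> o\<^sub>L S"
    unfolding sandwiched_resolvent_def R(1) adj_M N_eq[OF x e, symmetric] unfolding M_def
    by (rule blinfun_eqI) simp
  have "cinner \<phi> (N x \<epsilon> \<phi>) = cinner (adj D \<phi>) (resolvent (Complex x \<epsilon>) (adj D \<phi>))"
    unfolding N_eq[OF x e, symmetric] by (simp add: cinner_adj_left clinear_D)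
  then show "0 \<le> Im (cinner \<phi> (N x \<epsilon> \<phi>))" using R(2) by simp
qed

lemma hs_sq_N_tendsto:
  assumes x: "regular x"
  shows "((\<lambda>\<epsilon>. hs_sq (N x \<epsilon> - N x 0)) \<longlongrightarrow> 0) (at_right 0)"
proof (rule tendsto_sandwich[OF _ _ tendsto_const])
  let ?d = "\<lambda>s \<epsilon>. kernel_op p (green h (Complex (x - m s) \<epsilon>)) (J s) - kernel_op p (green h (Complex (x - m s) 0)) (J s)"
  have "N x \<epsilon> - N x 0 = (\<Sum>s\<in>I. ?d s \<epsilon>)" for \<epsilon> by (simp add: N_def sum_subtractf)
  then show "\<forall>\<^sub>F \<epsilon> in at_right 0. hs_sq (N x \<epsilon> - N x 0) \<le> of_nat (card I) * (\<Sum>s\<in>I. hs_sq (?d s \<epsilon>))"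
    by (simp add: hs_sq_sum_le[OF I])
  have "((\<lambda>\<epsilon>. hs_sq (?d s \<epsilon>)) \<longlongrightarrow> 0) (at_right 0)" if s: "s \<in> I" for s
  proof (rule hs_sq_kernel_op_tendsto_0)
    show "\<forall>\<^sub>F \<epsilon> in at_right 0. \<forall>k. cmod (green h (Complex (x - m s) \<epsilon>) k) \<le> green_bound h (x - m s)"
      using eventually_at_right_less[of 0] by eventually_elim (use green_le[OF x s] in simp)
    show "((\<lambda>\<epsilon>. green h (Complex (x - m s) \<epsilon>) k) \<longlongrightarrow> green h (Complex (x - m s) 0) k) (at_right 0)" for k
      using x s by (intro tendsto_green h) (auto simp: regular_def)
  qed (use green_le[OF x s] clinear_J[OF s] hs_J[OF s] in simp_all)
  then have "((\<lambda>\<epsilon>. of_nat (card I) * (\<Sum>s\<in>I. hs_sq (?d s \<epsilon>))) \<longlongrightarrow> of_nat (card I) * (\<Sum>s\<in>I. 0)) (at_right 0)"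
    by (intro ennreal_tendsto_cmult tendsto_sum) (simp_all add: of_nat_less_top)
  then show "((\<lambda>\<epsilon>. of_nat (card I) * (\<Sum>s\<in>I. hs_sq (?d s \<epsilon>))) \<longlongrightarrow> 0) (at_right 0)" by simp
qed simp

text \<open>The energy enters only through \<open>c\<close>, so the bound is uniform wherever
  \<open>green_bound\<close> is controlled.\<close>

lemma hs_sq_N_le:
  assumes x: "regular x" and c: "\<And>s. s \<in> I \<Longrightarrow> green_bound h (x - m s) \<le> c"
  shows "hs_sq (N x 0) \<le> of_nat (card I) *
    (\<Sum>s\<in>I. hs_sq (J s) * (ennreal (c\<^sup>2) * (ennreal ((norm p)\<^sup>2) * ennreal ((norm p)\<^sup>2))))"
proof -
  have "hs_sq (N x 0) \<le> of_nat (card I) * (\<Sum>s\<in>I. hs_sq (kernel_op p (green h (Complex (x - m s) 0)) (J s)))"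
    unfolding N_def by (rule hs_sq_sum_le[OF I])
  also have "\<dots> \<le> of_nat (card I) *
    (\<Sum>s\<in>I. hs_sq (J s) * (ennreal (c\<^sup>2) * (ennreal ((norm p)\<^sup>2) * ennreal ((norm p)\<^sup>2))))"
    by (intro mult_left_mono sum_mono hs_sq_kernel_op_bound clinear_J order_trans[OF green_le[OF x] c]) simp_all
  finally show ?thesis .
qed

lemma hs_sq_sandwich_le:
  assumes "clinear_op A"
  shows "hs_sq (S o\<^sub>L A o\<^sub>L S) \<le> (ennreal ((norm S)\<^sup>2) * ennreal ((norm S)\<^sup>2)) * hs_sq A"
proof -
  have "hs_sq (S o\<^sub>L A o\<^sub>L S) \<le> ennreal ((norm S)\<^sup>2) * hs_sq (S o\<^sub>L A)"
    by (intro hs_sq_compose_right clinear_op_compose clinear assms)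
  also have "\<dots> \<le> ennreal ((norm S)\<^sup>2) * (ennreal ((norm S)\<^sup>2) * hs_sq A)"
    by (intro mult_left_mono hs_sq_compose_left) simp
  finally show ?thesis by (simp only: mult.assoc)
qed

lemma hs_bound_finite:
  "of_nat (card I) * (\<Sum>s\<in>I. hs_sq (J s) * (ennreal (c\<^sup>2) * (ennreal ((norm p)\<^sup>2) * ennreal ((norm p)\<^sup>2)))) < \<infinity>"
  using hs_J by (simp add: ennreal_mult_less_top of_nat_less_top I)

lemma boundary_value_eq:
  assumes x: "regular x"
  shows "boundary_value M (H_op h Q) x = S o\<^sub>L N x 0 o\<^sub>L S"
proof (rule boundary_value_eqI)
  have N0: "clinear_op (N x 0)" using x by (intro clinear_N) simp_all
  have "green_bound h (x - m s) \<le> (\<Sum>s\<in>I. \<bar>green_bound h (x - m s)\<bar>)" if "s \<in> I" for s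
    by (rule order_trans[OF abs_ge_self])
      (use member_le_sum[of s I "\<lambda>s. \<bar>green_bound h (x - m s)\<bar>"] I that in simp)
  from order_le_less_trans[OF hs_sq_N_le[OF x this] hs_bound_finite]
  have "hs_sq (N x 0) < \<infinity>" .
  then have "hs_sq (S o\<^sub>L N x 0 o\<^sub>L S) < \<infinity>"
    using hs_sq_sandwich_le[OF N0] by (simp add: ennreal_mult_less_top order_le_less_trans)
  then show "hilbert_schmidt (S o\<^sub>L N x 0 o\<^sub>L S)"
    unfolding hilbert_schmidt_def by (intro conjI clinear_op_compose clinear N0)
  show "((\<lambda>\<epsilon>. hs_sq (sandwiched_resolvent M (H_op h Q) (Complex x \<epsilon>) - (S o\<^sub>L N x 0 o\<^sub>L S))) \<longlongrightarrow> 0) (at_right 0)"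
  proof (rule tendsto_sandwich[OF _ _ tendsto_const])
    show "\<forall>\<^sub>F \<epsilon> in at_right 0. hs_sq (sandwiched_resolvent M (H_op h Q) (Complex x \<epsilon>) - (S o\<^sub>L N x 0 o\<^sub>L S))
        \<le> (ennreal ((norm S)\<^sup>2) * ennreal ((norm S)\<^sup>2)) * hs_sq (N x \<epsilon> - N x 0)"
      using eventually_at_right_less[of 0]
    proof eventually_elim
      case (elim \<epsilon>)
      have "sandwiched_resolvent M (H_op h Q) (Complex x \<epsilon>) - (S o\<^sub>L N x 0 o\<^sub>L S) = S o\<^sub>L (N x \<epsilon> - N x 0) o\<^sub>L S"
        unfolding sandwiched_resolvent_eq(1)[OF x elim]
        by (rule blinfun_eqI) (simp add: blinfun.diff_left blinfun.diff_right)
      moreover have "clinear_op (N x \<epsilon> - N x 0)" using elim x by (intro clinear_op_diff clinear_N) simp_all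
      ultimately show ?case using hs_sq_sandwich_le by simp
    qed
    have "((\<lambda>\<epsilon>. (ennreal ((norm S)\<^sup>2) * ennreal ((norm S)\<^sup>2)) * hs_sq (N x \<epsilon> - N x 0))
        \<longlongrightarrow> (ennreal ((norm S)\<^sup>2) * ennreal ((norm S)\<^sup>2)) * 0) (at_right 0)"
      by (intro ennreal_tendsto_cmult hs_sq_N_tendsto x) (simp add: ennreal_mult_less_top)
    then show "((\<lambda>\<epsilon>. (ennreal ((norm S)\<^sup>2) * ennreal ((norm S)\<^sup>2)) * hs_sq (N x \<epsilon> - N x 0)) \<longlongrightarrow> 0) (at_right 0)" by simp
  qed simp
qed

text \<open>For \<open>\<epsilon> > 0\<close> the sign comes from the resolvent; Hilbert-Schmidt
  convergence implies strong convergence, which preserves it.\<close>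

lemma positive_im_N:
  assumes x: "regular x"
  shows "positive_op (im_op (N x 0))"
  unfolding positive_op_def
proof (intro conjI allI)
  have N0: "clinear_op (N x 0)" using x by (intro clinear_N) simp_all
  show "selfadjoint (im_op (N x 0))" by (rule selfadjoint_im_op[OF N0])
  fix \<phi>
  \<comment> \<open>Complex linearity of \<open>N x \<epsilon>\<close> is known for
    \<open>\<epsilon> \<ge> 0\<close>, while \<open>tendsto_apply_of_hs_sq\<close> asks for it at
    every parameter; truncation changes nothing to the right of \<open>0\<close>.\<close>
  have "((\<lambda>\<epsilon>. N x (max 0 \<epsilon>) \<phi>) \<longlongrightarrow> N x 0 \<phi>) (at_right 0)"
  proof (rule tendsto_apply_of_hs_sq)
    show "clinear_op (N x (max 0 \<epsilon>) - N x 0)" for \<epsilon> using x by (intro clinear_op_diff clinear_N) simp_all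
    have "\<forall>\<^sub>F \<epsilon> in at_right 0. hs_sq (N x \<epsilon> - N x 0) = hs_sq (N x (max 0 \<epsilon>) - N x 0)"
      using eventually_at_right_less[of 0] by eventually_elim simp
    then show "((\<lambda>\<epsilon>. hs_sq (N x (max 0 \<epsilon>) - N x 0)) \<longlongrightarrow> 0) (at_right 0)"
      using hs_sq_N_tendsto[OF x] by (simp add: tendsto_cong)
  qed
  then have "((\<lambda>\<epsilon>. Im (cinner \<phi> (N x (max 0 \<epsilon>) \<phi>))) \<longlongrightarrow> Im (cinner \<phi> (N x 0 \<phi>))) (at_right 0)"
    by (intro tendsto_Im cinner.tendsto tendsto_const)
  moreover have "\<forall>\<^sub>F \<epsilon> in at_right 0. 0 \<le> Im (cinner \<phi> (N x (max 0 \<epsilon>) \<phi>))"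
    using eventually_at_right_less[of 0] by eventually_elim (simp add: sandwiched_resolvent_eq(2)[OF x])
  ultimately have "0 \<le> Im (cinner \<phi> (N x 0 \<phi>))" by (rule tendsto_lowerbound) simp
  then show "0 \<le> Re (cinner \<phi> (im_op (N x 0) \<phi>))" by (simp add: cinner_im_op[OF N0])
qed

text \<open>Only the diagonal of the kernel enters the trace of the imaginary part.\<close>

lemma trace_im_N_le:
  assumes x: "regular x" and c: "\<And>s. s \<in> I \<Longrightarrow> green_bound h (x - m s) \<le> c" "0 \<le> c"
    and E: "is_onb E"
  shows "(\<Sum>\<^sub>\<infinity>n. \<Sum>\<^sub>\<infinity>e\<in>E. ennreal (inner (tensor_vec (delta n) e) (im_op (N x 0) (tensor_vec (delta n) e))))
    \<le> ennreal (real (card I) * c) * ennreal ((norm p)\<^sup>2) * hs_sq K"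
proof -
  have N0: "clinear_op (N x 0)" using x by (intro clinear_N) simp_all
  \<comment> \<open>Both weights sit at the same site, and the fiber part is the form of
    \<open>P s\<close> at \<open>adj K e\<close>, at most the squared norm of that vector. Summing
    these diagonal bounds gives the squared norms of \<open>p\<close> and \<open>K\<close>.\<close>
  have diag: "inner (tensor_vec (delta n) e) (im_op (N x 0) (tensor_vec (delta n) e))
      \<le> real (card I) * c * (cmod (ell2_apply p n))\<^sup>2 * (norm (adj K e))\<^sup>2" for n e
  proof -
    let ?g = "\<lambda>s. green h (Complex (x - m s) 0)"
    have kd: "ell2_apply (kernel_op p (?g s) (J s) (tensor_vec (delta n) e)) n
        = (ell2_apply p n * (?g s 0 * ell2_apply p n)) *\<^sub>C J s e" if "s \<in> I" for s
      using kernel_op_tensor_delta[where a = "?g s", OF green_le[OF x that order_refl], of p "J s" n e n]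
      by simp
    have "cinner (tensor_vec (delta n) e) (N x 0 (tensor_vec (delta n) e))
        = (\<Sum>s\<in>I. cinner e ((ell2_apply p n * (?g s 0 * ell2_apply p n)) *\<^sub>C J s e))"
      unfolding cinner_tensor_delta N_def blinfun.sum_left sum_ell2_apply cinner.sum_right
      by (intro sum.cong refl arg_cong[of _ _ "cinner e"]) (rule kd)
    also have "cmod \<dots> \<le> (\<Sum>s\<in>I. c * (cmod (ell2_apply p n))\<^sup>2 * (norm (adj K e))\<^sup>2)"
    proof (rule order_trans[OF norm_sum], rule sum_mono)
      fix s assume s: "s \<in> I"
      have "cinner e (J s e) = cinner (adj K e) (P s (adj K e))"
        by (simp add: J_def cinner_adj_left clinear)
      also have "cmod \<dots> \<le> norm (adj K e) * norm (P s (adj K e))" by (rule cmod_cinner_le)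
      also have "\<dots> \<le> norm (adj K e) * norm (adj K e)"
        using norm_blinfun[of "P s" "adj K e"] mult_right_mono[OF P(2)[OF s], of "norm (adj K e)"]
        by (intro mult_left_mono) simp_all
      finally have 1: "cmod (cinner e (J s e)) \<le> (norm (adj K e))\<^sup>2" by (simp add: power2_eq_square)
      have 2: "cmod (?g s 0) \<le> c" using green_le[OF x s, of 0 0] c(1)[OF s] by simp
      have "cmod (cinner e ((ell2_apply p n * (?g s 0 * ell2_apply p n)) *\<^sub>C J s e))
          = (cmod (ell2_apply p n))\<^sup>2 * (cmod (?g s 0) * cmod (cinner e (J s e)))"
        by (simp add: cinner_scaleC_right norm_mult power2_eq_square mult_ac)
      also have "\<dots> \<le> (cmod (ell2_apply p n))\<^sup>2 * (c * (norm (adj K e))\<^sup>2)"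
        using c(2) by (intro mult_left_mono mult_mono 1 2) simp_all
      finally show "cmod (cinner e ((ell2_apply p n * (?g s 0 * ell2_apply p n)) *\<^sub>C J s e))
          \<le> c * (cmod (ell2_apply p n))\<^sup>2 * (norm (adj K e))\<^sup>2" by (simp add: mult_ac)
    qed
    finally have "cmod (cinner (tensor_vec (delta n) e) (N x 0 (tensor_vec (delta n) e)))
        \<le> real (card I) * c * (cmod (ell2_apply p n))\<^sup>2 * (norm (adj K e))\<^sup>2" by (simp add: mult_ac)
    moreover have "inner (tensor_vec (delta n) e) (im_op (N x 0) (tensor_vec (delta n) e))
        = Im (cinner (tensor_vec (delta n) e) (N x 0 (tensor_vec (delta n) e)))"
      by (simp add: inner_eq_Re_cinner cinner_im_op[OF N0])
    ultimately show ?thesis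
      using abs_Im_le_cmod[of "cinner (tensor_vec (delta n) e) (N x 0 (tensor_vec (delta n) e))"] by linarith
  qed
  have col: "(\<Sum>\<^sub>\<infinity>e\<in>E. X * ennreal ((norm (adj K e))\<^sup>2)) = hs_sq K * X" for X
    unfolding infsum_cmult_ennreal hs_sq_eq_infsum[OF clinear(3) E, symmetric] hs_sq_adj[OF clinear(2)]
    by (rule mult.commute)
  have "(\<Sum>\<^sub>\<infinity>n. \<Sum>\<^sub>\<infinity>e\<in>E. ennreal (inner (tensor_vec (delta n) e) (im_op (N x 0) (tensor_vec (delta n) e))))
      \<le> (\<Sum>\<^sub>\<infinity>n. \<Sum>\<^sub>\<infinity>e\<in>E. (ennreal (real (card I) * c) * ennreal ((cmod (ell2_apply p n))\<^sup>2)) * ennreal ((norm (adj K e))\<^sup>2))"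
    using c(2) by (intro infsum_mono_ennreal)
      (simp add: ennreal_mult[symmetric] ennreal_leI[OF diag])
  also have "\<dots> = (\<Sum>\<^sub>\<infinity>n. hs_sq K * (ennreal (real (card I) * c) * ennreal ((cmod (ell2_apply p n))\<^sup>2)))"
    by (simp only: col)
  also have "\<dots> = hs_sq K * (ennreal (real (card I) * c) * ennreal ((norm p)\<^sup>2))"
    unfolding infsum_cmult_ennreal norm_ell2_sq_ennreal[symmetric] ..
  finally show ?thesis by (simp only: mult.commute)
qed

text \<open>\<open>C\<close> is fixed before \<open>x\<close>: \<open>a\<close> bounds the squared
  Hilbert-Schmidt norm of the real part and \<open>b\<close> the trace of the imaginary part, both
  depending on the energy only through \<open>c\<close>.\<close>

lemma ssf_integrals_bounded:
  assumes c: "0 \<le> c"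
  shows "\<exists>C. \<forall>x. regular x \<longrightarrow> (\<forall>s\<in>I. green_bound h (x - m s) \<le> c) \<longrightarrow>
    (let A = re_op (boundary_value M (H_op h Q) x); B = im_op (boundary_value M (H_op h Q) x)
     in (\<integral>\<^sup>+t. ennreal_of_enat (count_plus 1 (A + t *\<^sub>R B)) * ennreal (1 / (1 + t\<^sup>2)) \<partial>lborel) \<le> ennreal C \<and>
        (\<integral>\<^sup>+t. ennreal_of_enat (count_minus 1 (A + t *\<^sub>R B)) * ennreal (1 / (1 + t\<^sup>2)) \<partial>lborel) \<le> ennreal C)"
proof -
  obtain E :: "'g set" where E: "is_onb E" using ex_onb by blast
  let ?a = "4 * ((ennreal ((norm S)\<^sup>2) * ennreal ((norm S)\<^sup>2)) * (of_nat (card I) *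
    (\<Sum>s\<in>I. hs_sq (J s) * (ennreal (c\<^sup>2) * (ennreal ((norm p)\<^sup>2) * ennreal ((norm p)\<^sup>2))))))"
  let ?b = "ennreal ((norm S)\<^sup>2) * (ennreal (real (card I) * c) * ennreal ((norm p)\<^sup>2) * hs_sq K)"
  have "?a < \<infinity>" using hs_bound_finite[of c] by (simp add: ennreal_mult_less_top)
  then obtain a where a: "0 \<le> a" "?a = ennreal a" by (cases ?a) auto
  have "?b < \<infinity>" using K by (simp add: ennreal_mult_less_top hilbert_schmidt_def)
  then obtain b where b: "0 \<le> b" "?b = ennreal b" by (cases ?b) auto
  show ?thesis
  proof (intro exI[of _ "4 * a * pi + 8 * b"] allI impI)
    fix x assume x: "regular x" and "\<forall>s\<in>I. green_bound h (x - m s) \<le> c"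
    then have cx: "\<And>s. s \<in> I \<Longrightarrow> green_bound h (x - m s) \<le> c" by blast
    define L where "L = S o\<^sub>L N x 0 o\<^sub>L S"
    have N0: "clinear_op (N x 0)" using x by (intro clinear_N) simp_all
    have L: "clinear_op L" unfolding L_def by (intro clinear_op_compose clinear N0)
    have A: "(\<Sum>f\<in>F. (norm (re_op L f))\<^sup>2) \<le> a" if F: "finite F" "orthonormal F" for F
    proof -
      have "ennreal (\<Sum>f\<in>F. (norm (re_op L f))\<^sup>2) \<le> hs_sq (re_op L)"
        using sum_orthonormal_le_hs_sq[OF clinear_op_re_im_op(1)[OF L] F(2,1)] by (simp add: sum_ennreal)
      also have "\<dots> \<le> 4 * hs_sq L" by (rule hs_sq_re_op_le[OF L])
      also have "\<dots> \<le> 4 * ((ennreal ((norm S)\<^sup>2) * ennreal ((norm S)\<^sup>2)) * hs_sq (N x 0))"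
        unfolding L_def by (intro mult_left_mono hs_sq_sandwich_le N0) simp
      also have "\<dots> \<le> ?a" by (intro mult_left_mono hs_sq_N_le x cx) simp_all
      finally show ?thesis unfolding a(2) using a(1) by simp
    qed
    \<comment> \<open>Conjugation by the self-adjoint \<open>S\<close> commutes with taking
      imaginary parts, so \<open>trace_compose_le\<close> reduces the trace to that of the imaginary
      part of \<open>N\<close>.\<close>
    have im: "inner f (im_op L f) = inner (S f) (im_op (N x 0) (S f))" for f
    proof -
      have "cinner f (L f) = cinner (S f) (N x 0 (S f))"
        using S by (simp add: L_def selfadjoint_def)
      then show ?thesis by (simp add: inner_eq_Re_cinner cinner_im_op L N0)
    qed
    note Y = positive_im_N[OF x]
    have pos: "positive_op (im_op L)"
      using selfadjoint_im_op[OF L] Y im by (simp add: positive_op_def inner_eq_Re_cinner[symmetric])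
    have B: "(\<Sum>f\<in>F. inner f (im_op L f)) \<le> b" if F: "finite F" "orthonormal F" for F
    proof -
      have nn: "0 \<le> inner f (im_op L f)" for f using pos by (simp add: positive_op_def inner_eq_Re_cinner)
      have "ennreal (\<Sum>f\<in>F. inner f (im_op L f)) = (\<Sum>f\<in>F. ennreal (inner (S f) (im_op (N x 0) (S f))))"
        unfolding im[symmetric] using nn by (intro sum_ennreal[symmetric])
      also have "\<dots> \<le> ennreal ((norm S)\<^sup>2) *
          (\<Sum>\<^sub>\<infinity>e\<in>(\<lambda>(n, e). tensor_vec (delta n) e) ` (UNIV \<times> E). ennreal (inner e (im_op (N x 0) e)))"
        by (rule trace_compose_le[OF Y clinear(4) F is_onb_tensor_delta[OF E]])
      also have "\<dots> \<le> ?b"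
        by (intro mult_left_mono order_trans[OF infsum_tensor_delta_le trace_im_N_le[OF x cx c E]]) simp_all
      finally show ?thesis unfolding b(2) using b(1) by simp
    qed
    show "let A = re_op (boundary_value M (H_op h Q) x); B = im_op (boundary_value M (H_op h Q) x)
     in (\<integral>\<^sup>+t. ennreal_of_enat (count_plus 1 (A + t *\<^sub>R B)) * ennreal (1 / (1 + t\<^sup>2)) \<partial>lborel) \<le> ennreal (4 * a * pi + 8 * b) \<and>
        (\<integral>\<^sup>+t. ennreal_of_enat (count_minus 1 (A + t *\<^sub>R B)) * ennreal (1 / (1 + t\<^sup>2)) \<partial>lborel) \<le> ennreal (4 * a * pi + 8 * b)"
      unfolding boundary_value_eq[OF x] L_def[symmetric] Let_def
      using nn_integral_count_le[OF selfadjoint_re_op[OF L] A pos B] by blast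
  qed
qed

end

section \<open>From the counting integrals to the spectral shift function\<close>

lemma abs_ssf_le:
  assumes H: "H = H0 + (adj M o\<^sub>L M) \<or> H = H0 - (adj M o\<^sub>L M)"
    and le: "let A = re_op (boundary_value M H0 x); B = im_op (boundary_value M H0 x)
     in (\<integral>\<^sup>+t. ennreal_of_enat (count_plus 1 (A + t *\<^sub>R B)) * ennreal (1 / (1 + t\<^sup>2)) \<partial>lborel) \<le> ennreal C \<and>
        (\<integral>\<^sup>+t. ennreal_of_enat (count_minus 1 (A + t *\<^sub>R B)) * ennreal (1 / (1 + t\<^sup>2)) \<partial>lborel) \<le> ennreal C"
  shows "\<bar>ssf M H H0 x\<bar> \<le> ereal (1 / pi * max 0 C)"
proof -
  have *: "\<bar>ereal (1 / pi) * enn2ereal X\<bar> \<le> ereal (1 / pi * max 0 C)" if "X \<le> ennreal C" for X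
  proof -
    have "enn2ereal X \<le> enn2ereal (ennreal C)" using that by (simp add: less_eq_ennreal.rep_eq)
    \<comment> \<open>\<open>ennreal\<close> truncates a negative \<open>C\<close> to
      \<open>0\<close>.\<close>
    also have "\<dots> = ereal (max 0 C)" by (cases "0 \<le> C") (simp_all add: ennreal_neg max_def zero_ennreal.rep_eq zero_ereal_def)
    finally have "ereal (1 / pi) * enn2ereal X \<le> ereal (1 / pi) * ereal (max 0 C)"
      by (intro ereal_mult_left_mono) simp_all
    also have "\<dots> = ereal (1 / pi * max 0 C)" by (rule times_ereal.simps)
    finally have "ereal (1 / pi) * enn2ereal X \<le> ereal (1 / pi * max 0 C)" .
    moreover have "0 \<le> ereal (1 / pi) * enn2ereal X" by (intro ereal_0_le_mult) simp_all
    ultimately show ?thesis by (simp only: abs_ereal_ge0)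
  qed
  \<comment> \<open>Whichever branch the test in \<open>ssf\<close> selects, its counting integral
    is controlled.\<close>
  show ?thesis
    using le H * by (auto simp: ssf_def Let_def)
qed

text \<open>The square of \<psi> is at most \<open>|n| powr (- \<nu>0)\<close> away from the origin;
  this is where \<open>\<nu>0 > 1\<close> enters.\<close>

lemma psi_square_summable:
  assumes "1 < \<nu>0"
  shows "(\<lambda>n. (norm (psi \<nu>0 n))\<^sup>2) summable_on UNIV"
proof -
  define f where "f n = (sqrt (1 + (real n)\<^sup>2) powr (- \<nu>0 / 2))\<^sup>2" for n :: nat
  have "norm (f n) \<le> of_nat n powr (- \<nu>0)" if "1 \<le> n" for n
  proof -
    have "f n = sqrt (1 + (real n)\<^sup>2) powr (- \<nu>0)"
      by (simp add: f_def powr_powr power2_eq_square powr_add[symmetric])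
    also have "\<dots> \<le> real n powr (- \<nu>0)"
      using that assms by (intro powr_mono2') (auto intro: real_le_rsqrt)
    finally show ?thesis by (simp add: f_def)
  qed
  then have "summable f"
    by (intro summable_comparison_test'[OF summable_real_powr_iff[THEN iffD2], of "- \<nu>0" 1]) (use assms in auto)
  from summable_on_int_abs[OF this]
  show ?thesis by (simp add: f_def psi_def)
qed

theorem theorem5p1:
  fixes h \<nu>0 :: real
    and Q K :: "'g::{complex_hilbert, second_countable_topology} \<Rightarrow>\<^sub>L 'g"
    and d :: nat and \<mu> :: "nat \<Rightarrow> real"
    and W V M :: "'g ell2 \<Rightarrow>\<^sub>L 'g ell2"
    and \<Gamma> :: "real set"
  assumes "h > 0"
    and "selfadjoint Q"
    and "Q = 0 \<or> (Q \<noteq> 0 \<and> eigen_decomposition Q d \<mu>)"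
    and "\<nu>0 > 1"
    and "positive_op W"
    and "hilbert_schmidt K"
    and "V = tensor_op (mult_op (psi \<nu>0)) (adj K) o\<^sub>L W o\<^sub>L tensor_op (mult_op (psi \<nu>0)) K"
    and "M = sqrt_op W o\<^sub>L tensor_op (mult_op (psi \<nu>0)) K"
    and "compact \<Gamma>" and "\<Gamma> \<subseteq> UNIV - threshold_set h Q d \<mu>"
  shows "(SUP x\<in>\<Gamma>. \<bar>ssf M (H_op h Q + V) (H_op h Q) x\<bar>) < \<infinity> \<and>
         (SUP x\<in>\<Gamma>. \<bar>ssf M (H_op h Q - V) (H_op h Q) x\<bar>) < \<infinity>"
proof -
  obtain I :: "nat set" and P :: "nat \<Rightarrow> 'g \<Rightarrow>\<^sub>L 'g" and m
    where I: "finite I" and P: "\<And>s. s \<in> I \<Longrightarrow> selfadjoint (P s)" "\<And>s. s \<in> I \<Longrightarrow> norm (P s) \<le> 1"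
      "\<And>s x. s \<in> I \<Longrightarrow> Q (blinfun_apply (P s) x) = m s *\<^sub>R P s x" "\<And>x. (\<Sum>s\<in>I. P s x) = x"
    and thr: "threshold_set h Q d \<mu> = (\<Union>s\<in>I. {m s, m s + 4 / h\<^sup>2})"
    by (rule ex_spectral_family[OF assms(2,3), where h = h], rule that)
  define p where "p = Abs_ell2 (psi \<nu>0)"
  have p: "ell2_apply p = psi \<nu>0"
    unfolding p_def by (subst Abs_ell2_inverse) (use psi_square_summable[OF assms(4)] in auto)
  note W = sqrt_op_works[OF assms(5)]
  interpret L: lattice_hamiltonian h Q K I m P p "sqrt_op W"
    by unfold_locales (use assms I P W in \<open>auto simp: positive_op_def p psi_def\<close>)
  have M: "M = L.M" unfolding L.M_def L.D_def p assms(8) ..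
  have WW: "sqrt_op W (sqrt_op W x) = W x" for x
    by (subst (3) W(2)[symmetric]) simp
  \<comment> \<open>As \<psi> is real, the left factor of \<open>V\<close> is the adjoint of the
    right one, and the two roots of \<open>W\<close> multiply to \<open>W\<close>. Both
    perturbations thus have the form that \<open>ssf\<close> tests for.\<close>
  have "V = adj M o\<^sub>L M"
    unfolding M L.adj_M L.adj_D p assms(7) unfolding L.M_def L.D_def p
    by (rule blinfun_eqI) (simp add: WW)
  then have H: "H_op h Q + V = H_op h Q + (adj M o\<^sub>L M)" "H_op h Q - V = H_op h Q - (adj M o\<^sub>L M)" by simp_all
  have avoid: "x \<noteq> m s" "h\<^sup>2 * (x - m s) \<noteq> 4" if "x \<in> \<Gamma>" "s \<in> I" for x s
  proof -
    have "x \<noteq> m s" "x \<noteq> m s + 4 / h\<^sup>2" using assms(10) that by (auto simp: thr)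
    then show "x \<noteq> m s" "h\<^sup>2 * (x - m s) \<noteq> 4" using assms(1) by (auto simp: field_simps)
  qed
  \<comment> \<open>Compactness enters here: \<open>green_bound\<close> is continuous off the
    thresholds and hence bounded on \<open>\<Gamma>\<close>.\<close>
  have "\<exists>c. \<forall>x\<in>\<Gamma>. green_bound h (x - m s) \<le> c" if "s \<in> I" for s
  proof -
    have "compact ((\<lambda>x. green_bound h (x - m s)) ` \<Gamma>)"
      using avoid[OF _ that] assms(1,9) by (intro compact_continuous_image continuous_on_green_bound) auto
    then have "bdd_above ((\<lambda>x. green_bound h (x - m s)) ` \<Gamma>)"
      by (intro bounded_imp_bdd_above compact_imp_bounded)
    then show ?thesis by (auto simp: bdd_above_def)
  qed
  then obtain c where c: "\<And>x s. x \<in> \<Gamma> \<Longrightarrow> s \<in> I \<Longrightarrow> green_bound h (x - m s) \<le> c s" by metis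
  \<comment> \<open>The sum of absolute values is a nonnegative bound common to all eigenvalues of
    \<open>Q\<close>.\<close>
  have "green_bound h (x - m s) \<le> (\<Sum>s\<in>I. \<bar>c s\<bar>)" if "x \<in> \<Gamma>" "s \<in> I" for x s
    using c[OF that] member_le_sum[of s I "\<lambda>s. \<bar>c s\<bar>"] I that(2) by fastforce
  moreover have "L.regular x" if "x \<in> \<Gamma>" for x
    using avoid[OF that] by (simp add: L.regular_def)
  moreover have "0 \<le> (\<Sum>s\<in>I. \<bar>c s\<bar>)" by (simp add: sum_nonneg)
  ultimately obtain C where C: "\<And>x. x \<in> \<Gamma> \<Longrightarrow>
    (let A = re_op (boundary_value M (H_op h Q) x); B = im_op (boundary_value M (H_op h Q) x)
     in (\<integral>\<^sup>+t. ennreal_of_enat (count_plus 1 (A + t *\<^sub>R B)) * ennreal (1 / (1 + t\<^sup>2)) \<partial>lborel) \<le> ennreal C \<and>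
        (\<integral>\<^sup>+t. ennreal_of_enat (count_minus 1 (A + t *\<^sub>R B)) * ennreal (1 / (1 + t\<^sup>2)) \<partial>lborel) \<le> ennreal C)"
    using L.ssf_integrals_bounded unfolding M by meson
  have "(SUP x\<in>\<Gamma>. \<bar>ssf M H (H_op h Q) x\<bar>) < \<infinity>"
    if "H = H_op h Q + (adj M o\<^sub>L M) \<or> H = H_op h Q - (adj M o\<^sub>L M)" for H
  proof -
    have "(SUP x\<in>\<Gamma>. \<bar>ssf M H (H_op h Q) x\<bar>) \<le> ereal (1 / pi * max 0 C)"
      by (intro SUP_least abs_ssf_le that C)
    also have "\<dots> < \<infinity>" by simp
    finally show ?thesis .
  qed
  then show ?thesis unfolding H by blast
qed

end
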